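(* $$b_{94,7}=\left(412\sqrt{7}-159\sqrt{47}\right)\left(732\sqrt{2}-151\sqrt{47}\right).$$
   Context: For $|q|<1$ put $\varphi(q)=\sum_{k=-\infty}^{\infty}q^{k^2}$ and $\psi(q)=\sum_{k=0}^{\infty}q^{k(k+1)/2}$. For a positive rational number $m$ and a positive integer $n$ define $$b_{m,n}=\frac{n\,e^{-\frac{\pi}{4}(n-1)\sqrt{m/n}}\;\psi^2\!\left(-e^{-\pi\sqrt{mn}}\right)\varphi^2\!\left(-e^{-2\pi\sqrt{mn}}\right)}{\psi^2\!\left(-e^{-\pi\sqrt{m/n}}\right)\varphi^2\!\left(-e^{-2\pi\sqrt{m/n}}\right)}.$$ *)

theory Defs
  imports "HOL-Analysis.Analysis"
begin

(* Both series are meaningful only for norm q < 1, where they converge absolutely; elsewhere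
   infsum and suminf return unspecified or default values. The exponents k^2 are nonnegative,
   so powi never inverts q here, and q powi 0 = 1 even for q = 0. *)

definition ramanujan_phi :: "'a::{real_normed_field, banach} \<Rightarrow> 'a" where
  "ramanujan_phi q = (\<Sum>\<^sub>\<infinity>k\<in>(UNIV :: int set). q powi (k\<^sup>2))"

definition ramanujan_psi :: "'a::{real_normed_field, banach} \<Rightarrow> 'a" where
  "ramanujan_psi q = (\<Sum>k::nat. q ^ (k * (k + 1) div 2))"

(* Only positive m and n are intended. *)
definition b :: "rat \<Rightarrow> nat \<Rightarrow> real" where
  "b m n =
     (real n * exp (- (pi / 4) * (real n - 1) * sqrt (real_of_rat m / real n))
        * (ramanujan_psi (- exp (- pi * sqrt (real_of_rat m * real n))))\<^sup>2
        * (ramanujan_phi (- exp (- 2 * pi * sqrt (real_of_rat m * real n))))\<^sup>2)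
     / ((ramanujan_psi (- exp (- pi * sqrt (real_of_rat m / real n))))\<^sup>2
        * (ramanujan_phi (- exp (- 2 * pi * sqrt (real_of_rat m / real n))))\<^sup>2)"

end

theory Submission
  imports Defs "HOL-Number_Theory.Number_Theory" "HOL-Computational_Algebra.Squarefree"
    "HOL-Real_Asymp.Real_Asymp"
begin

text \<open>
  Put \<open>q = exp (- pi * sqrt (94 / 7))\<close> and \<open>f(x) = (1 - x) (1 - x^2) (1 - x^3) \<dots>\<close>. Gauss's product formulas
  give \<open>\<psi>(-q) \<phi>(-q^2) = f(q) f(q^2)\<close>, so that \<open>b 94 7\<close> is an eta quotient whose four factors belong to the
  forms \<open>a x^2 + (658 / a) y^2\<close> with \<open>a = 1, 2, 7, 14\<close>; these are the classes of order at most two among the eight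
  classes of discriminant \<open>-2632\<close>. The combination \<open>r1 + r2 - r7 - r14\<close> of their representation numbers is a sum
  of two genus characters, namely those of the factorisations \<open>-2632 = (-8) 329 = (-7) 376\<close>. Hence the same
  combination of Epstein zeta functions equals \<open>L(s,-8) L(s,329) + L(s,-7) L(s,376)\<close>. As \<open>s\<close> tends to 1 the
  left-hand side yields \<open>ln (b 94 7)\<close> (Kronecker's limit formula), and the right-hand side yields the
  logarithms of the fundamental units of \<open>Q(sqrt 329)\<close> and \<open>Q(sqrt 94)\<close>.
\<close>

subsection \<open>Quadratic characters\<close>

text \<open>The class group is Z/2 x Z/4, so no single genus character isolates the classes of order
  at most two. The product of the two genus characters is the one attached to 47: it is 1 on those
  four classes and -1 on the other four, whose reduced forms begin with 19 and 23. The sum of the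
  two characters therefore vanishes on the latter, and on the former it is twice
  \<open>chi8\<close>, which explains the four signs. Ideals are replaced by square roots of -658
  modulo m, and only real s > 1 occurs. The limit s -> 1 exists because the four signs add up to
  zero, so that the poles cancel; the derivative of \<open>c powr (1 - s)\<close> that they leave
  behind produces the factor 7 of \<open>b 94 7\<close>. Its exponential prefactor comes from the
  rows y = 0 of the lattice sums. The four L-values come from splitting cyclotomic polynomials into
  two conjugate factors over a quadratic field: a real field yields the logarithm of a unit, an
  imaginary one an angle.\<close>

text \<open>\<open>chi8\<close>, \<open>chi7\<close>, \<open>chi47\<close> are the Kronecker symbols of the discriminants \<open>-8\<close>, \<open>-7\<close>, \<open>-47\<close>; their products
  below belong to \<open>-2632\<close>, \<open>329\<close> and \<open>376\<close>.\<close>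

definition chi8 :: "int \<Rightarrow> int" where
  "chi8 n = (if n mod 8 \<in> {1, 3} then 1 else if n mod 8 \<in> {5, 7} then -1 else 0)"

definition chi7 :: "int \<Rightarrow> int" where
  "chi7 n = (if n mod 7 = 0 then 0 else if n mod 7 \<in> {1, 2, 4} then 1 else -1)"

definition chi47 :: "int \<Rightarrow> int" where
  "chi47 n = (if n mod 47 = 0 then 0 else if n mod 47 \<in> {1, 2, 3, 4, 6, 7, 8, 9, 12, 14, 16, 17,
     18, 21, 24, 25, 27, 28, 32, 34, 36, 37, 42} then 1 else -1)"

text \<open>Turns quadratic residuosity into membership in a finite set that can be
  computed.\<close>

lemma QuadRes_iff_mod:
  assumes "p > 0"
  shows "QuadRes p a \<longleftrightarrow> a mod p \<in> (\<lambda>y. y\<^sup>2 mod p) ` {0..<p}"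
proof
  assume "QuadRes p a"
  then obtain y where "[y\<^sup>2 = a] (mod p)" by (auto simp: QuadRes_def)
  hence "a mod p = (y mod p)\<^sup>2 mod p" using power_mod[of y p 2] by (simp add: Cong.cong_def)
  thus "a mod p \<in> (\<lambda>y. y\<^sup>2 mod p) ` {0..<p}" using assms by (intro image_eqI[of _ _ "y mod p"]) auto
next
  assume "a mod p \<in> (\<lambda>y. y\<^sup>2 mod p) ` {0..<p}"
  thus "QuadRes p a" by (auto simp: QuadRes_def Cong.cong_def)
qed

lemma chi7_Legendre: "chi7 n = Legendre n 7"
proof -
  have "(\<lambda>y. y\<^sup>2 mod 7) ` {0..<7::int} = {0, 1, 2, 4}" by code_simp
  thus ?thesis unfolding chi7_def Legendre_def QuadRes_iff_mod[of 7, simplified] by (auto simp: cong_0_iff dvd_eq_mod_eq_0)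
qed

lemma chi47_Legendre: "chi47 n = Legendre n 47"
proof -
  define S where "S = {1, 2, 3, 4, 6, 7, 8, 9, 12, 14, 16, 17,
     18, 21, 24, 25, 27, 28, 32, 34, 36, 37, 42::int}"
  have "(\<lambda>y. y\<^sup>2 mod 47) ` {0..<47::int} = insert 0 S" unfolding S_def by code_simp
  moreover have "chi47 n = (if n mod 47 = 0 then 0 else if n mod 47 \<in> S then 1 else -1)"
    unfolding chi47_def S_def ..
  moreover have "[n = 0] (mod 47) \<longleftrightarrow> n mod 47 = 0" by (simp add: Cong.cong_def)
  ultimately show ?thesis unfolding Legendre_def QuadRes_iff_mod[of 47, simplified] by simp
qed

text \<open>Euler's criterion makes the two sides congruent modulo \<open>p\<close>. Both lie in
  {-1, 0, 1}, so they differ by at most 2 < \<open>p\<close> and must agree.\<close>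

lemma Legendre_mult:
  fixes a b :: int
  assumes "prime p" "2 < p"
  shows "Legendre (a * b) (int p) = Legendre a p * Legendre b p"
proof -
  have "[Legendre (a * b) p = (a * b) ^ ((p - 1) div 2)] (mod p)" by (rule euler_criterion[OF assms])
  moreover have "[Legendre a p * Legendre b p = a ^ ((p - 1) div 2) * b ^ ((p - 1) div 2)] (mod p)"
    by (intro cong_mult euler_criterion assms)
  ultimately have "[Legendre (a * b) p = Legendre a p * Legendre b p] (mod p)"
    by (metis power_mult_distrib cong_sym cong_trans)
  hence d: "int p dvd Legendre (a * b) p - Legendre a p * Legendre b p" by (simp add: cong_iff_dvd_diff)
  have "\<bar>Legendre (a * b) p - Legendre a p * Legendre b p\<bar> \<le> 2"
    by (auto simp: Legendre_def)
  hence "\<bar>Legendre (a * b) p - Legendre a p * Legendre b p\<bar> < int p" using assms by linarith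
  thus ?thesis using d dvd_imp_le_int[of "Legendre (a * b) p - Legendre a p * Legendre b p" "int p"] by linarith
qed

lemma chi7_mult:
  fixes a b :: int
  shows "chi7 (a * b) = chi7 a * chi7 b"
  using Legendre_mult[of 7 a b] by (simp add: chi7_Legendre)

lemma chi47_mult:
  fixes a b :: int
  shows "chi47 (a * b) = chi47 a * chi47 b"
proof -
  have "prime (47::nat)" by simp
  thus ?thesis using Legendre_mult[of 47 a b] by (simp add: chi47_Legendre)
qed

lemma chi8_mod: "chi8 (n mod 8) = chi8 n"
  by (simp add: chi8_def)

lemma chi8_mult:
  fixes a b :: int
  shows "chi8 (a * b) = chi8 a * chi8 b"
proof -
  have m: "n mod 8 \<in> {0,1,2,3,4,5,6,7}" for n :: int by simp presburger
  have "\<forall>x\<in>{0,1,2,3,4,5,6,7}. \<forall>y\<in>{0,1,2,3,4,5,6,7}. chi8 (x * y) = chi8 x * chi8 y"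
    by (simp add: chi8_def)
  hence "chi8 ((a mod 8) * (b mod 8)) = chi8 (a mod 8) * chi8 (b mod 8)" using m by blast
  thus ?thesis by (metis chi8_mod mod_mult_eq)
qed

text \<open>Gauss's lemma with multiplier 2: the sign is the parity of the number of
  \<open>x\<close> in 1..h, where \<open>p = 2 * h + 1\<close>, whose double exceeds
  \<open>h\<close>. This number is \<open>h - h div 2\<close>; its parity depends on
  \<open>h\<close> modulo 4, that is, on \<open>p\<close> modulo 8.\<close>

lemma Legendre_2:
  assumes "prime p" "2 < (p::nat)"
  shows "Legendre 2 p = (if p mod 8 \<in> {1, 7} then 1 else -1)"
proof -
  have odd: "odd p" using assms prime_odd_nat by blast
  have "\<not> [2 = 0] (mod int p)" using assms 
    by (metis cong_0_iff  int_dvd_int_iff nat_dvd_not_less of_nat_numeral zero_less_numeral)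
  then interpret G: GAUSS p 2 using assms by unfold_locales auto
  define h where "h = (int p - 1) div 2"
  have ph: "int p = 2 * h + 1" using odd unfolding h_def by presburger
  have B: "G.B = (\<lambda>x. x * 2) ` {0<..h}" unfolding G.B_def G.A_def h_def by simp
  \<comment> \<open>The doubles are at most \<open>2 * h = p - 1\<close>, so reduction modulo
    \<open>p\<close> changes nothing.\<close>
  have C: "G.C = (\<lambda>x. x * 2) ` {0<..h}" unfolding G.C_def B image_image
    by (rule image_cong) (auto simp: ph)
  have E: "G.E = (\<lambda>x. x * 2) ` {h div 2<..h}" unfolding G.E_def C h_def[symmetric] using ph by auto
  have "card G.E = nat (h - h div 2)" unfolding E by (subst card_image) (auto simp: inj_on_def)
  hence "Legendre 2 p = (-1) ^ nat (h - h div 2)" using G.gauss_lemma by simp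
  also have "\<dots> = (if even (h - h div 2) then 1 else -1)"
    using ph by (auto simp: minus_one_power_iff even_nat_iff)
  also have "even (h - h div 2) \<longleftrightarrow> int p mod 8 \<in> {1, 7}"
  proof -
    have *: ?thesis if "h = 4 * k + r" "h - h div 2 = 2 * k + t" "2 * r + 1 < 8" "0 \<le> r"
        "even t \<longleftrightarrow> 2 * r + 1 \<in> {1, 7}" for k r t
    proof -
      have "int p = 2 * r + 1 + 8 * k" using that(1) ph by simp
      hence "int p mod 8 = 2 * r + 1" using that(3,4) by simp
      thus ?thesis using that(5) unfolding that(2) by simp
    qed
    obtain k where "h = 4 * k + 0 \<or> h = 4 * k + 1 \<or> h = 4 * k + 2 \<or> h = 4 * k + 3"
      by (rule that[of "h div 4"]) presburger
    thus ?thesis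
    proof (elim disjE)
      assume h: "h = 4 * k + 0"
      have "h div 2 = 2 * k" using h by presburger
      thus ?thesis using h by (intro *[of k 0 0]) simp_all
    next
      assume h: "h = 4 * k + 1"
      have "h div 2 = 2 * k" using h by presburger
      thus ?thesis using h by (intro *[of k 1 1]) simp_all
    next
      assume h: "h = 4 * k + 2"
      have "h div 2 = 2 * k + 1" using h by presburger
      thus ?thesis using h by (intro *[of k 2 1]) simp_all
    next
      assume h: "h = 4 * k + 3"
      have "h div 2 = 2 * k + 1" using h by presburger
      thus ?thesis using h by (intro *[of k 3 2]) simp_all
    qed
  qed
  also have "\<dots> \<longleftrightarrow> p mod 8 \<in> {1, 7}"
  proof -
    have "int p mod 8 = int (p mod 8)" by (simp add: zmod_int)
    thus ?thesis by auto
  qed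
  finally show ?thesis .
qed

lemma Legendre_minus_1:
  assumes "prime p" "2 < (p::nat)"
  shows "Legendre (-1) p = (-1) ^ ((p - 1) div 2)"
proof -
  have c: "[Legendre (-1) p = (-1) ^ ((p - 1) div 2)] (mod p)" by (rule euler_criterion[OF assms])
  have "\<bar>Legendre (-1) p - (-1) ^ ((p - 1) div 2)\<bar> \<le> 2"
    by (auto simp: Legendre_def minus_one_power_iff)
  hence "\<bar>Legendre (-1) p - (-1) ^ ((p - 1) div 2)\<bar> < int p" using assms by linarith
  thus ?thesis using c dvd_imp_le_int[of "Legendre (-1) p - (-1) ^ ((p - 1) div 2)" "int p"]
    unfolding cong_iff_dvd_diff by linarith
qed

lemma chi8_Legendre:
  assumes "prime p" "2 < (p::nat)"
  shows "chi8 p = Legendre (-2) p"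
proof -
  have odd: "odd p" using assms prime_odd_nat by blast
  have L: "Legendre (-2) p = Legendre (-1) p * Legendre 2 p"
    using Legendre_mult[OF assms, of "-1" 2] by simp
  have "even ((p - 1) div 2) \<longleftrightarrow> p mod 4 = 1" using odd by presburger
  hence "Legendre (-1) p = (if p mod 4 = 1 then 1 else -1)"
    by (simp add: Legendre_minus_1[OF assms] minus_one_power_iff)
  moreover have "p mod 8 = 1 \<or> p mod 8 = 3 \<or> p mod 8 = 5 \<or> p mod 8 = 7" using odd by presburger
  moreover have "p mod 4 = p mod 8 mod 4" by (simp add: mod_mod_cancel)
  moreover have "int p mod 8 = int (p mod 8)" by (simp add: zmod_int)
  ultimately show ?thesis unfolding L Legendre_2[OF assms] chi8_def by auto
qed

definition chiD :: "int \<Rightarrow> int" where "chiD n = chi8 n * chi7 n * chi47 n"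

lemma chiD_mult:
  fixes a b :: int
  shows "chiD (a * b) = chiD a * chiD b"
  by (simp add: chiD_def chi8_mult chi7_mult chi47_mult)

text \<open>Reciprocity exchanges the symbols of 7 and 47. Both primes are 3 modulo 4, so the two
  signs \<open>(-1) ^ (e * 3)\<close> and \<open>(-1) ^ (e * 23)\<close> cancel. Hence a character
  of period 2632 decides whether -658 is a square modulo \<open>p\<close>.\<close>

lemma chiD_Legendre:
  assumes "prime p" "coprime p (658::nat)"
  shows "chiD p = Legendre (-658) p"
proof -
  have "\<not> p dvd 658"
    using coprime_common_divisor[OF assms(2) dvd_refl] not_prime_unit assms(1) by blast
  hence "p \<noteq> 2" "p \<noteq> 7" "p \<noteq> 47" by auto
  hence p2: "2 < p" using prime_ge_2_nat[OF assms(1)] by linarith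
  have odd: "odd p" using assms p2 prime_odd_nat by blast
  have p47: "prime (47::nat)" by simp
  define e where "e = (p - 1) div 2"
  have "Legendre p 7 * Legendre 7 p = (-1) ^ (e * 3)"
    using Quadratic_Reciprocity[of p 7] assms(1) p2 \<open>p \<noteq> 7\<close> by (simp add: e_def)
  moreover have "Legendre p 47 * Legendre 47 p = (-1) ^ (e * 23)"
    using Quadratic_Reciprocity[of p 47] assms(1) p2 \<open>p \<noteq> 47\<close> p47 by (simp add: e_def)
  ultimately have 1: "Legendre p 7 * Legendre 7 p * (Legendre p 47 * Legendre 47 p) = 1"
    by (simp flip: power_add)
  have L: "Legendre (-658) p = Legendre (-2) p * (Legendre 7 p * Legendre 47 p)"
    using Legendre_mult[OF assms(1) p2, of "-2" 329] Legendre_mult[OF assms(1) p2, of 7 47] by simp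
  have v: "Legendre x y \<in> {-1, 0, 1}" for x y by (auto simp: Legendre_def)
  show ?thesis unfolding chiD_def chi8_Legendre[OF assms(1) p2] chi7_Legendre chi47_Legendre L
    using 1 v[of p 7] v[of 7 p] v[of p 47] v[of 47 p] by auto
qed


lemma chi8_values: "chi8 n \<in> {-1, 0, 1}" by (simp add: chi8_def)
lemma chi7_values: "chi7 n \<in> {-1, 0, 1}" by (simp add: chi7_def)
lemma chi47_values: "chi47 n \<in> {-1, 0, 1}" by (simp add: chi47_def)

lemma chi8_odd: "odd n \<Longrightarrow> chi8 n \<noteq> 0"
proof -
  assume "odd n"
  hence "n mod 8 = 1 \<or> n mod 8 = 3 \<or> n mod 8 = 5 \<or> n mod 8 = 7" by presburger
  thus ?thesis unfolding chi8_def by auto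
qed

lemma chi_coprime:
  assumes "coprime n (658::nat)"
  shows "chi8 n \<in> {-1, 1}" "chi7 n \<in> {-1, 1}" "chi47 n \<in> {-1, 1}" "chiD n \<in> {-1, 1}"
proof -
  have *: "coprime n (2 * (7 * 47))" using assms by simp
  have "coprime n 2" "coprime n 7" "coprime n 47"
    using * unfolding coprime_mult_right_iff by blast+
  hence nd: "\<not> 2 dvd n" "\<not> 7 dvd n" "\<not> 47 dvd n"
    using coprime_common_divisor[of n 2 2] coprime_common_divisor[of n 7 7]
      coprime_common_divisor[of n 47 47] by auto
  have "chi8 n \<noteq> 0" using nd(1) by (intro chi8_odd) auto
  thus 1: "chi8 n \<in> {-1, 1}" using chi8_values[of n] by simp
  have "\<not> 7 dvd int n" "\<not> 47 dvd int n" using nd by (metis int_dvd_int_iff of_nat_numeral)+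
  hence "int n mod 7 \<noteq> 0" "int n mod 47 \<noteq> 0" by (auto simp: dvd_eq_mod_eq_0)
  thus 2: "chi7 n \<in> {-1, 1}" and 3: "chi47 n \<in> {-1, 1}" unfolding chi7_def chi47_def by simp_all
  show "chiD n \<in> {-1, 1}" using 1 2 3 unfolding chiD_def by auto
qed

subsection \<open>Square roots of -658 modulo m\<close>

text \<open>For \<open>m\<close> prime to 658 these residues stand for the primitive ideals of norm
  \<open>m\<close> in the ring generated by \<open>sqrt (-658)\<close>. One integer is taken per
  residue class, so that they can be counted.\<close>

definition roots :: "nat \<Rightarrow> int set" where
  "roots m = {x \<in> {0..<int m}. int m dvd x\<^sup>2 + 658}"

lemma finite_roots [simp]: "finite (roots m)"
  by (rule finite_subset[of _ "{0..<int m}"]) (auto simp: roots_def)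

lemma dvd_square_mod: "(m::int) dvd (x mod m)\<^sup>2 + a \<longleftrightarrow> m dvd x\<^sup>2 + a"
proof -
  have "m dvd x - x mod m" by (simp add: minus_mod_eq_mult_div)
  hence "m dvd (x - x mod m) * (x + x mod m)" by simp
  hence "m dvd (x\<^sup>2 + a) - ((x mod m)\<^sup>2 + a)" by (simp add: power2_eq_square algebra_simps)
  thus ?thesis using dvd_diff_commute by (metis dvd_diff_right_iff dvd_diff_left_iff)
qed

lemma mod_mem_roots: "m > 0 \<Longrightarrow> int m dvd x\<^sup>2 + 658 \<Longrightarrow> x mod int m \<in> roots m"
  by (simp add: roots_def dvd_square_mod)

lemma int_interval_eqI:
  assumes "(0::int) \<le> x" "x < m" "0 \<le> y" "y < m" "m dvd x - y"
  shows "x = y"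
proof (rule ccontr)
  assume "x \<noteq> y"
  hence "\<bar>m\<bar> \<le> \<bar>x - y\<bar>" using dvd_imp_le_int[OF _ assms(5)] by simp
  thus False using assms by linarith
qed

text \<open>Chinese remainder theorem, applied to the pairs of residues.\<close>

lemma card_roots_mult:
  assumes "coprime m n" "m > 0" "n > 0"
  shows "card (roots (m * n)) = card (roots m) * card (roots n)"
proof -
  have cop: "coprime (int m) (int n)" using assms by simp
  have "bij_betw (\<lambda>x. (x mod int m, x mod int n)) (roots (m * n)) (roots m \<times> roots n)"
    unfolding bij_betw_def
  proof
    show "inj_on (\<lambda>x. (x mod int m, x mod int n)) (roots (m * n))"
    proof (rule inj_onI)
      fix x y assume x: "x \<in> roots (m * n)" and y: "y \<in> roots (m * n)"
        and e: "(x mod int m, x mod int n) = (y mod int m, y mod int n)"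
      from e have "int m dvd x - y" "int n dvd x - y" by (auto simp: mod_eq_dvd_iff)
      hence "int m * int n dvd x - y" using cop by (intro divides_mult)
      thus "x = y" using x y by (intro int_interval_eqI[of x "int (m * n)"]) (auto simp: roots_def)
    qed
    show "(\<lambda>x. (x mod int m, x mod int n)) ` roots (m * n) = roots m \<times> roots n"
    proof (intro equalityI subsetI)
      fix z assume "z \<in> (\<lambda>x. (x mod int m, x mod int n)) ` roots (m * n)"
      then obtain x where x: "x \<in> roots (m * n)" "z = (x mod int m, x mod int n)" by blast
      have "int m * int n dvd x\<^sup>2 + 658" using x by (simp add: roots_def)
      hence "int m dvd x\<^sup>2 + 658" "int n dvd x\<^sup>2 + 658" by (auto elim: dvd_mult_left dvd_mult_right)
      thus "z \<in> roots m \<times> roots n" using x assms mod_mem_roots by auto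
    next
      fix z assume "z \<in> roots m \<times> roots n"
      then obtain u v where z: "z = (u, v)" and u: "u \<in> roots m" and v: "v \<in> roots n" by auto
      obtain x where x: "[x = u] (mod int m)" "[x = v] (mod int n)"
        using binary_chinese_remainder_int[OF cop] by blast
      define w where "w = x mod int (m * n)"
      have "x mod int m = u" "x mod int n = v" using x u v by (auto simp: Cong.cong_def roots_def)
      moreover from this have "int m dvd x\<^sup>2 + 658" "int n dvd x\<^sup>2 + 658"
        using u v dvd_square_mod[of "int m" x 658] dvd_square_mod[of "int n" x 658] by (auto simp: roots_def)
      hence "int m * int n dvd x\<^sup>2 + 658" using cop by (intro divides_mult)
      hence "w \<in> roots (m * n)" unfolding w_def using assms by (intro mod_mem_roots) simp_all
      moreover have "w mod int m = x mod int m" "w mod int n = x mod int n"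
        unfolding w_def by (simp_all add: mod_mod_cancel)
      ultimately show "z \<in> (\<lambda>x. (x mod int m, x mod int n)) ` roots (m * n)"
        unfolding z by (intro image_eqI[of _ _ w]) auto
    qed
  qed
  hence "card (roots (m * n)) = card (roots m \<times> roots n)" by (rule bij_betw_same_card)
  thus ?thesis by (simp add: card_cartesian_product)
qed

text \<open>Hensel lifting. Because \<open>p\<close> is odd and does not divide \<open>a\<close>,
  the derivative \<open>2 * x\<close> is a unit modulo \<open>p\<close> at every solution.\<close>

lemma hensel_sqrt:
  fixes p :: nat
  assumes "prime p" "odd p" "\<not> int p dvd a" "int p dvd y\<^sup>2 + a"
  shows "\<exists>x. int p ^ k dvd x\<^sup>2 + a \<and> [x = y] (mod p)"
proof (induction k)
  case 0
  show ?case by (intro exI[of _ y]) simp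
next
  case (Suc k)
  show ?case
  proof (cases "k = 0")
    case True thus ?thesis using assms by (intro exI[of _ y]) simp
  next
    case False
    from Suc obtain x where x: "int p ^ k dvd x\<^sup>2 + a" "[x = y] (mod p)" by blast
    then obtain t where t: "x\<^sup>2 + a = int p ^ k * t" by blast
    have "int p dvd int p ^ k" using False by (simp add: dvd_power)
    hence "int p dvd x\<^sup>2 + a" using x(1) dvd_trans by blast
    have "\<not> int p dvd 2 * x"
    proof
      assume "int p dvd 2 * x"
      moreover have "\<not> int p dvd 2" using assms(1,2)
        by (metis dvd_refl int_dvd_int_iff of_nat_numeral prime_nat_iff primes_dvd_imp_eq two_is_prime_nat)
      ultimately have "int p dvd x" using assms(1) prime_dvd_mult_iff[of "int p" 2 x] by simp
      hence "int p dvd x\<^sup>2" by (simp add: power2_eq_square)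
      thus False using \<open>int p dvd x\<^sup>2 + a\<close> assms(3) by (simp add: dvd_add_right_iff)
    qed
    hence "coprime (2 * x) (int p)" using assms(1)
      by (metis coprime_commute prime_imp_coprime prime_nat_int_transfer)
    then obtain w where w: "[2 * x * w = 1] (mod int p)" using cong_solve_coprime_int by blast
    \<comment> \<open>A Newton step: \<open>t * p ^ k\<close> is the value of the polynomial at
      \<open>x\<close>, and \<open>w\<close> inverts its derivative \<open>2 * x\<close> modulo
      \<open>p\<close>.\<close>
    define x' where "x' = x - t * w * int p ^ k"
    have "x'\<^sup>2 + a = int p ^ k * t - 2 * x * w * t * int p ^ k + (t * w)\<^sup>2 * (int p ^ k)\<^sup>2"
      unfolding x'_def t[symmetric] by (simp add: power2_eq_square algebra_simps)
    also have "\<dots> = int p ^ k * (t * (1 - 2 * x * w) + (t * w)\<^sup>2 * int p ^ k)"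
      by (simp add: power2_eq_square algebra_simps)
    finally have e: "x'\<^sup>2 + a = int p ^ k * (t * (1 - 2 * x * w) + (t * w)\<^sup>2 * int p ^ k)" .
    have "int p dvd 1 - 2 * x * w" using w by (metis cong_iff_dvd_diff cong_sym)
    hence "int p dvd t * (1 - 2 * x * w) + (t * w)\<^sup>2 * int p ^ k"
      using \<open>int p dvd int p ^ k\<close> by (intro dvd_add dvd_mult) simp_all
    hence "int p ^ Suc k dvd x'\<^sup>2 + a" unfolding e by (simp add: mult.commute mult_dvd_mono)
    moreover have "[x' = x] (mod p)" unfolding x'_def cong_iff_dvd_diff
      using \<open>int p dvd int p ^ k\<close> by simp
    ultimately show ?thesis using x(2) cong_trans by blast
  qed
qed

text \<open>A solution modulo \<open>p\<close> lifts, and its only companions are \<open>x\<close>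
  and \<open>-x\<close>: \<open>p\<close> cannot divide both factors of
  \<open>(z - x) * (z + x)\<close>, so the full power divides one of them. Hence the count does not
  depend on \<open>k\<close>.\<close>

lemma card_roots_prime_power:
  assumes p: "prime p" and cop: "coprime p (658::nat)" and k: "k > 0"
  shows "int (card (roots (p ^ k))) = 1 + chiD p"
proof -
  have nd: "\<not> p dvd 658"
    using coprime_common_divisor[OF cop dvd_refl] not_prime_unit p by blast
  have nd': "\<not> int p dvd 658" using nd by (metis int_dvd_int_iff of_nat_numeral)
  have odd: "odd p" using nd p by (metis dvd_triv_left even_numeral prime_nat_iff primes_dvd_imp_eq two_is_prime_nat)
  have nd2: "\<not> int p dvd 2" using odd p
        by (metis dvd_refl int_dvd_int_iff of_nat_numeral prime_nat_iff primes_dvd_imp_eq two_is_prime_nat)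
  have pp: "int p dvd int p ^ k" using k by (simp add: dvd_power)
  have p0: "p > 0" using p prime_gt_0_nat by blast
  have nz: "\<not> [-658 = 0] (mod int p)" using nd' by (simp add: cong_0_iff)
  have D: "chiD p = (if QuadRes p (-658) then 1 else -1)"
    unfolding chiD_Legendre[OF p cop] Legendre_def using nz by simp
  show ?thesis
  proof (cases "QuadRes p (-658)")
    case False
    have "roots (p ^ k) = {}"
    proof (rule ccontr)
      assume "roots (p ^ k) \<noteq> {}"
      then obtain x where "int p ^ k dvd x\<^sup>2 + 658" by (auto simp: roots_def)
      hence "int p dvd x\<^sup>2 + 658" using pp dvd_trans by blast
      hence "[x\<^sup>2 = -658] (mod int p)" by (simp add: cong_iff_dvd_diff)
      thus False using False unfolding QuadRes_def by blast
    qed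
    thus ?thesis using False D by simp
  next
    case True
    then obtain y where "[y\<^sup>2 = -658] (mod int p)" unfolding QuadRes_def by blast
    hence "int p dvd y\<^sup>2 + 658" by (simp add: cong_iff_dvd_diff)
    then obtain x where x: "int p ^ k dvd x\<^sup>2 + 658"
      using hensel_sqrt[OF p odd nd'] by blast
    define q where "q = int (p ^ k)"
    have q0: "p ^ k > 0" using p0 by simp
    have npx: "\<not> int p dvd x"
    proof
      assume "int p dvd x"
      hence "int p dvd x\<^sup>2" by (simp add: power2_eq_square)
      moreover have "int p dvd x\<^sup>2 + 658" using x pp dvd_trans by blast
      ultimately show False using nd' by (simp add: dvd_add_right_iff)
    qed
    have ne: "x mod q \<noteq> (-x) mod q"
    proof
      assume "x mod q = (-x) mod q"
      hence "q dvd 2 * x" by (simp add: mod_eq_dvd_iff)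
      hence "int p dvd 2 * x" using pp dvd_trans unfolding q_def by (metis of_nat_power)
      thus False using nd2 npx p by (simp add: prime_dvd_mult_iff)
    qed
    have "roots (p ^ k) = {x mod q, (-x) mod q}"
    proof (intro equalityI subsetI)
      fix z assume "z \<in> {x mod q, (-x) mod q}"
      thus "z \<in> roots (p ^ k)" using mod_mem_roots[OF q0, of x] mod_mem_roots[OF q0, of "-x"] x
        unfolding q_def by auto
    next
      fix z assume z: "z \<in> roots (p ^ k)"
      hence zm: "z mod q = z" unfolding roots_def q_def by simp
      have "int p ^ k dvd z\<^sup>2 + 658 - (x\<^sup>2 + 658)" using z x by (intro dvd_diff) (auto simp: roots_def)
      hence d: "int p ^ k dvd (z - x) * (z + x)" by (simp add: power2_eq_square algebra_simps)
      have "\<not> (int p dvd z - x \<and> int p dvd z + x)"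
      proof
        assume "int p dvd z - x \<and> int p dvd z + x"
        hence "int p dvd (z + x) - (z - x)" using dvd_diff by blast
        hence "int p dvd 2 * x" by simp
        thus False using nd2 npx p by (simp add: prime_dvd_mult_iff)
      qed
      hence "coprime (int p ^ k) (z - x) \<or> coprime (int p ^ k) (z + x)"
        using p prime_imp_coprime[of "int p"] by auto
      hence "int p ^ k dvd z + x \<or> int p ^ k dvd z - x"
        using d by (metis coprime_dvd_mult_left_iff coprime_dvd_mult_right_iff)
      thus "z \<in> {x mod q, (-x) mod q}"
      proof
        assume "int p ^ k dvd z + x"
        hence "z mod q = (-x) mod q" unfolding q_def by (simp add: mod_eq_dvd_iff)
        thus ?thesis using zm by simp
      next
        assume "int p ^ k dvd z - x"
        hence "z mod q = x mod q" unfolding q_def by (simp add: mod_eq_dvd_iff)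
        thus ?thesis using zm by simp
      qed
    qed
    thus ?thesis using ne D True by simp
  qed
qed

lemma squarefree_divisors_prime_power:
  assumes p: "prime (p::nat)" and "\<not> p dvd m" "k > 0"
  shows "{d. d dvd p ^ k * m \<and> squarefree d} =
    {d. d dvd m \<and> squarefree d} \<union> (*) p ` {d. d dvd m \<and> squarefree d}" (is "?A = ?B \<union> _")
proof (intro equalityI subsetI)
  fix d assume "d \<in> ?A"
  hence d: "d dvd p ^ k * m" "squarefree d" by auto
  show "d \<in> ?B \<union> (*) p ` ?B"
  proof (cases "p dvd d")
    case False
    hence "coprime d (p ^ k)" using p by (metis coprime_commute coprime_power_right_iff prime_imp_coprime)
    thus ?thesis using d by (simp add: coprime_dvd_mult_right_iff)
  next
    case True
    then obtain e where e: "d = p * e" by blast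
    have "\<not> p dvd e"
    proof
      assume "p dvd e"
      hence "p\<^sup>2 dvd d" unfolding e power2_eq_square by simp
      hence "p dvd 1" using d(2) squarefreeD by blast
      thus False using p not_prime_unit by blast
    qed
    hence "coprime e (p ^ k)" using p by (metis coprime_commute coprime_power_right_iff prime_imp_coprime)
    moreover have "e dvd p ^ k * m" using d(1) e dvd_mult_right by blast
    ultimately have "e dvd m" by (simp add: coprime_dvd_mult_right_iff)
    moreover have "squarefree e" using d(2) e squarefree_mono by (metis dvd_triv_right)
    ultimately show ?thesis using e by blast
  qed
next
  fix d assume "d \<in> ?B \<union> (*) p ` ?B"
  thus "d \<in> ?A"
  proof
    assume "d \<in> ?B" thus ?thesis by auto
  next
    assume "d \<in> (*) p ` ?B"
    then obtain e where e: "d = p * e" "e dvd m" "squarefree e" by auto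
    have "\<not> p dvd e" using e(2) assms(2) dvd_trans by blast
    hence "coprime p e" using p prime_imp_coprime by blast
    hence "squarefree d" unfolding e(1) using e(3) p squarefree_prime by (intro squarefree_mult_coprime) auto
    moreover have "d dvd p ^ k * m" unfolding e(1) using assms(3) e(2) by (intro mult_dvd_mono) (simp_all add: dvd_power)
    ultimately show ?thesis by auto
  qed
qed

text \<open>Both sides are multiplicative, and a prime power has only 1 and \<open>p\<close> as
  squarefree divisors, which contribute \<open>1 + chiD p\<close>. The induction strips off one full
  prime power at a time.\<close>

lemma card_roots_eq_sum:
  assumes "m > 0" "coprime m (658::nat)"
  shows "int (card (roots m)) = (\<Sum>d | d dvd m \<and> squarefree d. chiD (int d))"
  using assms
proof (induction m rule: less_induct)
  case (less m)
  show ?case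
  proof (cases "m = 1")
    case True
    have "roots 1 = {0}" by (auto simp: roots_def)
    moreover have "{d. d dvd (1::nat) \<and> squarefree d} = {1}" by auto
    moreover have "chiD 1 = 1" by (simp add: chiD_def chi8_def chi7_def chi47_def)
    ultimately show ?thesis using True by simp
  next
    case False
    then obtain p where p: "prime p" "p dvd m" using prime_factor_nat by blast
    define k where "k = multiplicity p m"
    obtain n where n: "m = p ^ k * n" "\<not> p dvd n"
      using multiplicity_decompose'[of m p] less.prems p not_prime_unit unfolding k_def by (metis not_gr_zero)
    have k: "k > 0" using p(2) n by (cases k) auto
    have n0: "n > 0" using n less.prems by (cases n) auto
    have "1 < p ^ k" using k p(1) by (metis one_less_power prime_gt_1_nat)
    hence lt: "n < m" unfolding n(1) using n0 by simp
    have copn: "coprime n 658" "coprime p 658" using less.prems(2) k unfolding n(1) by auto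
    have cop: "coprime (p ^ k) n" using p n by (simp add: prime_imp_coprime)
    let ?D = "{d. d dvd n \<and> squarefree d}"
    have fin: "finite ?D" using n0 by simp
    have disj: "?D \<inter> (*) p ` ?D = {}" using n(2) dvd_trans by (auto dest: dvd_mult_left)
    have inj: "inj_on ((*) p) ?D" using p(1) by (auto simp: inj_on_def)
    have "(\<Sum>d | d dvd m \<and> squarefree d. chiD (int d)) = (\<Sum>d\<in>?D. chiD d) + (\<Sum>d\<in>(*) p ` ?D. chiD d)"
      unfolding n(1) squarefree_divisors_prime_power[OF p(1) n(2) k]
      by (rule sum.union_disjoint) (use fin disj in auto)
    also have "(\<Sum>d\<in>(*) p ` ?D. chiD d) = (\<Sum>d\<in>?D. chiD p * chiD d)"
      by (subst sum.reindex[OF inj]) (simp add: chiD_mult)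
    also have "(\<Sum>d\<in>?D. chiD d) + \<dots> = (1 + chiD p) * (\<Sum>d\<in>?D. chiD d)"
      unfolding sum_distrib_left[symmetric] by (simp add: distrib_right)
    also have "\<dots> = int (card (roots (p ^ k))) * int (card (roots n))"
      using less.IH[OF lt n0 copn(1)] card_roots_prime_power[OF p(1) copn(2) k] by simp
    also have "\<dots> = int (card (roots m))" using card_roots_mult[OF cop] n0 p(1) prime_gt_0_nat
      unfolding n(1) by simp
    finally show ?thesis ..
  qed
qed

lemma finite_square_divisors: "n > 0 \<Longrightarrow> finite {c::nat. c\<^sup>2 dvd n}"
  by (rule finite_subset[of _ "{..n}"])
     (auto dest!: dvd_imp_le simp: power2_eq_square intro: le_trans[OF le_square])

text \<open>Every divisor \<open>e\<close> of \<open>n\<close> is uniquely \<open>d * c^2\<close> with \<open>d\<close> squarefree, and the character does not see \<open>c\<close>.\<close>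

lemma sum_card_roots:
  assumes "n > 0" "coprime n (658::nat)"
  shows "(\<Sum>c | c\<^sup>2 dvd n. int (card (roots (n div c\<^sup>2)))) = (\<Sum>e | e dvd n. chiD (int e))"
proof -
  have "(\<Sum>c | c\<^sup>2 dvd n. int (card (roots (n div c\<^sup>2)))) =
      (\<Sum>c | c\<^sup>2 dvd n. \<Sum>d | d dvd n div c\<^sup>2 \<and> squarefree d. chiD (int d))"
  proof (rule sum.cong[OF refl])
    fix c assume "c \<in> {c. c\<^sup>2 dvd n}"
    then obtain k where k: "n = c\<^sup>2 * k" by auto
    hence "c > 0" using assms by (cases c) auto
    hence "n div c\<^sup>2 = k" using k by simp
    moreover have "k > 0" "coprime k 658" using k assms by (auto intro: Nat.gr0I)
    ultimately show "int (card (roots (n div c\<^sup>2))) = (\<Sum>d | d dvd n div c\<^sup>2 \<and> squarefree d. chiD (int d))"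
      using card_roots_eq_sum by simp
  qed
  also have "\<dots> = (\<Sum>(c, d)\<in>Sigma {c. c\<^sup>2 dvd n} (\<lambda>c. {d. d dvd n div c\<^sup>2 \<and> squarefree d}). chiD (int d))"
  proof (rule sum.Sigma)
    show "finite {c. c\<^sup>2 dvd n}" by (rule finite_square_divisors[OF assms(1)])
    show "\<forall>c\<in>{c. c\<^sup>2 dvd n}. finite {d. d dvd n div c\<^sup>2 \<and> squarefree d}"
    proof
      fix c assume "c \<in> {c. c\<^sup>2 dvd n}"
      hence "n div c\<^sup>2 > 0" using assms by (auto simp: div_greater_zero_iff dest: dvd_imp_le intro!: Nat.gr0I)
      thus "finite {d. d dvd n div c\<^sup>2 \<and> squarefree d}" by simp
    qed
  qed
  also have "\<dots> = (\<Sum>e | e dvd n. chiD (int e))"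
  proof (rule sum.reindex_bij_witness[of _ "\<lambda>e. (square_part e, squarefree_part e)" "\<lambda>(c, d). d * c\<^sup>2"])
    fix z assume "z \<in> Sigma {c. c\<^sup>2 dvd n} (\<lambda>c. {d. d dvd n div c\<^sup>2 \<and> squarefree d})"
    then obtain c d where z: "z = (c, d)" and c: "c\<^sup>2 dvd n" and d: "d dvd n div c\<^sup>2" "squarefree d" by auto
    have c0: "c > 0" using c assms by (auto intro!: Nat.gr0I)
    have "d > 0" using d(2) by (auto intro!: Nat.gr0I)
    show "(case z of (c, d) \<Rightarrow> d * c\<^sup>2) \<in> {e. e dvd n}"
      using c d(1) c0 unfolding z by (simp add: dvd_div_iff_mult)
    have "squarefree_part (d * c\<^sup>2) = d \<and> square_part (d * c\<^sup>2) = c"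
    proof -
      \<comment> \<open>If the square part were \<open>c * t\<close>, then \<open>t^2\<close> would
        divide the squarefree number \<open>d\<close>.\<close>
      have "c dvd square_part (d * c\<^sup>2)" by (simp add: dvd_square_part_iff)
      then obtain t where t: "square_part (d * c\<^sup>2) = c * t" by blast
      have "d * c\<^sup>2 = squarefree_part (d * c\<^sup>2) * (c * t)\<^sup>2"
        using squarefree_decompose[of "d * c\<^sup>2"] unfolding t .
      hence "c\<^sup>2 * d = c\<^sup>2 * (squarefree_part (d * c\<^sup>2) * t\<^sup>2)"
        by (simp only: power_mult_distrib ac_simps)
      hence e: "d = squarefree_part (d * c\<^sup>2) * t\<^sup>2" using c0 by simp
      hence "t\<^sup>2 dvd d" by (metis dvd_triv_right)
      hence "t = 1" using squarefreeD[OF d(2)] by simp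
      thus ?thesis using e t by simp
    qed
    thus "(case case z of (c, d) \<Rightarrow> d * c\<^sup>2 of e \<Rightarrow> (square_part e, squarefree_part e)) = z"
      unfolding z by simp
    obtain k where "n = c\<^sup>2 * k" using c by blast
    hence "coprime c 658" using assms(2) by (simp add: power2_eq_square)
    hence "chiD c * chiD c = 1" using chi_coprime(4)[of c] by auto
    thus "chiD (int (case z of (c, d) \<Rightarrow> d * c\<^sup>2)) = (case z of (c, d) \<Rightarrow> chiD (int d))"
      unfolding z by (simp add: chiD_mult power2_eq_square)
  next
    fix e assume e: "e \<in> {e. e dvd n}"
    have dec: "e = squarefree_part e * square_part e ^ 2" by (rule squarefree_decompose)
    show "(case (square_part e, squarefree_part e) of (c, d) \<Rightarrow> d * c\<^sup>2) = e" using dec[symmetric] by simp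
    have "e > 0" using e assms by (auto intro!: Nat.gr0I)
    moreover have "square_part e ^ 2 dvd n" using e dvd_trans[OF square_part_square_dvd] by simp
    moreover have "squarefree_part e * square_part e ^ 2 dvd n" using e dec[symmetric] by simp
    ultimately show "(square_part e, squarefree_part e) \<in> Sigma {c. c\<^sup>2 dvd n} (\<lambda>c. {d. d dvd n div c\<^sup>2 \<and> squarefree d})"
      using dvd_div_iff_mult[of "(square_part e)\<^sup>2" n "squarefree_part e"]
      by (simp del: square_part_0_iff add: square_part_nonzero)
  qed
  finally show ?thesis .
qed


subsection \<open>Representation numbers and genus characters\<close>

definition rep :: "int \<Rightarrow> int \<Rightarrow> nat \<Rightarrow> (int \<times> int) set" where
  "rep a c n = {(x, y). a * x\<^sup>2 + c * y\<^sup>2 = int n}"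

lemma finite_rep:
  assumes "a > 0" "c > 0"
  shows "finite (rep a c n)"
proof (rule finite_subset)
  have aux: "\<bar>x\<bar> \<le> int n" if "a * x\<^sup>2 + c * y\<^sup>2 = int n" "a > 0" "c > 0" for a c x y :: int
  proof -
    have "\<bar>x\<bar> * 1 \<le> \<bar>x\<bar> * \<bar>x\<bar>" by (cases "x = 0") (simp, intro mult_left_mono, simp_all)
    hence "\<bar>x\<bar> \<le> x\<^sup>2" by (simp add: power2_eq_square)
    also have "x\<^sup>2 \<le> a * x\<^sup>2" using that(2) by (intro mult_right_mono[of 1 a, simplified]) auto
    also have "\<dots> \<le> int n" using that by (smt (verit) mult_nonneg_nonneg zero_le_power2)
    finally show ?thesis .
  qed
  show "rep a c n \<subseteq> {-int n..int n} \<times> {-int n..int n}"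
  proof
    fix z assume "z \<in> rep a c n"
    then obtain x y where z: "z = (x, y)" "a * x\<^sup>2 + c * y\<^sup>2 = int n" by (auto simp: rep_def)
    hence "\<bar>x\<bar> \<le> int n" "\<bar>y\<bar> \<le> int n"
      using aux[of a x c y] aux[of c y a x] assms by (simp_all add: add.commute)
    thus "z \<in> {-int n..int n} \<times> {-int n..int n}" using z by auto
  qed
qed simp

lemma card_rep_swap: "card (rep a c n) = card (rep c a n)"
proof (rule bij_betw_same_card)
  show "bij_betw prod.swap (rep a c n) (rep c a n)"
    by (rule bij_betw_byWitness[of _ prod.swap]) (auto simp: rep_def add.commute)
qed

text \<open>Since \<open>p\<close> does not divide \<open>a\<close>, it divides \<open>x\<close>;
  cancelling one factor \<open>p\<close> in the equation moves this prime from the second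
  coefficient to the first. For the ramified primes 2, 7 and 47 this is multiplication by the prime
  ideal above \<open>p\<close>.\<close>

lemma card_rep_prime_mult:
  assumes "prime p" "\<not> p dvd a"
  shows "card (rep a (p * c) (nat p * n)) = card (rep (p * a) c n)"
proof (rule bij_betw_same_card[symmetric])
  have p0: "p > 0" using assms(1) prime_gt_0_int by blast
  show "bij_betw (\<lambda>(x, y). (p * x, y)) (rep (p * a) c n) (rep a (p * c) (nat p * n))"
    unfolding bij_betw_def
  proof
    show "inj_on (\<lambda>(x, y). (p * x, y)) (rep (p * a) c n)" using p0 by (auto simp: inj_on_def)
    show "(\<lambda>(x, y). (p * x, y)) ` rep (p * a) c n = rep a (p * c) (nat p * n)"
    proof (intro equalityI subsetI)
      fix z assume "z \<in> (\<lambda>(x, y). (p * x, y)) ` rep (p * a) c n"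
      then obtain x y where z: "z = (p * x, y)" and e: "p * a * x\<^sup>2 + c * y\<^sup>2 = int n" by (auto simp: rep_def)
      have "a * (p * x)\<^sup>2 + p * c * y\<^sup>2 = p * (p * a * x\<^sup>2 + c * y\<^sup>2)" by (simp add: power2_eq_square algebra_simps)
      thus "z \<in> rep a (p * c) (nat p * n)" using p0 unfolding z rep_def e by simp
    next
      fix z assume "z \<in> rep a (p * c) (nat p * n)"
      then obtain x y where z: "z = (x, y)" and e: "a * x\<^sup>2 + p * c * y\<^sup>2 = p * int n" using p0 by (auto simp: rep_def)
      have "a * x\<^sup>2 = p * (int n - c * y\<^sup>2)" using e by (simp add: algebra_simps)
      hence "p dvd a * x\<^sup>2" by simp
      hence "p dvd x" using assms by (metis prime_dvd_mult_iff prime_dvd_power)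
      then obtain x' where x': "x = p * x'" by blast
      have "p * (p * a * x'\<^sup>2 + c * y\<^sup>2) = p * int n" using e unfolding x' by (simp add: power2_eq_square algebra_simps)
      hence "p * a * x'\<^sup>2 + c * y\<^sup>2 = int n" using p0 by simp
      thus "z \<in> (\<lambda>(x, y). (p * x, y)) ` rep (p * a) c n" unfolding z x' rep_def by auto
    qed
  qed
qed

text \<open>The sign of each form is the value of \<open>chi8\<close> on the odd numbers that it
  represents.\<close>

definition rep_diff :: "nat \<Rightarrow> int" where
  "rep_diff n = int (card (rep 1 658 n)) + int (card (rep 2 329 n)) - int (card (rep 7 94 n)) - int (card (rep 14 47 n))"

text \<open>The prime 2 exchanges the forms starting with 1 and 2, and those with 7 and 14, which
  have equal signs. The primes 7 (1 with 7, 2 with 14) and 47 (1 with 14, 2 with 7) exchange forms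
  of opposite sign.\<close>

lemma rep_diff_2: "rep_diff (2 * n) = rep_diff n"
  using card_rep_prime_mult[of 2 1 329 n] card_rep_prime_mult[of 2 329 1 n]
    card_rep_prime_mult[of 2 7 47 n] card_rep_prime_mult[of 2 47 7 n]
    card_rep_swap[of 329 2 "2 * n"] card_rep_swap[of 658 1 n] card_rep_swap[of 47 14 "2 * n"] card_rep_swap[of 94 7 n]
  by (simp add: rep_diff_def)

lemma rep_diff_7: "rep_diff (7 * n) = - rep_diff n"
  using card_rep_prime_mult[of 7 1 94 n] card_rep_prime_mult[of 7 94 1 n]
    card_rep_prime_mult[of 7 2 47 n] card_rep_prime_mult[of 7 47 2 n]
    card_rep_swap[of 94 7 "7 * n"] card_rep_swap[of 658 1 n] card_rep_swap[of 47 14 "7 * n"] card_rep_swap[of 329 2 n]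
  by (simp add: rep_diff_def)

lemma rep_diff_47: "rep_diff (47 * n) = - rep_diff n"
proof -
  have p: "prime (47::int)" by simp 
  show ?thesis
  using card_rep_prime_mult[OF p, of 1 14 n] card_rep_prime_mult[OF p, of 14 1 n]
    card_rep_prime_mult[OF p, of 2 7 n] card_rep_prime_mult[OF p, of 7 2 n]
    card_rep_swap[of 47 14 n] card_rep_swap[of 14 47 "47 * n"] card_rep_swap[of 94 7 n] card_rep_swap[of 658 1 n]
    card_rep_swap[of 329 2 n]
  by (simp add: rep_diff_def)
qed

section \<open>Dirichlet convolutions of the characters\<close>

definition dconv :: "(int \<Rightarrow> int) \<Rightarrow> (int \<Rightarrow> int) \<Rightarrow> nat \<Rightarrow> int" where
  "dconv f g n = (\<Sum>d | d dvd n. f (int d) * g (int (n div d)))"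

lemma dconv_commute: "n > 0 \<Longrightarrow> dconv f g n = dconv g f n"
  unfolding dconv_def
  by (rule sum.reindex_bij_witness[of _ "\<lambda>d. n div d" "\<lambda>d. n div d"]) (auto elim!: dvdE)

text \<open>The divisors of \<open>p * n\<close> that do not divide \<open>n\<close> are multiples
  of \<open>p\<close>, where \<open>f\<close> vanishes; for every other divisor the cofactor gains
  the factor \<open>p\<close>. At each of the primes 2, 7, 47, at least one character of either
  product vanishes.\<close>

lemma dconv_prime_mult:
  assumes f: "\<And>a b. f (a * b) = f a * f b" and g: "\<And>a b. g (a * b) = g a * g b"
    and p: "prime p" and fp: "f (int p) = 0" and n: "n > 0"
  shows "dconv f g (p * n) = g (int p) * dconv f g n"
proof -
  have p0: "p > 0" using p prime_gt_0_nat by blast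
  have "dconv f g (p * n) = (\<Sum>d | d dvd n. f (int d) * g (int (p * n div d)))"
    unfolding dconv_def
  proof (rule sum.mono_neutral_right)
    show "finite {d. d dvd p * n}" using p0 n by simp
    show "{d. d dvd n} \<subseteq> {d. d dvd p * n}" by auto
    show "\<forall>d\<in>{d. d dvd p * n} - {d. d dvd n}. f (int d) * g (int (p * n div d)) = 0"
    proof
      fix d assume d: "d \<in> {d. d dvd p * n} - {d. d dvd n}"
      hence "p dvd d" using p by (metis Diff_iff coprime_commute coprime_dvd_mult_right_iff mem_Collect_eq prime_imp_coprime)
      then obtain e where "d = p * e" by blast
      thus "f (int d) * g (int (p * n div d)) = 0" by (simp add: f fp)
    qed
  qed
  also have "\<dots> = (\<Sum>d | d dvd n. g (int p) * (f (int d) * g (int (n div d))))"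
    by (rule sum.cong) (auto simp: div_mult_swap[symmetric] g)
  finally show ?thesis unfolding dconv_def by (simp add: sum_distrib_left)
qed

definition chi329 :: "int \<Rightarrow> int" where "chi329 n = chi7 n * chi47 n"
definition chi376 :: "int \<Rightarrow> int" where "chi376 n = chi8 n * chi47 n"

lemma chi329_mult:
  fixes a b :: int
  shows "chi329 (a * b) = chi329 a * chi329 b"
  by (simp add: chi329_def chi7_mult chi47_mult)
lemma chi376_mult:
  fixes a b :: int
  shows "chi376 (a * b) = chi376 a * chi376 b"
  by (simp add: chi376_def chi8_mult chi47_mult)

definition char_conv :: "nat \<Rightarrow> int" where
  "char_conv n = dconv chi8 chi329 n + dconv chi7 chi376 n"

lemma chi_values:
  "chi8 2 = 0" "chi8 7 = -1" "chi8 47 = -1" "chi7 2 = 1" "chi7 7 = 0" "chi7 47 = -1"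
  "chi329 2 = 1" "chi329 7 = 0" "chi329 47 = 0" "chi376 2 = 0" "chi376 7 = -1" "chi376 47 = 0"
  by (simp_all add: chi8_def chi7_def chi47_def chi329_def chi376_def)

lemma char_conv_2: "n > 0 \<Longrightarrow> char_conv (2 * n) = char_conv n"
  using dconv_prime_mult[OF chi8_mult chi329_mult, of 2 n] dconv_prime_mult[OF chi376_mult chi7_mult, of 2 n]
    dconv_commute[of "2 * n" chi7 chi376] dconv_commute[of n chi7 chi376]
  by (simp add: char_conv_def chi_values)

lemma char_conv_7: "n > 0 \<Longrightarrow> char_conv (7 * n) = - char_conv n"
  using dconv_prime_mult[OF chi329_mult chi8_mult, of 7 n] dconv_prime_mult[OF chi7_mult chi376_mult, of 7 n]
    dconv_commute[of "7 * n" chi8 chi329] dconv_commute[of n chi8 chi329]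
  by (simp add: char_conv_def chi_values)

lemma char_conv_47: "n > 0 \<Longrightarrow> char_conv (47 * n) = - char_conv n"
  using dconv_prime_mult[OF chi329_mult chi8_mult, of 47 n] dconv_prime_mult[OF chi376_mult chi7_mult, of 47 n]
    dconv_commute[of "47 * n" chi8 chi329] dconv_commute[of n chi8 chi329]
    dconv_commute[of "47 * n" chi7 chi376] dconv_commute[of n chi7 chi376]
  by (simp add: char_conv_def chi_values)

text \<open>On units all characters are signs and each convolved pair multiplies to
  \<open>chiD\<close>, so both convolutions are a sign times the same divisor sum. Exchanging
  complementary divisors multiplies that sum by \<open>chiD n\<close>; it vanishes unless
  \<open>chiD n = 1\<close>, and then \<open>chi329 n = chi8 n\<close> and
  \<open>chi376 n = chi8 n * chi47 n\<close>.\<close>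

lemma char_conv_coprime:
  assumes "n > 0" "coprime n 658"
  shows "char_conv n = chi8 n * (1 + chi47 n) * (\<Sum>e | e dvd n. chiD (int e))"
proof -
  let ?S = "\<Sum>e | e dvd n. chiD (int e)"
  note v = chi_coprime[OF assms(2)]
  have 1: "dconv chi8 chi329 n = chi329 n * ?S" "dconv chi7 chi376 n = chi376 n * ?S"
    unfolding dconv_def sum_distrib_left
  proof (safe intro!: sum.cong)
    fix d assume "d dvd n"
    then obtain e where e: "n = d * e" by blast
    have "coprime d 658" using assms(2) e by simp
    note w = chi_coprime[OF this]
    have "d > 0" using e assms by (auto intro: Nat.gr0I)
    hence q: "n div d = e" using e by simp
    show "chi8 (int d) * chi329 (int (n div d)) = chi329 n * chiD d"
      unfolding q chiD_def unfolding e using w by (auto simp: chi329_def chi7_mult chi47_mult)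
    show "chi7 (int d) * chi376 (int (n div d)) = chi376 n * chiD d"
      unfolding q chiD_def unfolding e using w by (auto simp: chi376_def chi8_mult chi47_mult)
  qed
  have "?S = (\<Sum>e | e dvd n. chiD (int (n div e)))"
    using dconv_commute[OF assms(1), of chiD "\<lambda>_. 1"] by (simp add: dconv_def)
  also have "\<dots> = (\<Sum>e | e dvd n. chiD n * chiD e)"
  proof (rule sum.cong[OF refl])
    fix d assume "d \<in> {d. d dvd n}"
    then obtain e where e: "n = d * e" by blast
    have "coprime d 658" using assms(2) e by simp
    note w = chi_coprime[OF this]
    have "d > 0" using e assms by (auto intro: Nat.gr0I)
    hence q: "n div d = e" using e by simp
    show "chiD (int (n div d)) = chiD n * chiD d" unfolding q unfolding e using w by (auto simp: chiD_mult)
  qed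
  finally have "?S = chiD n * ?S" unfolding sum_distrib_left[symmetric] .
  hence "chiD n = 1 \<or> ?S = 0" using v by auto
  thus ?thesis
  proof
    assume "?S = 0" thus ?thesis unfolding char_conv_def 1 by simp
  next
    assume "chiD n = 1"
    hence "chi329 n + chi376 n = chi8 n * (1 + chi47 n)"
      using v unfolding chiD_def chi329_def chi376_def by auto
    thus ?thesis unfolding char_conv_def 1 by (simp add: algebra_simps flip: distrib_right)
  qed
qed


section \<open>Reduction of binary quadratic forms of determinant 658, and counting of
  representations\<close>

text \<open>Gauss reduction: translate until the middle coefficient is small, then swap if this
  lowers the first coefficient. The unimodular substitution is carried along explicitly, since its
  first column will be the representation sought.\<close>

lemma form_reduction:
  fixes A B C :: int
  assumes "A > 0" "A * C - B\<^sup>2 = 658"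
  shows "\<exists>a b c p q r s. a > 0 \<and> a * c - b\<^sup>2 = 658 \<and> 2 * \<bar>b\<bar> \<le> a \<and> a \<le> c \<and> p * s - q * r = 1 \<and>
    A = a * p\<^sup>2 + 2 * b * p * r + c * r\<^sup>2 \<and> B = a * p * q + b * (p * s + q * r) + c * r * s"
  using assms
proof (induction "nat A" arbitrary: A B C rule: less_induct)
  case less
  \<comment> \<open>The translation that brings \<open>B + t * A\<close> as close to 0 as
    possible.\<close>
  define t where "t = - ((2 * B + A) div (2 * A))"
  define B' where "B' = B + t * A"
  define C' where "C' = C + 2 * t * B + t\<^sup>2 * A"
  have "2 * \<bar>B'\<bar> \<le> A"
  proof -
    define k where "k = (2 * B + A) div (2 * A)"
    have "2 * B + A = 2 * A * k + (2 * B + A) mod (2 * A)" unfolding k_def by simp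
    moreover have "0 \<le> (2 * B + A) mod (2 * A)" "(2 * B + A) mod (2 * A) < 2 * A" using less.prems by auto
    moreover have "B' = B - A * k" unfolding B'_def t_def k_def by simp
    ultimately show ?thesis by linarith
  qed
  have D: "A * C' - B'\<^sup>2 = 658" using less.prems(2) unfolding B'_def C'_def
    by (simp add: power2_eq_square algebra_simps)
  have C'0: "C' > 0" using D less.prems(1)
    by (smt (verit) mult_nonneg_nonpos zero_le_power2)
  show ?case
  proof (cases "A \<le> C'")
    case True
    have "B = A * 1 * (-t) + B' * (1 * 1 + (-t) * 0) + C' * 0 * 1" unfolding B'_def by simp
    moreover have "A = A * 1\<^sup>2 + 2 * B' * 1 * 0 + C' * 0\<^sup>2" "1 * 1 - (-t) * 0 = 1" by simp_all
    ultimately show ?thesis using less.prems(1) D True \<open>2 * \<bar>B'\<bar> \<le> A\<close> by blast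
  next
    case False
    hence "nat C' < nat A" using less.prems(1) by simp
    moreover have "C' * A - (-B')\<^sup>2 = 658" using D by (simp add: mult.commute)
    ultimately obtain a b c p q r s where h: "a > 0" "a * c - b\<^sup>2 = 658" "2 * \<bar>b\<bar> \<le> a" "a \<le> c"
        "p * s - q * r = 1" "C' = a * p\<^sup>2 + 2 * b * p * r + c * r\<^sup>2"
        "-B' = a * p * q + b * (p * s + q * r) + c * r * s"
      using less.hyps[of C' A "-B'"] C'0 by metis
    \<comment> \<open>The induction hypothesis speaks of the first two coefficients only; the third
      follows from the invariance of the determinant.\<close>
    have A: "A = a * q\<^sup>2 + 2 * b * q * s + c * s\<^sup>2"
    proof -
      let ?X = "a * p\<^sup>2 + 2 * b * p * r + c * r\<^sup>2" and ?Y = "a * p * q + b * (p * s + q * r) + c * r * s"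
      let ?Z = "a * q\<^sup>2 + 2 * b * q * s + c * s\<^sup>2"
      have "?X * ?Z - ?Y\<^sup>2 = (a * c - b\<^sup>2) * (p * s - q * r)\<^sup>2"
        by (simp add: power2_eq_square algebra_simps)
      hence "C' * ?Z - B'\<^sup>2 = 658" unfolding h(2,5) h(6,7)[symmetric] by simp
      hence "C' * ?Z = C' * A" using D mult.commute[of A C'] by linarith
      thus ?thesis using C'0 by simp
    qed
    have "B = B' - t * A" unfolding B'_def by simp
    also have "\<dots> = a * q * (-p - t * q) + b * (q * (-r - t * s) + (-p - t * q) * s) + c * s * (-r - t * s)"
      using h(7) unfolding A by (simp add: power2_eq_square algebra_simps)
    finally have B: "B = a * q * (-p - t * q) + b * (q * (-r - t * s) + (-p - t * q) * s) + c * s * (-r - t * s)" .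
    have "q * (-r - t * s) - (-p - t * q) * s = 1" using h(5) by (simp add: algebra_simps)
    thus ?thesis using h(1-4) A B by blast
  qed
qed

text \<open>The usual bound \<open>3 * a^2 <= 4 * 658\<close> leaves finitely many pairs. The third
  coefficient is not searched: its integrality is the divisibility of \<open>b^2 + 658\<close> by
  \<open>a\<close>, and \<open>a <= c\<close> becomes \<open>a * a <= b^2 + 658\<close>.\<close>

lemma reduced_forms:
  fixes a b c :: int
  assumes "a > 0" "a * c - b\<^sup>2 = 658" "2 * \<bar>b\<bar> \<le> a" "a \<le> c"
  shows "(a, b) \<in> {(1, 0), (2, 0), (7, 0), (14, 0), (19, 8), (19, -8), (23, 3), (23, -3)}"
proof -
  have "(2 * b)\<^sup>2 \<le> a\<^sup>2" using assms(1,3) by (intro power2_le_iff_abs_le[THEN iffD2]) auto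
  moreover have "a * a \<le> a * c" using assms by (intro mult_left_mono) auto
  ultimately have "3 * a\<^sup>2 \<le> 2632" using assms(2) by (simp add: power2_eq_square)
  have "a < 30"
  proof (rule ccontr)
    assume "\<not> a < 30"
    hence "30 * 30 \<le> a * a" by (intro mult_mono) auto
    thus False using \<open>3 * a\<^sup>2 \<le> 2632\<close> by (simp add: power2_eq_square)
  qed
  hence "a \<in> {1..29}" "b \<in> {-14..14}" using assms by auto
  hence ab: "a \<in> set [1..29]" "b \<in> set [-14..14]" by (simp_all only: set_upto)
  have m: "(b\<^sup>2 + 658) mod a = 0" using assms(2) by (metis diff_add_cancel diff_eq_eq add.commute mod_mult_self1_is_0)
  have le: "a * a \<le> b\<^sup>2 + 658" using \<open>a * a \<le> a * c\<close> assms(2) by linarith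
  have "\<forall>a\<in>set [1..29]. \<forall>b\<in>set [-14..14]. 2 * \<bar>b\<bar> \<le> a \<and> (b\<^sup>2 + 658) mod a = 0 \<and> a * a \<le> b\<^sup>2 + 658 \<longrightarrow>
      (a, b) \<in> set [(1, 0), (2, 0), (7, 0), (14, 0), (19, 8), (19, -8), (23, 3), (23, -3::int)]"
    by code_simp
  from this[rule_format, OF ab, OF conjI[OF assms(3) conjI[OF m le]]]
  show ?thesis by simp
qed

text \<open>The tag \<open>a\<close> keeps the four forms apart, so that a single cardinality counts
  representations by all of them.\<close>

definition prim_reps :: "nat \<Rightarrow> (int \<times> int \<times> int) set" where
  "prim_reps m = {(a, x, y). a \<in> {1, 2, 7, 14} \<and> a * x\<^sup>2 + (658 div a) * y\<^sup>2 = int m \<and> coprime x y}"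

definition reps :: "nat \<Rightarrow> (int \<times> int \<times> int) set" where
  "reps n = {(a, x, y). a \<in> {1, 2, 7, 14} \<and> a * x\<^sup>2 + (658 div a) * y\<^sup>2 = int n}"

lemma reps_eq: "reps n = Pair 1 ` rep 1 658 n \<union> Pair 2 ` rep 2 329 n \<union> Pair 7 ` rep 7 94 n \<union> Pair 14 ` rep 14 47 n"
  unfolding reps_def rep_def by auto

lemma finite_reps: "finite (reps n)"
  unfolding reps_eq by (simp add: finite_rep)

lemma card_reps: "card (reps n) = card (rep 1 658 n) + card (rep 2 329 n) + card (rep 7 94 n) + card (rep 14 47 n)"
proof -
  have c: "card (Pair k ` S) = card S" for k :: int and S :: "(int \<times> int) set"
    by (rule card_image) (simp add: inj_on_def)
  show ?thesis unfolding reps_eq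
    by (subst card_Un_disjoint, simp add: finite_rep, simp add: finite_rep, fastforce)+ (simp add: c)
qed

text \<open>The ideal behind a primitive representation \<open>a x^2 + (658 / a) y^2 = m\<close> is determined by the residue \<open>b\<close>
  with \<open>b y = a x\<close> modulo \<open>m\<close>. Two representations with the same residue differ by an element of norm
  \<open>a a'\<close>, so they agree up to sign; conversely the reduction of \<open>m x^2 + 2 b x y + \<dots>\<close> yields a representation.\<close>

lemma prim_reps_root:
  assumes m: "m > 0" "coprime m (658::nat)" and t: "(a, x, y) \<in> prim_reps m"
  shows "\<exists>!b. b \<in> roots m \<and> int m dvd b * y - a * x"
proof -
  have a: "a \<in> {1, 2, 7, 14}" and e: "a * x\<^sup>2 + (658 div a) * y\<^sup>2 = int m" and xy: "coprime x y"
    using t by (auto simp: prim_reps_def)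
  have aa: "a * (658 div a) = 658" using a by auto
  have cma: "coprime (int m) a"
    by (rule coprime_divisors[of _ "int m" _ 658]) (use aa m(2) in \<open>auto simp: coprime_int_iff[of m 658, simplified] dvd_def\<close>)
  have cym: "coprime y (int m)"
  proof (rule coprimeI)
    fix d assume d: "d dvd y" "d dvd int m"
    have "d dvd a * x\<^sup>2" using e d by (metis dvd_add_left_iff dvd_mult power2_eq_square)
    moreover have "coprime d a" using d(2) cma by (meson coprime_divisors dvd_refl)
    moreover have "coprime d x" using d(1) xy by (meson coprime_commute coprime_divisors dvd_refl)
    hence "coprime d (x\<^sup>2)" by simp
    ultimately show "is_unit d" by (metis coprime_absorb_left coprime_mult_right_iff)
  qed
  obtain w where w: "[y * w = 1] (mod int m)" using cong_solve_coprime_int[OF cym] by blast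
  define b where "b = (a * x * w) mod int m"
  have wd: "int m dvd y * w - 1" using w by (simp add: cong_iff_dvd_diff)
  have "int m dvd (a * x * w) * y - a * x"
    using dvd_mult[OF wd, of "a * x"] by (simp add: algebra_simps)
  moreover have "int m dvd ((a * x * w) - b) * y" unfolding b_def by (simp add: minus_mod_eq_mult_div)
  ultimately have by': "int m dvd b * y - a * x" using dvd_diff[of "int m" "a * x * w * y - a * x" "(a * x * w - b) * y"]
    by (simp add: algebra_simps)
  have br: "b \<in> roots m" if "0 \<le> b" "b < int m" "int m dvd b * y - a * x" for b
  proof -
    \<comment> \<open>Multiplying the form by \<open>a\<close> gives
      \<open>(a x)^2 + 658 y^2 = a m\<close>, so modulo \<open>m\<close> one has
      \<open>b^2 y^2 = (a x)^2 = -658 y^2\<close>, and the unit \<open>y^2\<close> cancels.\<close>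
    have "int m dvd (b * y - a * x) * (b * y + a * x) + a * int m" using that(3) by simp
    also have "(b * y - a * x) * (b * y + a * x) + a * int m = (b\<^sup>2 + a * (658 div a)) * y\<^sup>2"
      unfolding e[symmetric] by (simp add: power2_eq_square algebra_simps)
    finally have "int m dvd (b\<^sup>2 + 658) * y\<^sup>2" unfolding aa .
    moreover have "coprime (int m) (y\<^sup>2)" using cym by (simp add: coprime_commute)
    ultimately show ?thesis using that unfolding roots_def by (simp add: coprime_dvd_mult_left_iff)
  qed
  show ?thesis
  proof (rule ex1I[of _ b])
    show "b \<in> roots m \<and> int m dvd b * y - a * x" using br[of b] by' m unfolding b_def by simp
  next
    fix b' assume b': "b' \<in> roots m \<and> int m dvd b' * y - a * x"
    have "int m dvd (b' * y - a * x) - (b * y - a * x)" using b' by' dvd_diff by blast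
    hence "int m dvd (b' - b) * y" by (simp add: algebra_simps)
    hence "int m dvd b' - b" using cym by (simp add: coprime_dvd_mult_left_iff coprime_commute)
    thus "b' = b" using b' m unfolding b_def roots_def by (intro int_interval_eqI[of _ "int m"]) auto
  qed
qed

lemma prim_reps_unique:
  fixes b :: int
  assumes m: "m > 0"
    and t: "(a, x, y) \<in> prim_reps m" and t': "(a', x', y') \<in> prim_reps m"
    and b: "b \<in> roots m" "int m dvd b * y - a * x" "int m dvd b * y' - a' * x'"
  shows "(a', x', y') = (a, x, y) \<or> (a', x', y') = (a, -x, -y)"
proof -
  have a: "a \<in> {1, 2, 7, 14}" and e: "a * x\<^sup>2 + (658 div a) * y\<^sup>2 = int m" and xy: "coprime x y"
    using t by (auto simp: prim_reps_def)
  have a': "a' \<in> {1, 2, 7, 14}" and e': "a' * x'\<^sup>2 + (658 div a') * y'\<^sup>2 = int m" and xy': "coprime x' y'"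
    using t' by (auto simp: prim_reps_def)
  have aa: "a * (658 div a) = 658" "a' * (658 div a') = 658" using a a' by auto
  have N: "(a * x)\<^sup>2 + 658 * y\<^sup>2 = a * int m" "(a' * x')\<^sup>2 + 658 * y'\<^sup>2 = a' * int m"
  proof -
    have "(u * x)\<^sup>2 + (u * v) * y\<^sup>2 = u * (u * x\<^sup>2 + v * y\<^sup>2)" for u v x y :: int
      by (simp add: power2_eq_square algebra_simps)
    from this[of a x "658 div a" y] this[of a' x' "658 div a'" y']
    show "(a * x)\<^sup>2 + 658 * y\<^sup>2 = a * int m" "(a' * x')\<^sup>2 + 658 * y'\<^sup>2 = a' * int m"
      unfolding aa e e' .
  qed
  \<comment> \<open>With theta = \<open>sqrt (-658)\<close>, the product of
    \<open>a x + y theta\<close> and \<open>a' x' - y' theta\<close> has rational part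
    \<open>a x a' x' + 658 y y'\<close> and theta-coefficient \<open>a' x' y - a x y'\<close>. The
    common root \<open>b\<close> makes both divisible by \<open>m\<close>; the quotient
    \<open>U + V theta\<close> has norm \<open>a a'\<close>.\<close>
  have "int m dvd (b * y - a * x) * y' - (b * y' - a' * x') * y" using b by (intro dvd_diff) auto
  hence "int m dvd a' * x' * y - a * x * y'" by (simp add: algebra_simps)
  then obtain V where V: "a' * x' * y - a * x * y' = int m * V" by blast
  have "int m dvd (b\<^sup>2 + 658) * (y * y') - (b * y - a * x) * (b * y') - a * x * (b * y' - a' * x')"
    using b(1) by (intro dvd_diff dvd_mult2[OF b(2)] dvd_mult[OF b(3)]) (simp add: roots_def)
  hence "int m dvd a * x * a' * x' + 658 * y * y'" by (simp add: power2_eq_square algebra_simps)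
  then obtain U where U: "a * x * a' * x' + 658 * y * y' = int m * U" by blast
  have "(a * x * a' * x' + 658 * y * y')\<^sup>2 + 658 * (a' * x' * y - a * x * y')\<^sup>2 =
      ((a * x)\<^sup>2 + 658 * y\<^sup>2) * ((a' * x')\<^sup>2 + 658 * y'\<^sup>2)" by (simp add: power2_eq_square algebra_simps)
  hence "(int m)\<^sup>2 * (U\<^sup>2 + 658 * V\<^sup>2) = (int m)\<^sup>2 * (a * a')"
    unfolding U V N by (simp add: power2_eq_square algebra_simps)
  hence UV: "U\<^sup>2 + 658 * V\<^sup>2 = a * a'" using m by simp
  \<comment> \<open>The norm is at most 196 < 658, which forces \<open>V = 0\<close>. Then
    \<open>a a'\<close> is a perfect square, and distinct elements of {1, 2, 7, 14} never have a
    square product.\<close>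
  have lt: "a * a' < 200" using a a' by auto
  have V0: "V = 0"
  proof (rule ccontr)
    assume "V \<noteq> 0"
    hence "V\<^sup>2 > 0" by simp
    moreover have "U\<^sup>2 \<ge> 0" by simp
    ultimately show False using UV lt by linarith
  qed
  hence U2: "U\<^sup>2 = a * a'" using UV by simp
  have "\<bar>U\<bar> < 15"
  proof (rule ccontr)
    assume "\<not> \<bar>U\<bar> < 15"
    hence "15 * 15 \<le> \<bar>U\<bar> * \<bar>U\<bar>" by (intro mult_mono) auto
    thus False using U2 lt by (simp add: power2_eq_square)
  qed
  hence U14: "\<bar>U\<bar> \<in> set [0..14]" by simp
  have UU: "\<bar>U\<bar> * \<bar>U\<bar> = a * a'" using U2 by (simp add: power2_eq_square)
  have "\<forall>u\<in>set [0..14]. \<forall>a\<in>set [1,2,7,14::int]. \<forall>a'\<in>set [1,2,7,14]. u * u = a * a' \<longrightarrow> a = a'"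
    by code_simp
  from this[rule_format, OF U14 _ _ UU] have "a = a'" using a a' by simp
  have "a > 0" using a by auto
  have "x' * y = x * y'" using V V0 \<open>a > 0\<close> unfolding \<open>a = a'\<close>[symmetric] by (simp add: algebra_simps)
  have "y dvd x * y'" by (metis \<open>x' * y = x * y'\<close> dvd_triv_right)
  hence "y dvd y'" using xy by (metis coprime_dvd_mult_right_iff coprime_commute)
  have "y' dvd x' * y" by (metis \<open>x' * y = x * y'\<close> dvd_triv_right)
  hence "y' dvd y" using xy' by (metis coprime_dvd_mult_right_iff coprime_commute)
  have "x dvd x' * y" by (metis \<open>x' * y = x * y'\<close> dvd_triv_left)
  hence "x dvd x'" using xy by (metis coprime_dvd_mult_left_iff)
  have "x' dvd x * y'" by (metis \<open>x' * y = x * y'\<close> dvd_triv_left)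
  hence "x' dvd x" using xy' by (metis coprime_dvd_mult_left_iff)
  have "\<bar>x\<bar> = \<bar>x'\<bar>" "\<bar>y\<bar> = \<bar>y'\<bar>"
    using \<open>x dvd x'\<close> \<open>x' dvd x\<close> \<open>y dvd y'\<close> \<open>y' dvd y\<close> by (auto intro: zdvd_antisym_abs)
  hence s: "x' = x \<or> x' = -x" "y' = y \<or> y' = -y" by (auto simp: abs_eq_iff)
  have "y \<noteq> 0 \<or> x \<noteq> 0" using xy by auto
  show ?thesis
  proof (cases "x = 0 \<or> y = 0")
    case True thus ?thesis using s \<open>a = a'\<close> by auto
  next
    case False thus ?thesis using s \<open>x' * y = x * y'\<close> \<open>a = a'\<close> by auto
  qed
qed

lemma chi47_square: "chi47 (x * x) = (if 47 dvd x then 0 else 1)"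
proof -
  have "(if c then 0 else if P then 1 else (-1::int)) = 0 \<longleftrightarrow> c" for c P by simp
  hence "chi47 x = 0 \<longleftrightarrow> 47 dvd x" unfolding chi47_def dvd_eq_mod_eq_0 .
  thus ?thesis using chi47_values[of x] by (auto simp: chi47_mult)
qed

lemma chi47_cong: "x mod 47 = y mod 47 \<Longrightarrow> chi47 x = chi47 y"
  by (simp add: chi47_def)

text \<open>Modulo 47 each of the four forms becomes \<open>a x^2\<close>, and 1, 2, 7, 14 are
  squares modulo 47.\<close>

lemma reps_chi47:
  assumes "(a, x, y) \<in> reps n" "coprime n (658::nat)"
  shows "chi47 n = 1"
proof -
  have a: "a \<in> {1, 2, 7, 14}" and e: "a * x\<^sup>2 + (658 div a) * y\<^sup>2 = int n" using assms by (auto simp: reps_def)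
  have "47 dvd (658 div a)" using a by auto
  hence "int n mod 47 = (a * (x * x)) mod 47" unfolding e[symmetric]
    by (metis dvd_mult2 mod_add_right_eq mod_eq_0_iff_dvd add.right_neutral power2_eq_square)
  hence "chi47 n = chi47 a * chi47 (x * x)" by (metis chi47_cong chi47_mult)
  moreover have "chi47 a = 1" using a by (auto simp: chi47_def)
  ultimately show ?thesis using chi_coprime(3)[OF assms(2)] by (auto simp: chi47_square split: if_splits)
qed

lemma square_mod_8: "(x::int)\<^sup>2 mod 8 \<in> {0, 1, 4}" "odd x \<Longrightarrow> x\<^sup>2 mod 8 = 1"
proof -
  have "x mod 8 = 0 \<or> x mod 8 = 1 \<or> x mod 8 = 2 \<or> x mod 8 = 3 \<or> x mod 8 = 4 \<or> x mod 8 = 5 \<or> x mod 8 = 6 \<or> x mod 8 = 7"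
    by presburger
  moreover have "x\<^sup>2 mod 8 = (x mod 8)\<^sup>2 mod 8" by (simp add: power_mod)
  ultimately show "x\<^sup>2 mod 8 \<in> {0, 1, 4}" by (elim disjE) simp_all
  assume "odd x"
  hence "x mod 8 = 1 \<or> x mod 8 = 3 \<or> x mod 8 = 5 \<or> x mod 8 = 7" by presburger
  thus "x\<^sup>2 mod 8 = 1" using \<open>x\<^sup>2 mod 8 = (x mod 8)\<^sup>2 mod 8\<close> by (elim disjE) simp_all
qed

lemma rep_chi8:
  assumes n: "odd n" and e: "a * x\<^sup>2 + c * y\<^sup>2 = int n"
  shows "a = 1 \<Longrightarrow> c = 658 \<Longrightarrow> chi8 n = 1" "a = 2 \<Longrightarrow> c = 329 \<Longrightarrow> chi8 n = 1"
    "a = 7 \<Longrightarrow> c = 94 \<Longrightarrow> chi8 n = -1" "a = 14 \<Longrightarrow> c = 47 \<Longrightarrow> chi8 n = -1"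
proof -
  define u v where "u = x\<^sup>2 mod 8" and "v = y\<^sup>2 mod 8"
  have m: "int n mod 8 = (a mod 8 * u + c mod 8 * v) mod 8"
    unfolding e[symmetric] u_def v_def by (metis mod_add_eq mod_mult_eq)
  have uv: "u \<in> {0, 1, 4}" "v \<in> {0, 1, 4}" unfolding u_def v_def by (rule square_mod_8(1))+
  have o: "odd (a * x\<^sup>2 + c * y\<^sup>2)" using n e by simp
  { assume ac: "a = 1" "c = 658"
    hence "odd x" using o by simp
    hence "u = 1" using square_mod_8(2) unfolding u_def v_def by simp
    hence "int n mod 8 \<in> {1, 3}" using uv unfolding m ac by auto
    thus "chi8 n = 1" unfolding chi8_def by auto }
  { assume ac: "a = 2" "c = 329"
    hence "odd y" using o by simp
    hence "v = 1" using square_mod_8(2) unfolding u_def v_def by simp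
    hence "int n mod 8 \<in> {1, 3}" using uv unfolding m ac by auto
    thus "chi8 n = 1" unfolding chi8_def by auto }
  { assume ac: "a = 7" "c = 94"
    hence "odd x" using o by simp
    hence "u = 1" using square_mod_8(2) unfolding u_def v_def by simp
    hence "int n mod 8 \<in> {5, 7}" using uv unfolding m ac by auto
    thus "chi8 n = -1" unfolding chi8_def by auto }
  { assume ac: "a = 14" "c = 47"
    hence "odd y" using o by simp
    hence "v = 1" using square_mod_8(2) unfolding u_def v_def by simp
    hence "int n mod 8 \<in> {5, 7}" using uv unfolding m ac by auto
    thus "chi8 n = -1" unfolding chi8_def by auto }
qed

text \<open>By congruences modulo 8 a given odd \<open>n\<close> is represented only by forms of one
  sign, namely \<open>chi8 n\<close>.\<close>

lemma rep_diff_coprime: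
  assumes "coprime n (658::nat)"
  shows "rep_diff n = chi8 n * int (card (reps n))"
proof -
  have "coprime n (2 * 329)" using assms by simp
  hence "odd n" unfolding coprime_mult_right_iff by simp
  have "card (rep 1 658 n) = 0 \<or> chi8 n = 1" "card (rep 2 329 n) = 0 \<or> chi8 n = 1"
     "card (rep 7 94 n) = 0 \<or> chi8 n = -1" "card (rep 14 47 n) = 0 \<or> chi8 n = -1"
    using rep_chi8(1)[OF \<open>odd n\<close> _ refl refl] rep_chi8(2)[OF \<open>odd n\<close> _ refl refl]
      rep_chi8(3)[OF \<open>odd n\<close> _ refl refl] rep_chi8(4)[OF \<open>odd n\<close> _ refl refl]
    unfolding rep_def by (auto simp: card_eq_0_iff)
  moreover have "chi8 n = 1 \<or> chi8 n = -1" using chi_coprime(1)[OF assms] by blast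
  ultimately show ?thesis unfolding rep_diff_def card_reps by auto
qed


text \<open>The form with coefficients \<open>m\<close>, \<open>2 b\<close>, \<open>C\<close> is
  reduced. Its reduced first coefficient times \<open>m\<close> is a square modulo 47, so the
  hypothesis on \<open>chi47\<close> rules out the nonresidues 19 and 23 and leaves the four
  diagonal forms. The first column of the substitution represents \<open>m\<close>.\<close>

lemma prim_reps_exists:
  fixes b :: int
  assumes m: "m > 0" "coprime m (658::nat)" "chi47 m = 1" and b: "b \<in> roots m"
  shows "\<exists>a x y. (a, x, y) \<in> prim_reps m \<and> int m dvd b * y - a * x"
proof -
  obtain C where C: "b\<^sup>2 + 658 = int m * C" using b by (auto simp: roots_def)
  have "int m > 0" "int m * C - b\<^sup>2 = 658" using m C by simp_all
  from form_reduction[OF this] obtain \<alpha> \<beta> \<gamma> p q r s where h: "\<alpha> > 0" "\<alpha> * \<gamma> - \<beta>\<^sup>2 = 658" "2 * \<bar>\<beta>\<bar> \<le> \<alpha>" "\<alpha> \<le> \<gamma>"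
      "p * s - q * r = 1" "int m = \<alpha> * p\<^sup>2 + 2 * \<beta> * p * r + \<gamma> * r\<^sup>2" 
      "b = \<alpha> * p * q + \<beta> * (p * s + q * r) + \<gamma> * r * s" by metis
  have "(\<alpha> * p + \<beta> * r) * (\<alpha> * p + \<beta> * r) + 658 * r\<^sup>2 = \<alpha> * int m"
    unfolding h(6) h(2)[symmetric] by (simp add: power2_eq_square algebra_simps)
  hence e: "\<alpha> * int m = (\<alpha> * p + \<beta> * r) * (\<alpha> * p + \<beta> * r) + 47 * (14 * r\<^sup>2)" by simp
  have "(\<alpha> * int m) mod 47 = ((\<alpha> * p + \<beta> * r) * (\<alpha> * p + \<beta> * r)) mod 47" unfolding e by (rule mod_mult_self2)
  hence "chi47 (\<alpha> * int m) = chi47 ((\<alpha> * p + \<beta> * r) * (\<alpha> * p + \<beta> * r))" by (rule chi47_cong)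
  hence "chi47 \<alpha> \<in> {0, 1}" using m(3) by (simp add: chi47_mult[of \<alpha>] chi47_square)
  moreover have "chi47 19 = -1" "chi47 23 = -1" by (simp_all add: chi47_def)
  ultimately have "\<alpha> \<noteq> 19" "\<alpha> \<noteq> 23" by auto
  hence ab: "\<alpha> \<in> {1, 2, 7, 14}" "\<beta> = 0" using reduced_forms[OF h(1-4)] by auto
  have g: "\<gamma> = 658 div \<alpha>" using h(2) ab by auto
  \<comment> \<open>The sign of \<open>r\<close> is reversed to meet the convention that
    \<open>b y\<close> and \<open>a x\<close> agree modulo \<open>m\<close>.\<close>
  have pr: "coprime p (-r)"
  proof -
    have "coprime p r"
    proof (rule coprimeI)
      fix d assume "d dvd p" "d dvd r"
      hence "d dvd p * s - q * r" by (intro dvd_diff dvd_mult2 dvd_mult)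
      thus "is_unit d" using h(5) by simp
    qed
    thus ?thesis by simp
  qed
  have "int m = \<alpha> * p\<^sup>2 + (658 div \<alpha>) * (-r)\<^sup>2" using h(6) ab g by simp
  hence "(\<alpha>, p, -r) \<in> prim_reps m" using ab(1) pr unfolding prim_reps_def by simp
  moreover have "b * (-r) - \<alpha> * p = int m * (-s)"
  proof -
    have "p * s = 1 + q * r" using h(5) by simp
    have "\<alpha> * p * (p * s) = \<alpha> * p * (1 + q * r)" unfolding \<open>p * s = 1 + q * r\<close> ..
    thus ?thesis unfolding h(6,7) ab(2) by (simp add: power2_eq_square algebra_simps)
  qed
  hence "int m dvd b * (-r) - \<alpha> * p" by simp
  ultimately show ?thesis by blast
qed

lemma finite_prim_reps: "finite (prim_reps m)"
  by (rule finite_subset[OF _ finite_reps[of m]]) (auto simp: prim_reps_def reps_def)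

text \<open>The fibre of representations over each root is a single pair of opposite vectors; the
  factor 2 counts the units 1 and -1.\<close>

lemma card_prim_reps:
  assumes m: "m > 0" "coprime m (658::nat)" "chi47 m = 1"
  shows "card (prim_reps m) = 2 * card (roots m)"
proof -
  define F where "F b = {(a, x, y). (a, x, y) \<in> prim_reps m \<and> int m dvd b * y - a * x}" for b
  have un: "prim_reps m = (\<Union>b\<in>roots m. F b)"
  proof (intro equalityI subsetI)
    fix z assume z: "z \<in> prim_reps m"
    obtain a x y where "z = (a, x, y)" by (cases z)
    thus "z \<in> (\<Union>b\<in>roots m. F b)" using prim_reps_root[OF m(1,2), of a x y] z unfolding F_def by auto
  qed (auto simp: F_def)
  have cF: "card (F b) = 2" if b: "b \<in> roots m" for b
  proof -
    obtain a x y where t: "(a, x, y) \<in> prim_reps m" "int m dvd b * y - a * x"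
      using prim_reps_exists[OF m b] by blast
    have t': "(a, -x, -y) \<in> prim_reps m" using t by (simp add: prim_reps_def)
    have d': "int m dvd b * (-y) - a * (-x)" using t(2) by (simp add: dvd_diff_commute)
    have "F b = {(a, x, y), (a, -x, -y)}"
    proof
      show "F b \<subseteq> {(a, x, y), (a, -x, -y)}"
      proof
        fix z assume "z \<in> F b"
        then obtain a' x' y' where z: "z = (a', x', y')" "(a', x', y') \<in> prim_reps m" "int m dvd b * y' - a' * x'"
          unfolding F_def by auto
        show "z \<in> {(a, x, y), (a, -x, -y)}" using prim_reps_unique[OF m(1) t(1) z(2) b t(2) z(3)] z(1) by simp
      qed
      show "{(a, x, y), (a, -x, -y)} \<subseteq> F b" unfolding F_def using t t' d' by auto
    qed
    moreover have "(a, x, y) \<noteq> (a, -x, -y)" using t by (auto simp: prim_reps_def)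
    ultimately show ?thesis by simp
  qed
  have "card (prim_reps m) = (\<Sum>b\<in>roots m. card (F b))" unfolding un
  proof (rule card_UN_disjoint)
    show "\<forall>i\<in>roots m. finite (F i)"
    proof
      fix i
      have "F i \<subseteq> prim_reps m" unfolding F_def by auto
      thus "finite (F i)" using finite_subset finite_prim_reps by blast
    qed
    have "i = j" if "i \<in> roots m" "j \<in> roots m" "z \<in> F i" "z \<in> F j" for i j z
    proof -
      obtain a x y where "z = (a, x, y)" by (cases z)
      thus ?thesis using prim_reps_root[OF m(1,2), of a x y] that unfolding F_def by auto
    qed
    thus "\<forall>i\<in>roots m. \<forall>j\<in>roots m. i \<noteq> j \<longrightarrow> F i \<inter> F j = {}" by blast
  qed simp
  also have "\<dots> = 2 * card (roots m)" by (simp add: cF)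
  finally show ?thesis .
qed

text \<open>Splitting off \<open>c = gcd x y\<close> makes a representation primitive. Positivity of
  \<open>n\<close> excludes the pair with gcd 0.\<close>

lemma card_reps_eq_sum:
  assumes "n > 0"
  shows "card (reps n) = (\<Sum>c | c\<^sup>2 dvd n. card (prim_reps (n div c\<^sup>2)))"
proof -
  let ?S = "Sigma {c. c\<^sup>2 dvd n} (\<lambda>c. prim_reps (n div c\<^sup>2))"
  have "bij_betw (\<lambda>(c, a, x, y). (a, int c * x, int c * y)) ?S (reps n)"
  proof (rule bij_betw_byWitness[of _ "\<lambda>(a, x, y). (nat (gcd x y), a, x div gcd x y, y div gcd x y)"])
    have pos: "c > 0" if "c\<^sup>2 dvd n" for c using that assms by (auto intro: Nat.gr0I)
    show "\<forall>z\<in>?S. (case case z of (c, a, x, y) \<Rightarrow> (a, int c * x, int c * y) of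
        (a, x, y) \<Rightarrow> (nat (gcd x y), a, x div gcd x y, y div gcd x y)) = z"
    proof
      fix z assume "z \<in> ?S"
      then obtain c a x y where z: "z = (c, a, x, y)" and "c\<^sup>2 dvd n" and p: "(a, x, y) \<in> prim_reps (n div c\<^sup>2)"
        by auto
      have "gcd (int c * x) (int c * y) = int c * gcd x y" by (simp add: gcd_mult_left)
      moreover have "gcd x y = 1" using p by (simp add: prim_reps_def)
      ultimately have "gcd (int c * x) (int c * y) = int c" by simp
      thus "(case case z of (c, a, x, y) \<Rightarrow> (a, int c * x, int c * y) of
        (a, x, y) \<Rightarrow> (nat (gcd x y), a, x div gcd x y, y div gcd x y)) = z"
        using pos[OF \<open>c\<^sup>2 dvd n\<close>] unfolding z by simp
    qed
    have nz: "gcd x y \<noteq> 0" if "(a, x, y) \<in> reps n" for a x y :: int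
      using that assms by (auto simp: reps_def)
    show "\<forall>z\<in>reps n. (case case z of (a, x, y) \<Rightarrow> (nat (gcd x y), a, x div gcd x y, y div gcd x y)
        of (c, a, x, y) \<Rightarrow> (a, int c * x, int c * y)) = z"
      by auto
    show "(\<lambda>(c, a, x, y). (a, int c * x, int c * y)) ` ?S \<subseteq> reps n"
    proof
      fix z assume "z \<in> (\<lambda>(c, a, x, y). (a, int c * x, int c * y)) ` ?S"
      then obtain c a x y where z: "z = (a, int c * x, int c * y)"
        and c: "c\<^sup>2 dvd n" and p: "(a, x, y) \<in> prim_reps (n div c\<^sup>2)" by auto
      obtain k where k: "n = c\<^sup>2 * k" using c by blast
      have "n div c\<^sup>2 = k" using k pos[OF c] by simp
      hence a: "a \<in> {1, 2, 7, 14}" and e: "a * x\<^sup>2 + (658 div a) * y\<^sup>2 = int k" using p by (auto simp: prim_reps_def)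
      have "a * (int c * x)\<^sup>2 + (658 div a) * (int c * y)\<^sup>2 = int n"
        unfolding k of_nat_mult e[symmetric] by (simp add: power2_eq_square algebra_simps)
      thus "z \<in> reps n" using a unfolding z reps_def by blast
    qed
    show "(\<lambda>(a, x, y). (nat (gcd x y), a, x div gcd x y, y div gcd x y)) ` reps n \<subseteq> ?S"
    proof
      fix z assume "z \<in> (\<lambda>(a, x, y). (nat (gcd x y), a, x div gcd x y, y div gcd x y)) ` reps n"
      then obtain a x y where z: "z = (nat (gcd x y), a, x div gcd x y, y div gcd x y)"
        and r: "(a, x, y) \<in> reps n" by auto
      define c where "c = nat (gcd x y)"
      have c: "int c = gcd x y" "c > 0" using nz[OF r] unfolding c_def
        by (auto intro: Nat.gr0I simp: le_less gcd_ge_0_int)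
      obtain x' y' where xy: "x = int c * x'" "y = int c * y'" "coprime x' y'"
        using gcd_coprime_exists[of x y] nz[OF r] unfolding c(1) by (metis mult.commute)
      have a: "a \<in> {1, 2, 7, 14}" and e: "a * x\<^sup>2 + (658 div a) * y\<^sup>2 = int n" using r by (auto simp: reps_def)
      define k where "k = nat (a * x'\<^sup>2 + (658 div a) * y'\<^sup>2)"
      have "a * x'\<^sup>2 + (658 div a) * y'\<^sup>2 \<ge> 0" using a by auto
      hence k: "int k = a * x'\<^sup>2 + (658 div a) * y'\<^sup>2" unfolding k_def by simp
      have "int n = int (c\<^sup>2 * k)" unfolding e[symmetric] of_nat_mult k xy
        by (simp add: power2_eq_square algebra_simps)
      hence n: "n = c\<^sup>2 * k" by (simp only: of_nat_eq_iff)
      hence "c\<^sup>2 dvd n" by simp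
      have "n div c\<^sup>2 = k" using n c(2) by simp
      moreover have "x div gcd x y = x'" "y div gcd x y = y'"
        using c xy(1,2) by (metis nonzero_mult_div_cancel_left of_nat_0_less_iff less_irrefl)+
      ultimately have "(a, x div gcd x y, y div gcd x y) \<in> prim_reps (n div c\<^sup>2)"
        using a k xy(3) unfolding prim_reps_def by auto
      thus "z \<in> ?S" unfolding z c_def[symmetric] using \<open>c\<^sup>2 dvd n\<close> by blast
    qed
  qed
  hence "card (reps n) = card ?S" by (rule bij_betw_same_card[symmetric])
  also have "\<dots> = (\<Sum>c | c\<^sup>2 dvd n. card (prim_reps (n div c\<^sup>2)))"
    by (rule card_SigmaI) (simp_all add: finite_prim_reps finite_square_divisors[OF assms])
  finally show ?thesis .
qed

text \<open>The factor \<open>1 + chi47 n\<close> is the number of units where representations are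
  possible, and 0 where \<open>reps_chi47\<close> forbids them.\<close>

lemma card_reps_coprime:
  assumes n: "n > 0" "coprime n (658::nat)"
  shows "int (card (reps n)) = (1 + chi47 n) * (\<Sum>e | e dvd n. chiD (int e))"
proof (cases "chi47 n = 1")
  case False
  hence "chi47 n = -1" using chi_coprime(3)[OF n(2)] by simp
  moreover have "reps n = {}" using reps_chi47[OF _ n(2)] False by auto
  ultimately show ?thesis by simp
next
  case True
  have "card (reps n) = (\<Sum>c | c\<^sup>2 dvd n. card (prim_reps (n div c\<^sup>2)))" by (rule card_reps_eq_sum[OF n(1)])
  also have "\<dots> = (\<Sum>c | c\<^sup>2 dvd n. 2 * card (roots (n div c\<^sup>2)))"
  proof (rule sum.cong[OF refl])
    fix c assume "c \<in> {c. c\<^sup>2 dvd n}"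
    then obtain k where k: "n = c\<^sup>2 * k" by auto
    have "c > 0" "k > 0" using k n by (auto intro: Nat.gr0I)
    have cop: "coprime c 658" "coprime k 658" using k n by (auto simp: power2_eq_square)
    have "chi47 n = (chi47 c * chi47 c) * chi47 k" unfolding k by (simp add: chi47_mult power2_eq_square)
    hence "chi47 k = 1" using True chi_coprime(3)[OF cop(1)] by auto
    thus "card (prim_reps (n div c\<^sup>2)) = 2 * card (roots (n div c\<^sup>2))"
      using card_prim_reps[OF \<open>k > 0\<close> cop(2)] k \<open>c > 0\<close> by simp
  qed
  finally have "int (card (reps n)) = 2 * (\<Sum>c | c\<^sup>2 dvd n. int (card (roots (n div c\<^sup>2))))"
    by (simp add: sum_distrib_left)
  thus ?thesis unfolding sum_card_roots[OF n] using True by simp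
qed

text \<open>Both sides change by the same sign when a ramified prime 2, 7 or 47 is removed, which
  reduces everything to \<open>n\<close> prime to 658.\<close>

theorem rep_diff_eq_char_conv: "n > 0 \<Longrightarrow> rep_diff n = char_conv n"
proof (induction n rule: less_induct)
  case (less n)
  show ?case
  proof (cases "coprime n 658")
    case True
    show ?thesis unfolding rep_diff_coprime[OF True] card_reps_coprime[OF less.prems True] char_conv_coprime[OF less.prems True]
      by simp
  next
    case False
    hence "\<not> coprime n (2 * (7 * 47))" by simp
    hence "\<not> coprime n 2 \<or> \<not> coprime n 7 \<or> \<not> coprime n 47" unfolding coprime_mult_right_iff by blast
    moreover have "prime (7::nat)" "prime (47::nat)" by simp_all
    ultimately have "2 dvd n \<or> 7 dvd n \<or> 47 dvd n"
      by (metis coprime_commute prime_imp_coprime two_is_prime_nat)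
    thus ?thesis
    proof (elim disjE)
      assume "2 dvd n" then obtain k where k: "n = 2 * k" by blast
      thus ?thesis using less.IH[of k] less.prems char_conv_2[of k] rep_diff_2[of k] by simp
    next
      assume "7 dvd n" then obtain k where k: "n = 7 * k" by blast
      thus ?thesis using less.IH[of k] less.prems char_conv_7[of k] rep_diff_7[of k] by simp
    next
      assume "47 dvd n" then obtain k where k: "n = 47 * k" by blast
      thus ?thesis using less.IH[of k] less.prems char_conv_47[of k] rep_diff_47[of k] by simp
    qed
  qed
qed


subsection \<open>Values of L-series at 1\<close>

text \<open>Integer lists, lowest coefficient first, let the identities of high degree below be
  decided by evaluation; \<open>list_eval\<close> carries them over to real functions.\<close>

primrec list_eval :: "int list \<Rightarrow> real \<Rightarrow> real" where
  "list_eval [] x = 0"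
| "list_eval (a # as) x = of_int a + x * list_eval as x"

fun ladd :: "int list \<Rightarrow> int list \<Rightarrow> int list" where
  "ladd [] bs = bs"
| "ladd as [] = as"
| "ladd (a # as) (c # cs) = (a + c) # ladd as cs"

definition lsmult :: "int \<Rightarrow> int list \<Rightarrow> int list" where
  "lsmult c as = map (\<lambda>a. c * a) as"

text \<open>The separate case for a zero coefficient keeps products with sparse lists cheap.\<close>

primrec lmul :: "int list \<Rightarrow> int list \<Rightarrow> int list" where
  "lmul [] bs = []"
| "lmul (a # as) bs = (if a = 0 then 0 # lmul as bs else ladd (lsmult a bs) (0 # lmul as bs))"

primrec ldiff_aux :: "int \<Rightarrow> int list \<Rightarrow> int list" where
  "ldiff_aux n [] = []"
| "ldiff_aux n (a # as) = n * a # ldiff_aux (n + 1) as"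

definition ldiff :: "int list \<Rightarrow> int list" where
  "ldiff as = ldiff_aux 1 (tl as)"

text \<open>Equality up to trailing zeros, which the arithmetic does not remove.\<close>

definition list_eq :: "int list \<Rightarrow> int list \<Rightarrow> bool" where
  "list_eq as bs = list_all (\<lambda>a. a = 0) (ladd as (lsmult (-1) bs))"

lemma list_eval_ladd: "list_eval (ladd as bs) x = list_eval as x + list_eval bs x"
  by (induction as bs rule: ladd.induct) (auto simp: algebra_simps)

lemma list_eval_lsmult: "list_eval (lsmult c as) x = of_int c * list_eval as x"
  by (induction as) (auto simp: lsmult_def algebra_simps)

lemma list_eval_lmul: "list_eval (lmul as bs) x = list_eval as x * list_eval bs x"
  by (induction as) (auto simp: list_eval_ladd list_eval_lsmult algebra_simps)

lemma list_eval_zero: "list_all (\<lambda>a. a = 0) as \<Longrightarrow> list_eval as x = 0"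
  by (induction as) auto

lemma list_eq_eval: "list_eq as bs \<Longrightarrow> list_eval as x = list_eval bs x"
  unfolding list_eq_def by (drule list_eval_zero[of _ x]) (simp add: list_eval_ladd list_eval_lsmult)

lemma list_eval_ldiff_aux_Suc: "list_eval (ldiff_aux (n + 1) as) x = list_eval (ldiff_aux n as) x + list_eval as x"
proof (induction as arbitrary: n)
  case (Cons a as)
  show ?case using Cons[of "n + 1"] by (simp add: algebra_simps)
qed simp

lemma list_eval_deriv: "(list_eval as has_real_derivative list_eval (ldiff as) x) (at x)"
proof (induction as)
  case Nil thus ?case by (simp add: ldiff_def)
next
  case (Cons a as)
  have "((\<lambda>x. of_int a + x * list_eval as x) has_real_derivative (0 + (1 * list_eval as x + list_eval (ldiff as) x * x))) (at x)"
    by (intro DERIV_add DERIV_mult DERIV_ident DERIV_const Cons)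
  moreover have "list_eval (ldiff (a # as)) x = list_eval as x + x * list_eval (ldiff as) x"
  proof (cases as)
    case Nil thus ?thesis by (simp add: ldiff_def)
  next
    case (Cons b bs)
    thus ?thesis using list_eval_ldiff_aux_Suc[of 1 bs x] by (simp add: ldiff_def algebra_simps)
  qed
  ultimately show ?case by (simp add: algebra_simps)
qed

lemma list_eval_nonneg: "list_all (\<lambda>a. a \<ge> 0) as \<Longrightarrow> x \<ge> 0 \<Longrightarrow> list_eval as x \<ge> 0"
  by (induction as) auto

lemma list_eval_pos: "as \<noteq> [] \<Longrightarrow> hd as > 0 \<Longrightarrow> list_all (\<lambda>a. a \<ge> 0) as \<Longrightarrow> x \<ge> 0 \<Longrightarrow> list_eval as x > 0"
  by (cases as) (auto intro!: add_pos_nonneg mult_nonneg_nonneg list_eval_nonneg)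

text \<open>The product of \<open>1 - x \<zeta>^k\<close> over all \<open>k\<close> modulo 329 with \<open>chi329 k = 1\<close>, where \<open>\<zeta> = exp (2 pi i / 329)\<close>, is
  \<open>(p329 + sqrt 329 q329) / 2\<close>; likewise it is \<open>p376 + sqrt 94 q376\<close> for the modulus 376. The logarithmic
  derivative of such a product divided by its conjugate is a multiple of the generating function of the character.\<close>

definition p329 :: "int list" where
  "p329 = [2, -1, 82, 41, 478, 861, 1057, 3299, 3625, 4296, 9806, 7905, 9030, 19733, 12434, 14874, 33878,
    17142, 21625, 51338, 19530, 27092, 69075, 17533, 32094, 86725, 12355, 39543, 103021, 2379,
    48697, 114407, -14446, 60011, 121352, -35880, 75221, 123870, -61510, 91597, 119504, -89439,
    109160, 110515, -113143, 130290, 98422, -130395, 153226, 81530, -141377, 177386, 61333, -144142,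
    203526, 39679, -139530, 228734, 16505, -129347, 251197, -5991, -113068, 270537, -27130, -92793,
    283373, -48928, -71196, 287612, -71196, -48928, 283373, -92793, -27130, 270537, -113068, -5991,
    251197, -129347, 16505, 228734, -139530, 39679, 203526, -144142, 61333, 177386, -141377, 81530,
    153226, -130395, 98422, 130290, -113143, 110515, 109160, -89439, 119504, 91597, -61510, 123870,
    75221, -35880, 121352, 60011, -14446, 114407, 48697, 2379, 103021, 39543, 12355, 86725, 32094,
    17533, 69075, 27092, 19530, 51338, 21625, 17142, 33878, 14874, 12434, 19733, 9030, 7905, 9806,
    4296, 3625, 3299, 1057, 861, 478, 41, 82, -1, 2]"

definition q329 :: "int list" where
  "q329 = [0, -1, 0, -13, -14, -41, -109, -99, -229, -370, -268, -593, -768, -435, -1120, -1296, -582,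
    -1850, -1945, -632, -2684, -2536, -467, -3543, -2974, -197, -4525, -3233, 95, -5579, -3101, 489,
    -6620, -2507, 892, -7742, -1551, 1240, -8824, -185, 1576, -9721, 1428, 1669, -10527, 3006, 1348,
    -11175, 4548, 670, -11569, 6018, -409, -11802, 7276, -1861, -11852, 8336, -3487, -11667, 9149,
    -5219, -11324, 9627, -6964, -10737, 9883, -8518, -9790, 9978, -9790, -8518, 9883, -10737, -6964,
    9627, -11324, -5219, 9149, -11667, -3487, 8336, -11852, -1861, 7276, -11802, -409, 6018, -11569,
    670, 4548, -11175, 1348, 3006, -10527, 1669, 1428, -9721, 1576, -185, -8824, 1240, -1551, -7742,
    892, -2507, -6620, 489, -3101, -5579, 95, -3233, -4525, -197, -2974, -3543, -467, -2536, -2684,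
    -632, -1945, -1850, -582, -1296, -1120, -435, -768, -593, -268, -370, -229, -99, -109, -41, -14,
    -13, 0, -1, 0]"

definition p376 :: "int list" where
  "p376 = [1, 0, 47, 0, 399, 0, 1645, 0, 4577, 0, 9823, 0, 17375, 0, 26461, 0, 35645, 0, 43475, 0, 49159,
    0, 52969, 0, 55921, 0, 58891, 0, 62139, 0, 65189, 0, 67549, 0, 69231, 0, 71159, 0, 74589, 0,
    80033, 0, 86527, 0, 91867, 0, 93953, 0, 91867, 0, 86527, 0, 80033, 0, 74589, 0, 71159, 0, 69231,
    0, 67549, 0, 65189, 0, 62139, 0, 58891, 0, 55921, 0, 52969, 0, 49159, 0, 43475, 0, 35645, 0,
    26461, 0, 17375, 0, 9823, 0, 4577, 0, 1645, 0, 399, 0, 47, 0, 1]"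

definition q376 :: "int list" where
  "q376 = [0, -1, 0, -16, 0, -89, 0, -294, 0, -711, 0, -1376, 0, -2249, 0, -3212, 0, -4105, 0, -4806, 0,
    -5285, 0, -5620, 0, -5917, 0, -6240, 0, -6573, 0, -6856, 0, -7059, 0, -7228, 0, -7491, 0, -7950,
    0, -8589, 0, -9230, 0, -9635, 0, -9635, 0, -9230, 0, -8589, 0, -7950, 0, -7491, 0, -7228, 0,
    -7059, 0, -6856, 0, -6573, 0, -6240, 0, -5917, 0, -5620, 0, -5285, 0, -4806, 0, -4105, 0, -3212,
    0, -2249, 0, -1376, 0, -711, 0, -294, 0, -89, 0, -16, 0, -1, 0]"

definition list_geom :: "nat \<Rightarrow> int list" where "list_geom n = replicate n 1"
definition list_binomial :: "int \<Rightarrow> nat \<Rightarrow> int list" where "list_binomial c n = 1 # replicate (n - 1) 0 @ [c]"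

text \<open>Up to the factor \<open>2 * sqrt D\<close> this is the numerator in the logarithmic
  derivative of \<open>(p + sqrt D q) / (p - sqrt D q)\<close>; the denominator is the norm
  \<open>list_pell D p q\<close>.\<close>

definition list_wronskian :: "int list \<Rightarrow> int list \<Rightarrow> int list" where
  "list_wronskian p q = ladd (lmul (ldiff q) p) (lsmult (-1) (lmul q (ldiff p)))"

definition list_pell :: "int \<Rightarrow> int list \<Rightarrow> int list \<Rightarrow> int list" where
  "list_pell D p q = ladd (lmul p p) (lsmult (-D) (lmul q q))"

text \<open>The two conjugate factors multiply to the cyclotomic polynomial of order 376, which is
  \<open>(1 + x^188) / (1 + x^4)\<close>; denominators are cleared.\<close>

lemma pell_376: "list_eq (lmul [1,0,0,0,1] (list_pell 94 p376 q376)) (list_binomial 1 188)"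
  by code_simp

text \<open>The same for order 329 = 7 * 47, whose cyclotomic polynomial is the quotient of the
  geometric sums of lengths 329 and 7, 47. The 4 comes from the halves in
  \<open>(p + sqrt 329 q) / 2\<close>.\<close>

lemma pell_329: "list_eq (lmul (list_geom 7) (lmul (list_geom 47) (list_pell 329 p329 q329))) (lsmult 4 (list_geom 329))"
  by code_simp


text \<open>The Fekete polynomial of \<open>f\<close> divided by \<open>x\<close>. Over
  \<open>1 - x^d\<close> it generates the whole sequence \<open>f 1, f 2, ...\<close> when
  \<open>f\<close> has period \<open>d\<close>.\<close>

definition fekete :: "(int \<Rightarrow> int) \<Rightarrow> nat \<Rightarrow> int list" where
  "fekete f d = map (\<lambda>k. f (int k + 1)) [0..<d]"

lemma list_eval_map_upt: "list_eval (map f [m..<m + d]) x = (\<Sum>k<d. of_int (f (m + k)) * x ^ k)"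
proof (induction d arbitrary: m)
  case (Suc d)
  have "[m..<m + Suc d] = m # [Suc m..<Suc m + d]" by (simp add: upt_rec)
  hence "list_eval (map f [m..<m + Suc d]) x = of_int (f m) + x * (\<Sum>k<d. of_int (f (Suc m + k)) * x ^ k)"
    by (simp only: list.map list_eval.simps Suc)
  also have "\<dots> = (\<Sum>k<Suc d. of_int (f (m + k)) * x ^ k)"
    by (subst sum.lessThan_Suc_shift) (simp add: sum_distrib_left algebra_simps)
  finally show ?case .
qed simp

lemma list_eval_fekete: "list_eval (fekete f d) x = (\<Sum>k<d. of_int (f (int k + 1)) * x ^ k)"
  using list_eval_map_upt[of "\<lambda>k. f (int k + 1)" 0 d x] by (simp add: fekete_def)

definition sq47 :: "int list" where
  "sq47 = [1, 2, 3, 4, 6, 7, 8, 9, 12, 14, 16, 17, 18, 21, 24, 25, 27, 28, 32, 34, 36, 37, 42]"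

text \<open>The two polynomial identities below are evaluated by rewriting, which is far too slow with a set literal.\<close>

lemma chi47_code: "chi47 n = (if n mod 47 = 0 then 0 else if List.member sq47 (n mod 47) then 1 else -1)"
  by (simp add: chi47_def sq47_def)

lemmas [code del] = chi47_def
declare chi47_code [code]

text \<open>By the Gauss sum, the sum of \<open>chi k * ln (1 - x zeta^k)\<close> is
  \<open>- sqrt d\<close> times the sum of \<open>chi n * x^n / n\<close>, where \<open>d\<close> is
  the modulus. This identity and the next are its derivative, cleared of denominators;
  \<open>sqrt 376 = 2 * sqrt 94\<close> accounts for the different constants.\<close>

lemma fekete_329:
  "list_eq (lmul (list_geom 7) (lmul (list_binomial (-1) 47) (list_wronskian p329 q329))) (lsmult (-2) (fekete chi329 329))"
  by code_simp

lemma fekete_376: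
  "list_eq (lmul [1,0,0,0,1] (lmul (list_binomial (-1) 188) (list_wronskian p376 q376))) (lsmult (-1) (fekete chi376 376))"
  by code_simp

text \<open>The cyclotomic polynomials of orders 329 and 376 take the value 1 at 1, so their factors
  become units there; the negative values of \<open>q329\<close> and \<open>q376\<close> give the
  inverses of the units sought.\<close>

lemma units_at_1: "foldr (+) p329 0 = 4752830" "foldr (+) q329 0 = -262032"
  "foldr (+) p376 0 = 2143295" "foldr (+) q376 0 = -221064"
  by (simp_all add: p329_def q329_def p376_def q376_def)

lemma list_eval_at_1: "list_eval as 1 = of_int (foldr (+) as 0)"
  by (induction as) auto


section \<open>L-series as s tends to 1 from the right\<close>

definition L_series :: "(int \<Rightarrow> int) \<Rightarrow> real \<Rightarrow> real" where
  "L_series f s = (\<Sum>n. of_int (f (int n + 1)) * real (n + 1) powr (-s))"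

text \<open>Tannery's theorem (dominated convergence for series). Only the behaviour near 1 counts,
  so a bound on 1 < s < 2 suffices.\<close>

lemma suminf_tendsto_at_right_1:
  fixes f :: "nat \<Rightarrow> real \<Rightarrow> real"
  assumes lim: "\<And>k. (f k \<longlongrightarrow> g k) (at_right 1)" and M: "summable M"
    and bound: "\<And>k s. 1 < s \<Longrightarrow> s < 2 \<Longrightarrow> \<bar>f k s\<bar> \<le> M k"
  shows "summable g" "((\<lambda>s. \<Sum>k. f k s) \<longlongrightarrow> (\<Sum>k. g k)) (at_right 1)"
proof -
  have "eventually (\<lambda>s. 1 < s \<and> s < (2::real)) (at_right 1)"
    using eventually_at_right_real[of 1 2] by (simp add: conj_commute)
  from eventually_prodI[OF eventually_True this]
  have "\<forall>\<^sub>F (k, s) in sequentially \<times>\<^sub>F at_right 1. norm (f k s) \<le> M k"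
    by (rule eventually_mono) (use bound in auto)
  from tannerys_theorem[OF lim this M trivial_limit_at_right_real]
  show "summable g" "((\<lambda>s. \<Sum>k. f k s) \<longlongrightarrow> (\<Sum>k. g k)) (at_right 1)"
    by (auto intro: summable_norm_cancel)
qed

text \<open>Mean value theorem. The decay \<open>1 / m^2\<close>, uniform in \<open>s\<close>,
  dominates the sums over full periods, although the L-series itself converges only conditionally at
  1.\<close>

lemma powr_diff_bound:
  fixes m k s :: real
  assumes "m \<ge> 1" "k \<ge> 0" "1 < s" "s < 2"
  shows "\<bar>(m + k) powr (-s) - m powr (-s)\<bar> \<le> 2 * k / m\<^sup>2"
proof (cases "k = 0")
  case False
  have "\<exists>z. z > m \<and> z < m + k \<and> (m + k) powr (-s) - m powr (-s) = (m + k - m) * (-s * z powr (-s - 1))"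
    by (rule MVT2) (use assms False in \<open>auto intro!: derivative_eq_intros\<close>)
  then obtain z where z: "z > m" "(m + k) powr (-s) - m powr (-s) = k * (-s * z powr (-s - 1))" by auto
  have "z powr (-s - 1) \<le> z powr (-2)" using z assms by (intro powr_mono) auto
  also have "\<dots> \<le> m powr (-2)" using z assms by (intro powr_mono2') auto
  also have "\<dots> = 1 / m\<^sup>2" using assms by (simp add: powr_minus divide_inverse)
  finally have 1: "z powr (-s - 1) \<le> 1 / m\<^sup>2" .
  have "\<bar>(m + k) powr (-s) - m powr (-s)\<bar> = k * (s * z powr (-s - 1))"
    unfolding z(2) using assms by (simp add: abs_mult)
  also have "\<dots> \<le> k * (2 * (1 / m\<^sup>2))"
    using 1 assms by (intro mult_left_mono mult_mono) auto
  finally show ?thesis by (simp add: mult.commute)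
qed simp

lemma summable_powr_bounded:
  fixes c :: "nat \<Rightarrow> real"
  assumes "\<And>n. \<bar>c n\<bar> \<le> 1" "s > 1"
  shows "summable (\<lambda>n. c n * real (n + 1) powr (-s))"
proof (rule summable_comparison_test')
  show "summable (\<lambda>n. real (n + 1) powr (-s))"
    using summable_Suc_iff[of "\<lambda>n. real n powr (-s)"] summable_real_powr_iff[of "-s"] assms by simp
  show "norm (c n * real (n + 1) powr (-s)) \<le> real (n + 1) powr (-s)" if "n \<ge> 0" for n
    using assms(1)[of n] by (simp add: abs_mult mult_left_le_one_le)
qed

lemma DERIV_power_div: "((\<lambda>x. x ^ (n + 1) / real (n + 1)) has_real_derivative x ^ n) (at x)"
proof -
  have "((\<lambda>x. x ^ (n + 1) / real (n + 1)) has_real_derivative (real (n + 1) * x ^ n / real (n + 1))) (at x)"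
    by (intro DERIV_cdivide) (use DERIV_pow[of "n + 1" x UNIV] in simp)
  thus ?thesis by (simp del: of_nat_add of_nat_Suc)
qed

text \<open>The sum over the first \<open>J\<close> periods at \<open>s = 1\<close> is the integral of \<open>V x * (1 - x ^ (J * d))\<close> over the unit interval.\<close>

theorem L_series_limit:
  fixes f :: "int \<Rightarrow> int" and h V :: "real \<Rightarrow> real"
  assumes d: "d > 0" and per: "\<And>n. f (n + int d) = f n" and bd: "\<And>n. \<bar>f n\<bar> \<le> 1"
    and h: "\<And>x. 0 \<le> x \<Longrightarrow> x \<le> 1 \<Longrightarrow> (h has_real_derivative V x) (at x)"
    and V: "\<And>x. 0 \<le> x \<Longrightarrow> x \<le> 1 \<Longrightarrow> V x * (1 - x ^ d) = (\<Sum>k<d. of_int (f (int k + 1)) * x ^ k)"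
    and M: "\<And>x. 0 \<le> x \<Longrightarrow> x \<le> 1 \<Longrightarrow> \<bar>V x\<bar> \<le> M"
  shows "(L_series f \<longlongrightarrow> h 1 - h 0) (at_right 1)"
proof -
  define B where "B j s = (\<Sum>k<d. of_int (f (int k + 1)) * real (j * d + k + 1) powr (-s))" for j s
  define B1 where "B1 j = (\<Sum>k<d. of_int (f (int k + 1)) / real (j * d + k + 1))" for j
  have per': "f (n + int j * int d) = f n" for n and j :: nat
  proof (induction j)
    case (Suc j)
    have "f (n + int (Suc j) * int d) = f ((n + int j * int d) + int d)" by (simp add: algebra_simps)
    thus ?case using Suc per by simp
  qed simp
  have bd': "\<bar>real_of_int (f n)\<bar> \<le> 1" for n using bd[of n] by linarith
  \<comment> \<open>At \<open>x = 1\<close> the hypothesis on \<open>V\<close> says that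
    \<open>f\<close> sums to 0 over a period.\<close>
  have "real_of_int (\<Sum>k<d. f (int k + 1)) = 0" using V[of 1] by simp
  hence zero: "(\<Sum>k<d. real_of_int (f (int k + 1))) = 0" by simp
  have LB: "L_series f s = (\<Sum>j. B j s)" if "s > 1" for s
  proof -
    have "summable (\<lambda>n. real_of_int (f (int n + 1)) * real (n + 1) powr (-s))"
      by (rule summable_powr_bounded) (use bd' that in auto)
    hence "(\<lambda>n. real_of_int (f (int n + 1)) * real (n + 1) powr (-s)) sums L_series f s"
      unfolding L_series_def by (rule summable_sums)
    from sums_group[OF this d]
    have "(\<lambda>j. \<Sum>n\<in>{j * d..<j * d + d}. real_of_int (f (int n + 1)) * real (n + 1) powr (-s)) sums L_series f s" .
    moreover have "(\<Sum>n\<in>{j * d..<j * d + d}. real_of_int (f (int n + 1)) * real (n + 1) powr (-s)) = B j s" for j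
    proof -
      have "(\<Sum>n\<in>{j * d..<j * d + d}. real_of_int (f (int n + 1)) * real (n + 1) powr (-s))
          = (\<Sum>k\<in>{0..<d}. real_of_int (f (int (k + j * d) + 1)) * real (k + j * d + 1) powr (-s))"
        using sum.shift_bounds_nat_ivl[of "\<lambda>n. real_of_int (f (int n + 1)) * real (n + 1) powr (-s)" 0 "j * d" d]
        by (simp add: add.commute)
      also have "\<dots> = B j s" unfolding B_def atLeast0LessThan
      proof (rule sum.cong[OF refl])
        fix k
        have "f (int (k + j * d) + 1) = f (int k + 1)" using per'[of "int k + 1" j] by (simp add: algebra_simps)
        thus "real_of_int (f (int (k + j * d) + 1)) * real (k + j * d + 1) powr (-s) =
           real_of_int (f (int k + 1)) * real (j * d + k + 1) powr (-s)" by (simp add: add.commute add.left_commute)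
      qed
      finally show ?thesis .
    qed
    ultimately show ?thesis by (simp add: sums_iff)
  qed
  have bound: "\<bar>B j s\<bar> \<le> 2 * (real d)\<^sup>2 * (1 / real (j + 1) ^ 2)" if s: "1 < s" "s < 2" for j s
  proof -
    define m where "m = real (j * d + 1)"
    have m: "m \<ge> 1" "m \<ge> real (j + 1)" 
    proof -
      have "j * 1 \<le> j * d" using d by (intro mult_left_mono) auto
      hence "j + 1 \<le> j * d + 1" by simp
      thus "m \<ge> real (j + 1)" unfolding m_def by (simp only: of_nat_le_iff)
    qed (simp add: m_def)
    \<comment> \<open>Since \<open>f\<close> sums to 0, the constant \<open>m powr (-s)\<close> may
      be subtracted inside the period, which gains one power of \<open>m\<close>.\<close>
    have "B j s = (\<Sum>k<d. of_int (f (int k + 1)) * ((m + k) powr (-s) - m powr (-s))) + m powr (-s) * (\<Sum>k<d. of_int (f (int k + 1)))"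
      unfolding B_def m_def sum_distrib_left sum.distrib[symmetric] by (intro sum.cong) (auto simp: algebra_simps)
    hence "B j s = (\<Sum>k<d. of_int (f (int k + 1)) * ((m + k) powr (-s) - m powr (-s)))"
      unfolding zero by simp
    also have "\<bar>\<dots>\<bar> \<le> (\<Sum>k<d. \<bar>of_int (f (int k + 1)) * ((m + k) powr (-s) - m powr (-s))\<bar>)" by (rule sum_abs)
    also have "\<dots> \<le> (\<Sum>k<d. 2 * real d * (1 / real (j + 1) ^ 2))"
    proof (rule sum_mono)
      fix k assume k: "k \<in> {..<d}"
      have "\<bar>of_int (f (int k + 1)) * ((m + k) powr (-s) - m powr (-s))\<bar> \<le> 1 * (2 * k / m\<^sup>2)"
        unfolding abs_mult using powr_diff_bound[of m k s] bd' m s by (intro mult_mono) auto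
      also have "1 * (2 * k / m\<^sup>2) \<le> 2 * real d / (real (j + 1))\<^sup>2"
        using k m by (auto intro!: frac_le power_mono)
      finally show "\<bar>of_int (f (int k + 1)) * ((m + k) powr (-s) - m powr (-s))\<bar> \<le> 2 * real d * (1 / real (j + 1) ^ 2)" by simp
    qed
    also have "\<dots> = 2 * (real d)\<^sup>2 * (1 / real (j + 1) ^ 2)" by (simp add: power2_eq_square)
    finally show ?thesis .
  qed
  have lim: "(B j \<longlongrightarrow> B1 j) (at_right 1)" for j
  proof -
    have "(B j \<longlongrightarrow> (\<Sum>k<d. of_int (f (int k + 1)) * real (j * d + k + 1) powr (-1))) (at_right 1)"
      unfolding B_def by (intro tendsto_intros) (simp del: of_nat_add of_nat_mult of_nat_Suc)
    also have "(\<Sum>k<d. of_int (f (int k + 1)) * real (j * d + k + 1) powr (-1)) = B1 j"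
      unfolding B1_def by (intro sum.cong refl) (simp add: powr_minus divide_inverse)
    finally show ?thesis .
  qed
  have ev12: "eventually (\<lambda>s. 1 < s \<and> s < (2::real)) (at_right 1)"
    using eventually_at_right_real[of 1 2] by (simp add: conj_commute)
  have "summable (\<lambda>n. 1 / real (n + 1) ^ 2)"
    using summable_Suc_iff[of "\<lambda>n. inverse (real n ^ 2)"] inverse_power_summable[of 2, where ?'a = real]
    by (simp add: divide_inverse)
  hence M': "summable (\<lambda>j. 2 * (real d)\<^sup>2 * (1 / real (j + 1) ^ 2))" by (rule summable_mult)
  note lm = suminf_tendsto_at_right_1(2)[OF lim M' bound]
  define F where "F J x = (\<Sum>j<J. \<Sum>k<d. of_int (f (int k + 1)) * (x ^ (j * d + k + 1) / real (j * d + k + 1)))" for J and x :: real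
  have M0: "M \<ge> 0" using M[of 0] by force
  have derF: "(F J has_real_derivative (V x * (1 - x ^ (J * d)))) (at x)" if x: "0 \<le> x" "x \<le> 1" for J x
  proof -
    have "(F J has_real_derivative (\<Sum>j<J. \<Sum>k<d. of_int (f (int k + 1)) * x ^ (j * d + k))) (at x)"
      unfolding F_def by (intro DERIV_sum DERIV_cmult DERIV_power_div)
    also have "(\<Sum>j<J. \<Sum>k<d. of_int (f (int k + 1)) * x ^ (j * d + k)) =
        (\<Sum>j<J. x ^ (j * d) * (V x * (1 - x ^ d)))"
      unfolding V[OF x] sum_distrib_left by (intro sum.cong refl) (simp add: power_add)
    also have "\<dots> = V x * ((\<Sum>j<J. (x ^ d) ^ j) * (1 - x ^ d))"
      by (simp add: sum_distrib_right sum_distrib_left power_mult[symmetric] mult.commute mult.left_commute)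
    also have "(\<Sum>j<J. (x ^ d) ^ j) * (1 - x ^ d) = 1 - (x ^ d) ^ J"
      using power_diff_1_eq[of "x ^ d" J] by (simp add: algebra_simps)
    also have "(x ^ d) ^ J = x ^ (J * d)" by (simp add: power_mult[symmetric] mult.commute)
    finally show ?thesis .
  qed
  have est: "\<bar>(h 1 - h 0) - F J 1\<bar> \<le> M / real (J * d + 1)" for J
  proof -
    \<comment> \<open>Instead of integrating the error \<open>V x * x ^ (J * d)\<close>, the
      primitive of its bound is added or subtracted: \<open>g 1\<close> is nondecreasing and
      \<open>g (-1)\<close> is nonincreasing.\<close>
    define g where "g c x = (h x - F J x) + c * (M * (x ^ (J * d + 1) / real (J * d + 1)))" for c x :: real
    have dg: "(g c has_real_derivative (V x * x ^ (J * d) + c * (M * x ^ (J * d)))) (at x)" if x: "0 \<le> x" "x \<le> 1" for c x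
    proof -
      have "(g c has_real_derivative (V x - V x * (1 - x ^ (J * d)) + c * (M * x ^ (J * d)))) (at x)"
        unfolding g_def by (intro DERIV_add DERIV_diff DERIV_cmult DERIV_power_div h[OF x] derF[OF x])
      thus ?thesis by (simp add: algebra_simps)
    qed
    have Vb: "- (M * x ^ (J * d)) \<le> V x * x ^ (J * d)" "V x * x ^ (J * d) \<le> M * x ^ (J * d)" if x: "0 \<le> x" "x \<le> 1" for x
      using M[OF x] x mult_right_mono[of "-M" "V x" "x ^ (J * d)"] mult_right_mono[of "V x" M "x ^ (J * d)"] by auto
    have "g 1 0 \<le> g 1 1"
    proof (rule DERIV_nonneg_imp_nondecreasing[of 0 1])
      fix x :: real assume x: "0 \<le> x" "x \<le> 1"
      show "\<exists>y. (g 1 has_real_derivative y) (at x) \<and> 0 \<le> y"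
        using dg[OF x, of 1] Vb[OF x] by (intro exI conjI) auto
    qed simp
    moreover have "g (-1) 0 \<ge> g (-1) 1"
    proof (rule DERIV_nonpos_imp_nonincreasing[of 0 1])
      fix x :: real assume x: "0 \<le> x" "x \<le> 1"
      show "\<exists>y. (g (-1) has_real_derivative y) (at x) \<and> y \<le> 0"
        using dg[OF x, of "-1"] Vb[OF x] by (intro exI conjI) auto
    qed simp
    moreover have "F J 0 = 0" unfolding F_def by simp
    ultimately show ?thesis unfolding g_def by (simp add: abs_le_iff)
  qed
  have "(\<lambda>J. F J 1) \<longlonglongrightarrow> h 1 - h 0"
  proof -
    have "(\<lambda>J. M / real (J * d + 1)) \<longlonglongrightarrow> 0"
    proof (rule tendsto_sandwich[OF _ _ tendsto_const])
      show "\<forall>\<^sub>F J in sequentially. 0 \<le> M / real (J * d + 1)" using M0 by simp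
      show "\<forall>\<^sub>F J in sequentially. M / real (J * d + 1) \<le> M / real (Suc J)"
        using M0 d by (intro always_eventually allI frac_le) (auto simp del: of_nat_Suc of_nat_add of_nat_mult)
      show "(\<lambda>J. M / real (Suc J)) \<longlonglongrightarrow> 0" by (rule LIMSEQ_Suc[OF lim_const_over_n])
    qed
    hence "(\<lambda>J. (h 1 - h 0) - F J 1) \<longlonglongrightarrow> 0"
      by (rule Lim_null_comparison[rotated]) (use est in \<open>simp add: eventually_sequentially\<close>)
    from tendsto_diff[OF tendsto_const[of "h 1 - h 0"] this] show ?thesis by simp
  qed
  moreover have "F J 1 = (\<Sum>j<J. B1 j)" for J unfolding F_def B1_def by simp
  ultimately have "B1 sums (h 1 - h 0)" unfolding sums_def by simp
  hence "(\<Sum>j. B1 j) = h 1 - h 0" by (rule sums_unique[symmetric])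
  hence "((\<lambda>s. \<Sum>j. B j s) \<longlongrightarrow> h 1 - h 0) (at_right 1)" using lm by simp
  moreover have "eventually (\<lambda>s. (\<Sum>j. B j s) = L_series f s) (at_right 1)"
    using ev12 by (rule eventually_mono) (use LB in auto)
  ultimately show ?thesis using tendsto_cong by force
qed


lemma bounded_on_unit:
  fixes V :: "real \<Rightarrow> real"
  assumes "continuous_on {0..1} V"
  obtains M where "\<And>x. 0 \<le> x \<Longrightarrow> x \<le> 1 \<Longrightarrow> \<bar>V x\<bar> \<le> M"
proof -
  have "bounded (V ` {0..1})" by (intro compact_imp_bounded compact_continuous_image assms) simp
  then obtain M where "\<forall>y\<in>V ` {0..1}. norm y \<le> M" unfolding bounded_iff by blast
  thus ?thesis using that by force
qed

text \<open>The primitive of \<open>V\<close> is a multiple of the logarithm of |A / B| for the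
  conjugates \<open>A = p + sqrt D q\<close> and \<open>B = p - sqrt D q\<close>. Squares inside the
  logarithms avoid any discussion of signs and turn \<open>2 * sqrt D\<close> into
  \<open>4 * sqrt D\<close>. The functions \<open>G\<close>, \<open>E\<close>, \<open>M\<close>
  clear denominators, so that polynomial identities can supply the hypotheses; \<open>Epos\<close>
  keeps the norm away from 0.\<close>

theorem L_series_limit_real:
  fixes f :: "int \<Rightarrow> int" and D :: nat and p q :: "int list" and G E M :: "real \<Rightarrow> real" and c \<kappa> :: real
  assumes d: "d > 0" and per: "\<And>n. f (n + int d) = f n" and bd: "\<And>n. \<bar>f n\<bar> \<le> 1"
    and D: "D > 0"
    and E: "\<And>x. 0 \<le> x \<Longrightarrow> ((list_eval p x)\<^sup>2 - D * (list_eval q x)\<^sup>2) * G x = E x"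
    and Epos: "\<And>x. 0 \<le> x \<Longrightarrow> E x > 0"
    and M: "\<And>x. 0 \<le> x \<Longrightarrow> M x * E x = c * (1 - x ^ d)" and c: "c > 0"
    and W: "\<And>x. 0 \<le> x \<Longrightarrow> - \<kappa> * (list_eval (ldiff q) x * list_eval p x - list_eval q x * list_eval (ldiff p) x) * G x * M x = c * list_eval (fekete f d) x"
    and q0: "list_eval q 0 = 0"
  shows "(L_series f \<longlongrightarrow> - \<kappa> / (4 * sqrt D) *
      (ln ((list_eval p 1 + sqrt D * list_eval q 1)\<^sup>2) - ln ((list_eval p 1 - sqrt D * list_eval q 1)\<^sup>2))) (at_right 1)"
proof -
  define A where "A x = list_eval p x + sqrt D * list_eval q x" for x
  define B where "B x = list_eval p x - sqrt D * list_eval q x" for x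
  define w where "w x = list_eval (ldiff q) x * list_eval p x - list_eval q x * list_eval (ldiff p) x" for x
  define V where "V x = - \<kappa> * w x / ((list_eval p x)\<^sup>2 - D * (list_eval q x)\<^sup>2)" for x
  define h where "h x = - \<kappa> / (4 * sqrt D) * (ln ((A x)\<^sup>2) - ln ((B x)\<^sup>2))" for x
  have AB: "A x * B x = (list_eval p x)\<^sup>2 - D * (list_eval q x)\<^sup>2" for x
    unfolding A_def B_def by (simp add: algebra_simps power2_eq_square)
  have nz: "(list_eval p x)\<^sup>2 - D * (list_eval q x)\<^sup>2 \<noteq> 0" if "0 \<le> x" for x
    using E[OF that] Epos[OF that] by auto
  have cont: "continuous_on S (list_eval l)" for S and l
    by (meson DERIV_isCont continuous_at_imp_continuous_on list_eval_deriv)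
  have "continuous_on {0..1} V" unfolding V_def w_def
    by (intro continuous_intros cont) (use nz in auto)
  then obtain K where K: "\<And>x. 0 \<le> x \<Longrightarrow> x \<le> 1 \<Longrightarrow> \<bar>V x\<bar> \<le> K" by (rule bounded_on_unit) blast
  have "(L_series f \<longlongrightarrow> h 1 - h 0) (at_right 1)"
  proof (rule L_series_limit[where f = f and d = d and V = V and h = h and M = K, OF d per bd _ _ K])
    fix x :: real assume x: "0 \<le> x" "x \<le> 1"
    have A0: "A x \<noteq> 0" "B x \<noteq> 0" using nz[OF x(1)] AB[of x] by auto
    have dA: "(A has_real_derivative (list_eval (ldiff p) x + sqrt D * list_eval (ldiff q) x)) (at x)"
      unfolding A_def by (auto intro!: derivative_eq_intros list_eval_deriv)
    have dB: "(B has_real_derivative (list_eval (ldiff p) x - sqrt D * list_eval (ldiff q) x)) (at x)"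
      unfolding B_def by (auto intro!: derivative_eq_intros list_eval_deriv)
    have lnsq: "((\<lambda>x. ln ((F x)\<^sup>2)) has_real_derivative (2 * F' / F x)) (at x)"
      if "(F has_real_derivative F') (at x)" "F x \<noteq> 0" for F F'
    proof -
      have "((\<lambda>x. (F x)\<^sup>2) has_real_derivative (F' * F x + F' * F x)) (at x)"
        unfolding power2_eq_square using that(1) by (auto intro!: derivative_eq_intros)
      hence "((\<lambda>x. ln ((F x)\<^sup>2)) has_real_derivative (1 / (F x)\<^sup>2 * (F' * F x + F' * F x))) (at x)"
        using that(2) by (intro DERIV_chain2[OF DERIV_ln_divide]) simp_all
      moreover have "1 / (F x)\<^sup>2 * (F' * F x + F' * F x) = 2 * F' / F x"
        using that(2) by (simp add: power2_eq_square field_simps)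
      ultimately show ?thesis by simp
    qed
    have "(h has_real_derivative (- \<kappa> / (4 * sqrt D) * (2 * (list_eval (ldiff p) x + sqrt D * list_eval (ldiff q) x) / A x
         - 2 * (list_eval (ldiff p) x - sqrt D * list_eval (ldiff q) x) / B x))) (at x)"
      unfolding h_def by (intro DERIV_cmult DERIV_diff lnsq dA dB A0)
    also have "2 * (list_eval (ldiff p) x + sqrt D * list_eval (ldiff q) x) / A x - 2 * (list_eval (ldiff p) x - sqrt D * list_eval (ldiff q) x) / B x
        = 4 * sqrt D * w x / (A x * B x)"
    proof -
      have "2 * (list_eval (ldiff p) x + sqrt D * list_eval (ldiff q) x) * B x - 2 * (list_eval (ldiff p) x - sqrt D * list_eval (ldiff q) x) * A x
         = 4 * sqrt D * w x" unfolding A_def B_def w_def by (simp add: algebra_simps)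
      thus ?thesis using A0 by (simp add: field_simps)
    qed
    also have "- \<kappa> / (4 * sqrt D) * (4 * sqrt D * w x / (A x * B x)) = V x"
      using D unfolding AB V_def by simp
    finally show "(h has_real_derivative V x) (at x)" .
    have "c * (V x * (1 - x ^ d)) = V x * (M x * E x)" using M[OF x(1)] by simp
    also have "\<dots> = - \<kappa> * w x * G x * M x" unfolding E[OF x(1), symmetric] V_def using nz[OF x(1)] by simp
    also have "\<dots> = c * list_eval (fekete f d) x" unfolding w_def by (rule W[OF x(1)])
    finally have "V x * (1 - x ^ d) = list_eval (fekete f d) x" using c by simp
    thus "V x * (1 - x ^ d) = (\<Sum>k<d. real_of_int (f (int k + 1)) * x ^ k)" unfolding list_eval_fekete .
  qed
  moreover have "h 0 = 0" unfolding h_def A_def B_def q0 by simp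
  ultimately have "(L_series f \<longlongrightarrow> h 1) (at_right 1)" by simp
  thus ?thesis unfolding h_def A_def B_def .
qed

lemma list_eval_append: "list_eval (xs @ ys) x = list_eval xs x + x ^ length xs * list_eval ys x"
  by (induction xs) (auto simp: algebra_simps)

lemma list_eval_replicate_0: "list_eval (replicate n 0) x = 0"
  by (induction n) auto

lemma list_eval_binomial: "n > 0 \<Longrightarrow> list_eval (list_binomial c n) x = 1 + of_int c * x ^ n"
  unfolding list_binomial_def by (cases n) (simp_all add: list_eval_append list_eval_replicate_0)

lemma list_eval_list_geom: "list_eval (list_geom n) x * (1 - x) = 1 - x ^ n"
proof (induction n)
  case (Suc n)
  have "list_eval (list_geom (Suc n)) x * (1 - x) = (1 - x) + x * (list_eval (list_geom n) x * (1 - x))"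
    by (simp add: list_geom_def algebra_simps)
  thus ?case unfolding Suc by (simp add: algebra_simps)
qed (simp add: list_geom_def)

lemma list_eval_list_geom_pos: "n > 0 \<Longrightarrow> x \<ge> 0 \<Longrightarrow> list_eval (list_geom n) x > 0"
  unfolding list_geom_def by (rule list_eval_pos) (auto simp: hd_replicate list_all_iff)

lemma list_eval_wronskian: "list_eval (list_wronskian p q) x = list_eval (ldiff q) x * list_eval p x - list_eval q x * list_eval (ldiff p) x"
  unfolding list_wronskian_def by (simp add: list_eval_ladd list_eval_lsmult list_eval_lmul)

lemma list_eval_pell: "list_eval (list_pell D p q) x = (list_eval p x)\<^sup>2 - of_int D * (list_eval q x)\<^sup>2"
  unfolding list_pell_def by (simp add: list_eval_ladd list_eval_lsmult list_eval_lmul power2_eq_square)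

lemma chi_bounds: "\<bar>chi8 n\<bar> \<le> 1" "\<bar>chi7 n\<bar> \<le> 1" "\<bar>chi47 n\<bar> \<le> 1" "\<bar>chi329 n\<bar> \<le> 1" "\<bar>chi376 n\<bar> \<le> 1"
proof -
  have "chi8 n = -1 \<or> chi8 n = 0 \<or> chi8 n = 1" "chi7 n = -1 \<or> chi7 n = 0 \<or> chi7 n = 1" "chi47 n = -1 \<or> chi47 n = 0 \<or> chi47 n = 1"
    using chi8_values[of n] chi7_values[of n] chi47_values[of n] by auto
  thus "\<bar>chi8 n\<bar> \<le> 1" "\<bar>chi7 n\<bar> \<le> 1" "\<bar>chi47 n\<bar> \<le> 1" "\<bar>chi329 n\<bar> \<le> 1" "\<bar>chi376 n\<bar> \<le> 1"
    unfolding chi329_def chi376_def by auto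
qed

lemma chi_periodic: "chi8 (n + 8) = chi8 n" "chi7 (n + 7) = chi7 n" "chi329 (n + 329) = chi329 n"
  "chi376 (n + 376) = chi376 n"
proof -
  have m: "(n + 329) mod 7 = n mod 7" "(n + 329) mod 47 = n mod 47" "(n + 376) mod 8 = n mod 8"
      "(n + 376) mod 47 = n mod 47" "(n + 8) mod 8 = n mod 8" "(n + 7) mod 7 = n mod 7"
    using mod_mult_self2[of n 7 47] mod_mult_self2[of n 47 7] mod_mult_self2[of n 8 47] mod_mult_self2[of n 47 8]
    by simp_all
  have c: "chi7 (n + 329) = chi7 n" "chi8 (n + 376) = chi8 n"
    unfolding chi7_def chi8_def m by (rule refl)+
  show "chi329 (n + 329) = chi329 n" "chi376 (n + 376) = chi376 n"
    unfolding chi329_def chi376_def c chi47_cong[OF m(2)] chi47_cong[OF m(4)] by (rule refl)+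
  show "chi8 (n + 8) = chi8 n" "chi7 (n + 7) = chi7 n"
    unfolding chi7_def chi8_def m by (rule refl)+
qed

theorem L_series_329_limit: "(L_series chi329 \<longlongrightarrow> 2 * ln (2376415 + 131016 * sqrt 329) / sqrt 329) (at_right 1)"
proof -
  have "(L_series chi329 \<longlongrightarrow> - 2 / (4 * sqrt (329::nat)) *
      (ln ((list_eval p329 1 + sqrt (329::nat) * list_eval q329 1)\<^sup>2) - ln ((list_eval p329 1 - sqrt (329::nat) * list_eval q329 1)\<^sup>2))) (at_right 1)"
  proof (rule L_series_limit_real[where d = 329 and G = "\<lambda>x. list_eval (list_geom 7) x * list_eval (list_geom 47) x"
        and E = "\<lambda>x. 4 * list_eval (list_geom 329) x" and M = "\<lambda>x. 1 - x" and c = 4])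
    fix x :: real assume x: "0 \<le> x"
    show "((list_eval p329 x)\<^sup>2 - real 329 * (list_eval q329 x)\<^sup>2) * (list_eval (list_geom 7) x * list_eval (list_geom 47) x) = 4 * list_eval (list_geom 329) x"
      using list_eq_eval[OF pell_329, of x] by (simp add: list_eval_lmul list_eval_lsmult list_eval_pell algebra_simps)
    show "0 < 4 * list_eval (list_geom 329) x" using list_eval_list_geom_pos[of 329 x] x by simp
    show "(1 - x) * (4 * list_eval (list_geom 329) x) = 4 * (1 - x ^ 329)" using list_eval_list_geom[of 329 x] by (simp add: algebra_simps)
    have a: "list_eval (list_geom 7) x * ((1 - x ^ 47) * list_eval (list_wronskian p329 q329) x) = - 2 * list_eval (fekete chi329 329) x"
      using list_eq_eval[OF fekete_329, of x] by (simp add: list_eval_lmul list_eval_lsmult list_eval_binomial)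
    show "- 2 * (list_eval (ldiff q329) x * list_eval p329 x - list_eval q329 x * list_eval (ldiff p329) x) * (list_eval (list_geom 7) x * list_eval (list_geom 47) x) * (1 - x)
       = 4 * list_eval (fekete chi329 329) x"
      using a unfolding list_eval_wronskian list_eval_list_geom[of 47 x, symmetric] by (simp add: algebra_simps)
  qed (use chi_periodic(3) chi_bounds(4) in \<open>simp_all add: q329_def\<close>)
  note lim = this
  have vals: "list_eval p329 1 = 2 * 2376415" "list_eval q329 1 = - 2 * 131016" by (simp_all add: list_eval_at_1 units_at_1)
  note lim[unfolded vals]
  also have "- 2 / (4 * sqrt (329::nat)) * (ln ((2 * 2376415 + sqrt (329::nat) * (- 2 * 131016))\<^sup>2) - ln ((2 * 2376415 - sqrt (329::nat) * (- 2 * 131016))\<^sup>2))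
     = 2 * ln (2376415 + 131016 * sqrt 329) / sqrt 329"
  proof -
    \<comment> \<open>The conjugate of the unit \<open>e\<close> is its inverse, so the two values
      at 1 are \<open>2 / e\<close> and \<open>2 * e\<close>; the factor 2 drops out of the
      difference of logarithms.\<close>
    define e where "e = 2376415 + 131016 * sqrt 329"
    have e0: "e > 0" unfolding e_def by (intro add_pos_pos mult_pos_pos) simp_all
    have ee: "(2376415 - 131016 * sqrt 329) * e = 1"
      unfolding e_def by (simp add: algebra_simps)
    hence e': "2376415 - 131016 * sqrt 329 = inverse e" using e0 by (simp add: field_simps)
    have "2 * 2376415 + sqrt (329::nat) * (- 2 * 131016) = 2 * inverse e" unfolding e'[symmetric] by simp
    moreover have "2 * 2376415 - sqrt (329::nat) * (- 2 * 131016) = 2 * e" unfolding e_def by simp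
    moreover have "ln ((2 * inverse e)\<^sup>2) = 2 * (ln 2 - ln e)" "ln ((2 * e)\<^sup>2) = 2 * (ln 2 + ln e)"
    proof -
      have l: "ln (2 * inverse e) = ln 2 - ln e" "ln (2 * e) = ln 2 + ln e"
        using e0 by (simp_all add: ln_mult ln_inverse)
      have "ln ((2 * inverse e)\<^sup>2) = real 2 * ln (2 * inverse e)" "ln ((2 * e)\<^sup>2) = real 2 * ln (2 * e)"
        using e0 by (intro ln_realpow; simp)+
      thus "ln ((2 * inverse e)\<^sup>2) = 2 * (ln 2 - ln e)" "ln ((2 * e)\<^sup>2) = 2 * (ln 2 + ln e)" unfolding l by simp_all
    qed
    ultimately show ?thesis unfolding e_def[symmetric] by (simp only:) (simp add: field_simps)
  qed
  finally show ?thesis .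
qed

theorem L_series_376_limit: "(L_series chi376 \<longlongrightarrow> ln (2143295 + 221064 * sqrt 94) / sqrt 94) (at_right 1)"
proof -
  have "(L_series chi376 \<longlongrightarrow> - 1 / (4 * sqrt (94::nat)) *
      (ln ((list_eval p376 1 + sqrt (94::nat) * list_eval q376 1)\<^sup>2) - ln ((list_eval p376 1 - sqrt (94::nat) * list_eval q376 1)\<^sup>2))) (at_right 1)"
  proof (rule L_series_limit_real[where d = 376 and G = "\<lambda>x. 1 + x ^ 4"
        and E = "\<lambda>x. 1 + x ^ 188" and M = "\<lambda>x. 1 - x ^ 188" and c = 1])
    fix x :: real assume x: "0 \<le> x"
    have l: "list_eval [1,0,0,0,1] x = 1 + x ^ 4" by (simp add: eval_nat_numeral)
    show "((list_eval p376 x)\<^sup>2 - real 94 * (list_eval q376 x)\<^sup>2) * (1 + x ^ 4) = 1 + x ^ 188"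
      using list_eq_eval[OF pell_376, of x] unfolding list_eval_lmul l list_eval_pell list_eval_binomial[of 188, simplified] by (simp add: mult.commute)
    show "0 < 1 + x ^ 188" using x by (simp add: add_pos_nonneg)
    have "x ^ 376 = x ^ 188 * x ^ 188" by (simp flip: power_add)
    thus "(1 - x ^ 188) * (1 + x ^ 188) = 1 * (1 - x ^ 376)" by (simp add: algebra_simps)
    have a: "(1 + x ^ 4) * ((1 - x ^ 188) * list_eval (list_wronskian p376 q376) x) = - 1 * list_eval (fekete chi376 376) x"
      using list_eq_eval[OF fekete_376, of x] unfolding list_eval_lmul l list_eval_lsmult list_eval_binomial[of 188, simplified] by simp
    show "- 1 * (list_eval (ldiff q376) x * list_eval p376 x - list_eval q376 x * list_eval (ldiff p376) x) * (1 + x ^ 4) * (1 - x ^ 188)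
       = 1 * list_eval (fekete chi376 376) x"
      using a unfolding list_eval_wronskian by (simp only: mult.assoc mult.commute mult.left_commute mult_minus_left mult_1_left minus_equation_iff[of "_ * _"])
  qed (use chi_periodic(4) chi_bounds(5) in \<open>simp_all add: q376_def\<close>)
  note lim = this
  have vals: "list_eval p376 1 = 2143295" "list_eval q376 1 = - 221064" by (simp_all add: list_eval_at_1 units_at_1)
  note lim[unfolded vals]
  also have "- 1 / (4 * sqrt (94::nat)) * (ln ((2143295 + sqrt (94::nat) * (- 221064))\<^sup>2) - ln ((2143295 - sqrt (94::nat) * (- 221064))\<^sup>2))
     = ln (2143295 + 221064 * sqrt 94) / sqrt 94"
  proof -
    define e where "e = 2143295 + 221064 * sqrt 94"
    have e0: "e > 0" unfolding e_def by (intro add_pos_pos mult_pos_pos) simp_all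
    have ee: "(2143295 - 221064 * sqrt 94) * e = 1"
      unfolding e_def by (simp add: algebra_simps)
    hence e': "2143295 - 221064 * sqrt 94 = inverse e" using e0 by (simp add: field_simps)
    have "2143295 + sqrt (94::nat) * (- 221064) = inverse e" unfolding e'[symmetric] by simp
    moreover have "2143295 - sqrt (94::nat) * (- 221064) = e" unfolding e_def by simp
    moreover have "ln ((inverse e)\<^sup>2) = - 2 * ln e" "ln (e\<^sup>2) = 2 * ln e"
    proof -
      have "ln ((inverse e)\<^sup>2) = real 2 * ln (inverse e)" "ln (e\<^sup>2) = real 2 * ln e"
        using e0 by (intro ln_realpow; simp)+
      thus "ln ((inverse e)\<^sup>2) = - 2 * ln e" "ln (e\<^sup>2) = 2 * ln e" using e0 by (simp_all add: ln_inverse)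
    qed
    ultimately show ?thesis unfolding e_def[symmetric] by (simp only:) (simp add: field_simps)
  qed
  finally show ?thesis .
qed

text \<open>\<open>arctan ((Q - P) / (Q + P))\<close> is the argument of \<open>P + \<i> Q\<close> minus \<open>pi / 4\<close>; unlike \<open>Q / P\<close>, this quotient
  stays finite where \<open>P\<close> vanishes.\<close>

theorem L_series_limit_imaginary:
  fixes f :: "int \<Rightarrow> int" and P Q P' Q' :: "real \<Rightarrow> real"
  assumes d: "d > 0" and per: "\<And>n. f (n + int d) = f n" and bd: "\<And>n. \<bar>f n\<bar> \<le> 1"
    and dP: "\<And>x. (P has_real_derivative P' x) (at x)" and dQ: "\<And>x. (Q has_real_derivative Q' x) (at x)"
    and cont: "continuous_on {0..1} P'" "continuous_on {0..1} Q'"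
    and pos: "\<And>x. 0 \<le> x \<Longrightarrow> x \<le> 1 \<Longrightarrow> P x + Q x > 0"
    and W: "\<And>x. 0 \<le> x \<Longrightarrow> x \<le> 1 \<Longrightarrow> \<kappa> * (Q' x * P x - Q x * P' x) * (1 - x ^ d) =
        (\<Sum>k<d. of_int (f (int k + 1)) * x ^ k) * ((P x)\<^sup>2 + (Q x)\<^sup>2)"
    and P1: "P 1 = 0" and Q0: "Q 0 = 0"
  shows "(L_series f \<longlongrightarrow> \<kappa> * pi / 2) (at_right 1)"
proof -
  define V where "V x = \<kappa> * (Q' x * P x - Q x * P' x) / ((P x)\<^sup>2 + (Q x)\<^sup>2)" for x
  define h where "h x = \<kappa> * arctan ((Q x - P x) / (Q x + P x))" for x
  have nz: "(P x)\<^sup>2 + (Q x)\<^sup>2 > 0" if "0 \<le> x" "x \<le> 1" for x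
    using pos[OF that] by (auto simp: sum_power2_gt_zero_iff)
  have cPQ: "continuous_on {0..1} P" "continuous_on {0..1} Q"
    using dP dQ by (meson DERIV_isCont continuous_at_imp_continuous_on)+
  have "continuous_on {0..1} V" unfolding V_def
    by (intro continuous_intros cont cPQ) (use nz in force)
  then obtain K where K: "\<And>x. 0 \<le> x \<Longrightarrow> x \<le> 1 \<Longrightarrow> \<bar>V x\<bar> \<le> K" by (rule bounded_on_unit) blast
  have "(L_series f \<longlongrightarrow> h 1 - h 0) (at_right 1)"
  proof (rule L_series_limit[where f = f and d = d and V = V and h = h and M = K, OF d per bd _ _ K])
    fix x :: real assume x: "0 \<le> x" "x \<le> 1"
    have s0: "Q x + P x \<noteq> 0" using pos[OF x] by simp
    define u where "u = (Q x - P x) / (Q x + P x)"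
    have du: "((\<lambda>x. (Q x - P x) / (Q x + P x)) has_real_derivative
        ((Q' x - P' x) * (Q x + P x) - (Q x - P x) * (Q' x + P' x)) / ((Q x + P x) * (Q x + P x))) (at x)"
      by (intro DERIV_divide DERIV_diff DERIV_add dP dQ s0)
    have "(h has_real_derivative (\<kappa> * (inverse (1 + u\<^sup>2) *
        (((Q' x - P' x) * (Q x + P x) - (Q x - P x) * (Q' x + P' x)) / ((Q x + P x) * (Q x + P x)))))) (at x)"
      unfolding h_def u_def by (intro DERIV_cmult DERIV_chain2[OF DERIV_arctan du])
    also have "1 + u\<^sup>2 = 2 * ((P x)\<^sup>2 + (Q x)\<^sup>2) / (Q x + P x)\<^sup>2"
    proof -
      have "1 + u\<^sup>2 = ((Q x + P x)\<^sup>2 + (Q x - P x)\<^sup>2) / (Q x + P x)\<^sup>2"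
        unfolding u_def power_divide using s0 by (simp add: add_divide_distrib)
      also have "(Q x + P x)\<^sup>2 + (Q x - P x)\<^sup>2 = 2 * ((P x)\<^sup>2 + (Q x)\<^sup>2)"
        by (simp add: power2_eq_square algebra_simps)
      finally show ?thesis .
    qed
    also have "(Q' x - P' x) * (Q x + P x) - (Q x - P x) * (Q' x + P' x) = 2 * (Q' x * P x - Q x * P' x)"
      by (simp add: algebra_simps)
    also have "\<kappa> * (inverse (2 * ((P x)\<^sup>2 + (Q x)\<^sup>2) / (Q x + P x)\<^sup>2) * (2 * (Q' x * P x - Q x * P' x) / ((Q x + P x) * (Q x + P x)))) = V x"
    proof -
      have "k * (inverse (2 * N / s\<^sup>2) * (2 * w / (s * s))) = k * w / N"
        if "s \<noteq> 0" "N > 0" for k N s w :: real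
        using that by (simp add: power2_eq_square field_simps)
      from this[OF s0 nz[OF x]] show ?thesis unfolding V_def .
    qed
    finally show "(h has_real_derivative V x) (at x)" .
    show "V x * (1 - x ^ d) = (\<Sum>k<d. real_of_int (f (int k + 1)) * x ^ k)"
    proof -
      have "a / N * b = c" if "a * b = c * N" "N > 0" for a b c N :: real
        using that by (simp add: field_simps)
      from this[OF W[OF x] nz[OF x]] show ?thesis unfolding V_def .
    qed
  qed
  \<comment> \<open>From 0 to 1 the quotient inside the arctangent goes from -1 to 1, so the
    argument of \<open>P + i Q\<close> grows by \<open>pi / 2\<close>.\<close>
  moreover have "h 1 - h 0 = \<kappa> * pi / 2"
  proof -
    have "h 1 = \<kappa> * (pi / 4)" unfolding h_def P1 using pos[of 1] P1 by (simp add: arctan_one)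
    moreover have "h 0 = - (\<kappa> * (pi / 4))" unfolding h_def Q0 using pos[of 0] Q0
      by (simp add: arctan_minus arctan_one)
    ultimately show ?thesis by (simp only:)
  qed
  ultimately show ?thesis by (simp only:)
qed

text \<open>Here \<open>P + i Q\<close> is the product of \<open>1 - x zeta^k\<close> over the
  residues \<open>k\<close> with \<open>chi8 k = -1\<close>, where zeta = exp (2 pi i / 8).\<close>

theorem L_series_8_limit: "(L_series chi8 \<longlongrightarrow> pi / (2 * sqrt 2)) (at_right 1)"
proof -
  have "(L_series chi8 \<longlongrightarrow> (1 / sqrt 2) * pi / 2) (at_right 1)"
  proof (rule L_series_limit_imaginary[where d = 8 and P = "\<lambda>x. 1 - x\<^sup>2" and Q = "\<lambda>x. sqrt 2 * x"
       and P' = "\<lambda>x. - 2 * x" and Q' = "\<lambda>x. sqrt 2"])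
    fix x :: real
    show "((\<lambda>x. 1 - x\<^sup>2) has_real_derivative - 2 * x) (at x)" by (auto intro!: derivative_eq_intros)
    show "((\<lambda>x. sqrt 2 * x) has_real_derivative sqrt 2) (at x)" by (auto intro!: derivative_eq_intros)
    assume x: "0 \<le> x" "x \<le> 1"
    show "0 < 1 - x\<^sup>2 + sqrt 2 * x"
    proof (cases "x = 0")
      case False
      have "x\<^sup>2 \<le> 1" using x by (simp add: power_le_one)
      moreover have "sqrt 2 * x > 0" using x False by simp
      ultimately show ?thesis by linarith
    qed simp
    have s: "sqrt 2 * (sqrt 2 * y) = 2 * y" for y :: real by (simp flip: mult.assoc)
    have "(\<Sum>k<8. real_of_int (chi8 (int k + 1)) * x ^ k) = 1 + x\<^sup>2 - x ^ 4 - x ^ 6"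
      by (simp add: eval_nat_numeral chi8_def)
    moreover have "1 / sqrt 2 * (sqrt 2 * (1 - x\<^sup>2) - sqrt 2 * x * (- 2 * x)) = 1 + x\<^sup>2"
      by (simp add: field_simps power2_eq_square)
    ultimately show "1 / sqrt 2 * (sqrt 2 * (1 - x\<^sup>2) - sqrt 2 * x * (- 2 * x)) * (1 - x ^ 8) =
         (\<Sum>k<8. real_of_int (chi8 (int k + 1)) * x ^ k) * ((1 - x\<^sup>2)\<^sup>2 + (sqrt 2 * x)\<^sup>2)"
      by (simp add: power_mult_distrib) (simp add: eval_nat_numeral algebra_simps)
  qed (use chi_periodic(1) chi_bounds(1) in \<open>auto intro!: continuous_intros\<close>)
  thus ?thesis by (simp add: field_simps)
qed

text \<open>Here \<open>P + i Q\<close> is twice the product of \<open>1 - x zeta^k\<close> over the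
  residues \<open>k\<close> with \<open>chi7 k = -1\<close>, where zeta = exp (2 pi i / 7). The
  factor 2 clears the halves in the Gauss periods.\<close>

theorem L_series_7_limit: "(L_series chi7 \<longlongrightarrow> pi / sqrt 7) (at_right 1)"
proof -
  have "(L_series chi7 \<longlongrightarrow> (2 / sqrt 7) * pi / 2) (at_right 1)"
  proof (rule L_series_limit_imaginary[where d = 7 and P = "\<lambda>x. 2 + x - x\<^sup>2 - 2 * x ^ 3" and Q = "\<lambda>x. sqrt 7 * (x + x\<^sup>2)"
       and P' = "\<lambda>x. 1 - 2 * x - 6 * x\<^sup>2" and Q' = "\<lambda>x. sqrt 7 * (1 + 2 * x)"])
    fix x :: real
    show "((\<lambda>x. 2 + x - x\<^sup>2 - 2 * x ^ 3) has_real_derivative (1 - 2 * x - 6 * x\<^sup>2)) (at x)" by (auto intro!: derivative_eq_intros)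
    show "((\<lambda>x. sqrt 7 * (x + x\<^sup>2)) has_real_derivative sqrt 7 * (1 + 2 * x)) (at x)" by (auto intro!: derivative_eq_intros)
    assume x: "0 \<le> x" "x \<le> 1"
    show "0 < 2 + x - x\<^sup>2 - 2 * x ^ 3 + sqrt 7 * (x + x\<^sup>2)"
    proof (cases "x = 0")
      case False
      have "2 + x - x\<^sup>2 - 2 * x ^ 3 = (1 - x) * (2 + 3 * x + 2 * x\<^sup>2)" by (simp add: algebra_simps eval_nat_numeral)
      also have "\<dots> \<ge> 0" using x by (intro mult_nonneg_nonneg add_nonneg_nonneg) auto
      finally have "0 \<le> 2 + x - x\<^sup>2 - 2 * x ^ 3" .
      moreover have "sqrt 7 * (x + x\<^sup>2) > 0" using x False by (intro mult_pos_pos add_pos_nonneg) auto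
      ultimately show ?thesis by linarith
    qed simp
    have "(\<Sum>k<7. real_of_int (chi7 (int k + 1)) * x ^ k) = 1 + x - x\<^sup>2 + x ^ 3 - x ^ 4 - x ^ 5"
      by (simp add: eval_nat_numeral chi7_def)
    moreover have "2 / sqrt 7 * (sqrt 7 * (1 + 2 * x) * (2 + x - x\<^sup>2 - 2 * x ^ 3) - sqrt 7 * (x + x\<^sup>2) * (1 - 2 * x - 6 * x\<^sup>2))
        = 2 * ((1 + 2 * x) * (2 + x - x\<^sup>2 - 2 * x ^ 3) - (x + x\<^sup>2) * (1 - 2 * x - 6 * x\<^sup>2))"
      by (simp add: field_simps)
    ultimately show "2 / sqrt 7 * (sqrt 7 * (1 + 2 * x) * (2 + x - x\<^sup>2 - 2 * x ^ 3) - sqrt 7 * (x + x\<^sup>2) * (1 - 2 * x - 6 * x\<^sup>2)) * (1 - x ^ 7) =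
         (\<Sum>k<7. real_of_int (chi7 (int k + 1)) * x ^ k) * ((2 + x - x\<^sup>2 - 2 * x ^ 3)\<^sup>2 + (sqrt 7 * (x + x\<^sup>2))\<^sup>2)"
      by (simp add: power_mult_distrib) (simp add: eval_nat_numeral algebra_simps)
  qed (use chi_periodic(2) chi_bounds(2) in \<open>auto intro!: continuous_intros\<close>)
  thus ?thesis by simp
qed


subsection \<open>Gauss's product formulas\<close>

definition ln_euler :: "real \<Rightarrow> real" where
  "ln_euler x = (\<Sum>k. ln (1 - x ^ Suc k))"

lemma summable_ln_one_minus:
  assumes "0 < x" "x < (1::real)"
  shows "summable (\<lambda>k. ln (1 - x ^ Suc k))"
proof (rule summable_comparison_test')
  show "summable (\<lambda>k. x ^ Suc k / (1 - x))"
    using assms by (intro summable_divide) (simp add: summable_mult)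
  fix k :: nat
  have l: "x ^ Suc k \<le> x" "0 < x ^ Suc k" using assms power_decreasing[of 1 "Suc k" x] by auto
  have p: "1 - x ^ Suc k > 0" using l(1) assms by linarith
  have "- ln (1 - x ^ Suc k) = ln (1 / (1 - x ^ Suc k))" using p by (simp add: ln_div)
  also have "\<dots> \<le> 1 / (1 - x ^ Suc k) - 1" using p by (intro ln_le_minus_one) simp
  also have "\<dots> = x ^ Suc k / (1 - x ^ Suc k)" using p by (simp add: field_simps del: power_Suc)
  also have "\<dots> \<le> x ^ Suc k / (1 - x)" 
  proof (rule divide_left_mono)
    show "1 - x \<le> 1 - x ^ Suc k" using l by linarith
  qed (use l p assms in \<open>auto simp del: power_Suc\<close>)
  finally show "norm (ln (1 - x ^ Suc k)) \<le> x ^ Suc k / (1 - x)" using p l by (simp del: power_Suc)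
qed

lemma prod_tendsto_exp_ln_euler:
  assumes "0 < x" "x < (1::real)"
  shows "(\<lambda>n. \<Prod>k<n. 1 - x ^ Suc k) \<longlonglongrightarrow> exp (ln_euler x)"
proof -
  have "(\<lambda>n. \<Sum>k<n. ln (1 - x ^ Suc k)) \<longlonglongrightarrow> ln_euler x"
    unfolding ln_euler_def using summable_ln_one_minus[OF assms] by (rule summable_LIMSEQ)
  hence "(\<lambda>n. exp (\<Sum>k<n. ln (1 - x ^ Suc k))) \<longlonglongrightarrow> exp (ln_euler x)" by (rule tendsto_exp)
  moreover have "exp (\<Sum>k<n. ln (1 - x ^ Suc k)) = (\<Prod>k<n. 1 - x ^ Suc k)" for n
  proof -
    have "x ^ Suc k < 1" for k using assms power_Suc_less_one by auto
    thus ?thesis by (simp add: exp_sum)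
  qed
  ultimately show ?thesis by simp
qed

definition Ppsi :: "real \<Rightarrow> nat \<Rightarrow> real" where
  "Ppsi x n = (\<Prod>k<n. (1 - x ^ (2 * k + 2)) / (1 - x ^ (2 * k + 1)))"

text \<open>Partial products for phi at \<open>-x\<close>: the sign is already absorbed, whereas
  \<open>Ppsi x\<close> belongs to psi at \<open>x\<close> itself.\<close>

definition Pphi :: "real \<Rightarrow> nat \<Rightarrow> real" where
  "Pphi x n = (\<Prod>k<n. (1 - x ^ Suc k) / (1 + x ^ Suc k))"

lemma abs_power_less_one: "\<bar>x\<bar> < 1 \<Longrightarrow> n > 0 \<Longrightarrow> \<bar>x ^ n\<bar> < (1::real)"
  by (simp add: power_abs power_less_one_iff)

lemma factors_nz:
  assumes "\<bar>x\<bar> < (1::real)" "n > 0"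
  shows "1 - x ^ n > 0" "1 + x ^ n > 0"
  using abs_power_less_one[OF assms] by (auto simp: abs_less_iff)

lemma Ppsi_pos: "\<bar>x\<bar> < 1 \<Longrightarrow> Ppsi x n > 0"
proof -
  assume x: "\<bar>x\<bar> < 1"
  have "0 < (1 - x ^ (2 * k + 2)) / (1 - x ^ (2 * k + 1))" for k
    by (intro divide_pos_pos factors_nz[OF x]) auto
  thus ?thesis unfolding Ppsi_def by (intro prod_pos) blast
qed

lemma Pphi_pos: "\<bar>x\<bar> < 1 \<Longrightarrow> Pphi x n > 0"
  unfolding Pphi_def by (intro prod_pos divide_pos_pos ballI) (use factors_nz[of x "Suc _"] in auto)

text \<open>Shanks's finite versions of the two product formulas: the difference of consecutive sums telescopes, and in
  the limit only the term \<open>s = 0\<close> survives.\<close>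

lemma shanks_phi:
  assumes x: "\<bar>x\<bar> < 1"
  shows "(\<Sum>s\<le>n. (-1) ^ s * (Pphi x n / Pphi x s) * (2 * x ^ (s * (n + 1)) / (1 + x ^ s)))
    = 1 + 2 * (\<Sum>k<n. (-1) ^ Suc k * x ^ (Suc k)\<^sup>2)"
proof (induction n)
  case 0 show ?case by (simp add: Pphi_def)
next
  case (Suc n)
  let ?P = "Pphi x"
  define y where "y = x ^ Suc n"
  have nz: "1 + x ^ s \<noteq> 0" for s using factors_nz(2)[OF x, of s] by (cases s) auto
  have Pn: "?P s \<noteq> 0" for s using Pphi_pos[OF x, of s] by simp
  have PS: "?P (Suc s) = ?P s * ((1 - x ^ Suc s) / (1 + x ^ Suc s))" for s by (simp add: Pphi_def)
  \<comment> \<open>The quantity that telescopes: raising \<open>n\<close> by 1 changes the summand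
    by a difference in \<open>s\<close>. The value 0 at \<open>s = 0\<close> agrees with the factor
    \<open>1 - x^0\<close> of the general formula.\<close>
  define u where "u s = (case s of 0 \<Rightarrow> 0 | Suc r \<Rightarrow> ?P n / ?P r * y ^ s)" for s
  have tele: "(-1) ^ s * (?P (Suc n) / ?P s) * (2 * x ^ (s * (Suc n + 1)) / (1 + x ^ s)) -
      (-1) ^ s * (?P n / ?P s) * (2 * x ^ (s * (n + 1)) / (1 + x ^ s)) =
      2 / (1 + y) * ((-1) ^ Suc s * u (Suc s) - (-1) ^ s * u s)" for s
  proof -
    have ys: "x ^ (s * (n + 1)) = y ^ s" "x ^ (s * (Suc n + 1)) = y ^ s * x ^ s"
      unfolding y_def by (simp_all add: power_mult[symmetric] power_add[symmetric] algebra_simps)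
    have us: "u s = (1 - x ^ s) / (1 + x ^ s) * (?P n / ?P s) * y ^ s"
    proof (cases s)
      case (Suc r)
      have "1 - x ^ Suc r \<noteq> 0" using factors_nz(1)[OF x, of "Suc r"] by simp
      thus ?thesis unfolding u_def Suc PS[of r] using nz[of "Suc r"] Pn[of r] by (simp del: power_Suc)
    qed (simp add: u_def)
    have uS: "u (Suc s) = ?P n / ?P s * (y ^ s * y)" by (simp add: u_def)
    have "1 + y \<noteq> 0" unfolding y_def by (rule nz)
    define w where "w = ?P n / ?P s"
    define z where "z = x ^ s"
    have z: "1 + z \<noteq> 0" unfolding z_def by (rule nz)
    have "?P (Suc n) / ?P s = w * ((1 - y) / (1 + y))" unfolding PS w_def y_def by simp
    have "w * ((1 - y) / (1 + y)) * (2 * (y ^ s * z) / (1 + z)) - w * (2 * y ^ s / (1 + z)) =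
       2 / (1 + y) * (- (w * (y ^ s * y)) - (1 - z) / (1 + z) * w * y ^ s)"
      using z \<open>1 + y \<noteq> 0\<close> by (simp add: divide_simps) (simp add: algebra_simps)
    moreover have "m * (w * a) * b - m * w * c = e * (-1 * m * g - m * h)"
      if "w * a * b - w * c = e * (- g - h)" for m a b c e g h :: real
    proof -
      have "m * (w * a) * b - m * w * c = m * (w * a * b - w * c)" by (simp add: algebra_simps)
      thus ?thesis unfolding that by (simp add: algebra_simps)
    qed
    ultimately show ?thesis
      unfolding us uS ys \<open>?P (Suc n) / ?P s = w * ((1 - y) / (1 + y))\<close> w_def[symmetric] z_def[symmetric] power_Suc
      by blast
  qed
  have "(\<Sum>s\<le>n. (-1) ^ s * (?P (Suc n) / ?P s) * (2 * x ^ (s * (Suc n + 1)) / (1 + x ^ s))) -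
      (\<Sum>s\<le>n. (-1) ^ s * (?P n / ?P s) * (2 * x ^ (s * (n + 1)) / (1 + x ^ s))) =
      2 / (1 + y) * (\<Sum>s\<le>n. (-1) ^ Suc s * u (Suc s) - (-1) ^ s * u s)"
    unfolding sum_subtractf[symmetric] tele sum_distrib_left ..
  also have "(\<Sum>s\<le>n. (-1) ^ Suc s * u (Suc s) - (-1) ^ s * u s) = (-1) ^ Suc n * u (Suc n) - (-1) ^ 0 * u 0"
    unfolding lessThan_Suc_atMost[symmetric] by (rule sum_lessThan_telescope)
  also have "\<dots> = (-1) ^ Suc n * y ^ Suc n" using Pn[of n] by (simp add: u_def)
  finally have d: "(\<Sum>s\<le>n. (-1) ^ s * (?P (Suc n) / ?P s) * (2 * x ^ (s * (Suc n + 1)) / (1 + x ^ s))) =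
     1 + 2 * (\<Sum>k<n. (-1) ^ Suc k * x ^ (Suc k)\<^sup>2) + 2 / (1 + y) * ((-1) ^ Suc n * y ^ Suc n)"
    unfolding Suc.IH by linarith
  have yy: "x ^ (Suc n)\<^sup>2 = y ^ Suc n" unfolding y_def by (simp add: power_mult[symmetric] power2_eq_square del: power_Suc)
  have yz: "x ^ (Suc n * (Suc n + 1)) = y ^ Suc n * y"
    unfolding y_def by (simp add: power_mult[symmetric] power_add[symmetric] algebra_simps del: power_Suc)
  have y1: "1 + y \<noteq> 0" unfolding y_def by (rule nz)
  have "(\<Sum>s\<le>Suc n. (-1) ^ s * (?P (Suc n) / ?P s) * (2 * x ^ (s * (Suc n + 1)) / (1 + x ^ s))) =
     1 + 2 * (\<Sum>k<n. (-1) ^ Suc k * x ^ (Suc k)\<^sup>2) + 2 / (1 + y) * ((-1) ^ Suc n * y ^ Suc n)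
      + (-1) ^ Suc n * (2 * (y ^ Suc n * y) / (1 + y))"
    unfolding sum.atMost_Suc d yz using Pn[of "Suc n"] by (simp add: y_def)
  also have "2 / (1 + y) * ((-1) ^ Suc n * y ^ Suc n) = (-1) ^ Suc n * (2 * y ^ Suc n / (1 + y))" by simp
  also have "1 + 2 * (\<Sum>k<n. (-1) ^ Suc k * x ^ (Suc k)\<^sup>2) + (-1) ^ Suc n * (2 * y ^ Suc n / (1 + y))
      + (-1) ^ Suc n * (2 * (y ^ Suc n * y) / (1 + y)) =
      1 + 2 * (\<Sum>k<n. (-1) ^ Suc k * x ^ (Suc k)\<^sup>2) + (-1) ^ Suc n * ((2 * y ^ Suc n + 2 * (y ^ Suc n * y)) / (1 + y))"
    by (simp add: add_divide_distrib distrib_left)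
  also have "(2 * y ^ Suc n + 2 * (y ^ Suc n * y)) / (1 + y) = 2 * y ^ Suc n"
    using y1 by (simp add: field_simps)
  finally show ?case unfolding sum.lessThan_Suc yy by (simp add: algebra_simps)
qed

lemma shanks_psi:
  assumes x: "\<bar>x\<bar> < 1"
  shows "(\<Sum>s<n. (Ppsi x n / Ppsi x s) * x ^ (s * (2 * n + 1))) = (\<Sum>k<2 * n. x ^ (k * (k + 1) div 2))"
proof (induction n)
  case 0 show ?case by simp
next
  case (Suc n)
  let ?P = "Ppsi x"
  define y where "y = x ^ (2 * n + 1)"
  have Pn: "?P s \<noteq> 0" for s using Ppsi_pos[OF x, of s] by simp
  have nz: "1 - x ^ (2 * s + 1) \<noteq> 0" "1 - x ^ (2 * s + 2) \<noteq> 0" for s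
    using factors_nz(1)[OF x, of "2 * s + 1"] factors_nz(1)[OF x, of "2 * s + 2"] by simp_all
  have PS: "?P (Suc s) = ?P s * ((1 - x ^ (2 * s + 2)) / (1 - x ^ (2 * s + 1)))" for s by (simp add: Ppsi_def)
  have y1: "1 - y \<noteq> 0" unfolding y_def by (rule nz)
  \<comment> \<open>The telescoping quantity for psi; here too \<open>v 0 = 0\<close> because of the
    factor \<open>1 - x^0\<close>.\<close>
  define v where "v s = (1 - x ^ (2 * s)) * (?P n / ?P s) * y ^ s" for s
  have vS: "v (Suc s) = (1 - x ^ (2 * s + 1)) * (?P n / ?P s) * (y ^ s * y)" for s
  proof -
    have "v (Suc s) = (1 - x ^ (2 * s + 2)) * (?P n / ?P (Suc s)) * (y ^ s * y)" unfolding v_def by (simp add: mult.commute)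
    also have "(1 - x ^ (2 * s + 2)) * (?P n / ?P (Suc s)) = (1 - x ^ (2 * s + 1)) * (?P n / ?P s)"
    proof -
      have "u * (P / (p * (u / t))) = t * (P / p)" if "u \<noteq> 0" "p \<noteq> 0" for u P p t :: real
        using that by simp
      from this[OF nz(2)[of s] Pn[of s]] show ?thesis unfolding PS .
    qed
    finally show ?thesis .
  qed
  have tele: "(?P (Suc n) / ?P s) * x ^ (s * (2 * Suc n + 1)) - (?P n / ?P s) * x ^ (s * (2 * n + 1)) =
     1 / (1 - y) * (v (Suc s) - v s)" for s
  proof -
    have ys: "x ^ (s * (2 * n + 1)) = y ^ s" "x ^ (s * (2 * Suc n + 1)) = y ^ s * x ^ (2 * s)"
      unfolding y_def by (simp_all add: power_mult[symmetric] power_add[symmetric] algebra_simps del: power_Suc)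
    define w where "w = ?P n / ?P s"
    define z where "z = x ^ (2 * s)"
    have e: "x ^ (2 * s + 1) = x * z" "x ^ (2 * n + 2) = x * y" unfolding z_def y_def by simp_all
    have "?P (Suc n) / ?P s = w * ((1 - x * y) / (1 - y))" unfolding PS w_def e y_def[symmetric] by simp
    have "w * ((1 - x * y) / (1 - y)) * (y ^ s * z) - w * y ^ s =
       1 / (1 - y) * ((1 - x * z) * w * (y ^ s * y) - (1 - z) * w * y ^ s)"
      using y1 by (simp add: divide_simps) (simp add: algebra_simps)
    thus ?thesis unfolding vS ys e \<open>?P (Suc n) / ?P s = w * ((1 - x * y) / (1 - y))\<close> w_def[symmetric]
      unfolding v_def w_def[symmetric] z_def[symmetric] .
  qed
  have "(\<Sum>s<n. (?P (Suc n) / ?P s) * x ^ (s * (2 * Suc n + 1))) - (\<Sum>s<n. (?P n / ?P s) * x ^ (s * (2 * n + 1))) =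
     1 / (1 - y) * (\<Sum>s<n. v (Suc s) - v s)"
    unfolding sum_subtractf[symmetric] tele sum_distrib_left ..
  also have "(\<Sum>s<n. v (Suc s) - v s) = v n - v 0" by (rule sum_lessThan_telescope)
  also have "\<dots> = (1 - x ^ (2 * n)) * y ^ n" using Pn[of n] by (simp add: v_def)
  finally have d: "(\<Sum>s<n. (?P (Suc n) / ?P s) * x ^ (s * (2 * Suc n + 1))) =
     (\<Sum>k<2 * n. x ^ (k * (k + 1) div 2)) + 1 / (1 - y) * ((1 - x ^ (2 * n)) * y ^ n)"
    unfolding Suc.IH by linarith
  have "?P (Suc n) / ?P n = (1 - x ^ (2 * n + 2)) / (1 - y)" unfolding PS y_def using Pn[of n] by simp
  moreover have "x ^ (n * (2 * Suc n + 1)) = y ^ n * x ^ (2 * n)"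
    unfolding y_def by (simp add: power_mult[symmetric] power_add[symmetric] algebra_simps del: power_Suc)
  ultimately have "(\<Sum>s<Suc n. (?P (Suc n) / ?P s) * x ^ (s * (2 * Suc n + 1))) =
     (\<Sum>k<2 * n. x ^ (k * (k + 1) div 2)) +
       (1 / (1 - y) * ((1 - x ^ (2 * n)) * y ^ n) + (1 - x ^ (2 * n + 2)) / (1 - y) * (y ^ n * x ^ (2 * n)))"
    unfolding sum.lessThan_Suc d by simp
  also have "1 / (1 - y) * ((1 - x ^ (2 * n)) * y ^ n) + (1 - x ^ (2 * n + 2)) / (1 - y) * (y ^ n * x ^ (2 * n))
     = y ^ n + y ^ n * y"
  proof -
    define z where "z = x ^ (2 * n)"
    have e: "x ^ (2 * n + 2) * z = y * y" unfolding z_def y_def by (simp add: power_add[symmetric] algebra_simps flip: power_Suc)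
    have "(1 - z) * y ^ n + (1 - x ^ (2 * n + 2)) * (y ^ n * z) = y ^ n * (1 - x ^ (2 * n + 2) * z)"
      by (simp add: algebra_simps)
    also have "\<dots> = (y ^ n + y ^ n * y) * (1 - y)" unfolding e by (simp add: algebra_simps)
    finally show ?thesis using y1 unfolding z_def[symmetric] by (simp add: divide_simps)
  qed
  also have "(\<Sum>k<2 * n. x ^ (k * (k + 1) div 2)) + (y ^ n + y ^ n * y) = (\<Sum>k<2 * Suc n. x ^ (k * (k + 1) div 2))"
  proof -
    have "2 * n * (2 * n + 1) div 2 = (2 * n + 1) * n" by simp
    moreover have "(2 * n + 1) * (2 * n + 1 + 1) div 2 = (2 * n + 1) * n + (2 * n + 1)"
    proof -
      have "(2 * n + 1) * (2 * n + 1 + 1) = 2 * ((2 * n + 1) * n + (2 * n + 1))" by (simp add: algebra_simps)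
      thus ?thesis by simp
    qed
    ultimately have "x ^ (2 * n * (2 * n + 1) div 2) = y ^ n" "x ^ ((2 * n + 1) * (2 * n + 1 + 1) div 2) = y ^ n * y"
      unfolding y_def by (simp_all only: power_mult power_add)
    moreover have "2 * Suc n = Suc (Suc (2 * n))" by simp
    ultimately show ?thesis by (simp add: add.commute add.left_commute del: power_Suc)
  qed
  finally show ?case .
qed


lemma Pphi_ratio:
  assumes "0 < x" "x < 1" "s \<le> n"
  shows "Pphi x n / Pphi x s \<le> 1"
proof -
  have "Pphi x n \<le> Pphi x s" using assms(3)
  proof (induction n rule: dec_induct)
    case (step n)
    have "Pphi x (Suc n) = Pphi x n * ((1 - x ^ Suc n) / (1 + x ^ Suc n))" by (simp add: Pphi_def)
    also have "\<dots> \<le> Pphi x n * 1"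
    proof (rule mult_left_mono)
      have "x ^ Suc n > 0" using assms by simp
      thus "(1 - x ^ Suc n) / (1 + x ^ Suc n) \<le> 1" by (simp del: power_Suc)
    qed (use Pphi_pos[of x n] assms in simp)
    finally show ?case using step by simp
  qed simp
  thus ?thesis using Pphi_pos[of x s] assms by simp
qed

text \<open>For negative \<open>x\<close> even powers are nonnegative and odd powers nonpositive, so
  every factor of the product is at most 1. With \<open>s >= 1\<close> this bounds the unwanted
  terms of the finite identity.\<close>

lemma Ppsi_ratio:
  assumes "-1 < x" "x < 0" "s \<le> n"
  shows "Ppsi x n / Ppsi x s \<le> 1"
proof -
  have x1: "\<bar>x\<bar> < 1" using assms by simp
  have "Ppsi x n \<le> Ppsi x s" using assms(3)
  proof (induction n rule: dec_induct)
    case (step n)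
    have "Ppsi x (Suc n) = Ppsi x n * ((1 - x ^ (2 * n + 2)) / (1 - x ^ (2 * n + 1)))" by (simp add: Ppsi_def)
    also have "\<dots> \<le> Ppsi x n * 1"
    proof (rule mult_left_mono)
      have "x ^ (2 * n + 2) = (x ^ (n + 1))\<^sup>2" by (simp add: power_mult[symmetric] del: power_Suc) (simp add: mult.commute)
      hence "x ^ (2 * n + 2) \<ge> 0" by simp
      moreover have "x ^ (2 * n + 1) = x * (x ^ n)\<^sup>2" by (simp add: power_mult[symmetric] mult.commute)
      hence "x ^ (2 * n + 1) \<le> 0" using assms by (simp add: mult_nonpos_nonneg)
      ultimately show "(1 - x ^ (2 * n + 2)) / (1 - x ^ (2 * n + 1)) \<le> 1"
        using factors_nz(1)[OF x1, of "2 * n + 1"] by (simp only: divide_le_eq_1_pos)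
    qed (use Ppsi_pos[OF x1, of n] in simp)
    finally show ?case using step by simp
  qed simp
  thus ?thesis using Ppsi_pos[OF x1, of s] by simp
qed

lemma Pphi_tendsto_ramanujan:
  assumes x: "0 < x" "x < (1::real)"
  shows "Pphi x \<longlonglongrightarrow> 1 + 2 * (\<Sum>k. (-1) ^ Suc k * x ^ (Suc k)\<^sup>2)"
    and "summable (\<lambda>k. norm ((-1) ^ Suc k * x ^ (Suc k)\<^sup>2))"
proof -
  have x1: "\<bar>x\<bar> < 1" using x by simp
  show sm: "summable (\<lambda>k. norm ((-1) ^ Suc k * x ^ (Suc k)\<^sup>2))"
  proof (rule summable_comparison_test')
    show "summable (\<lambda>k. x ^ k)" using x by simp
    fix k :: nat
    have "k \<le> (Suc k)\<^sup>2" by (simp add: power2_eq_square)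
    hence "x ^ (Suc k)\<^sup>2 \<le> x ^ k" using x by (intro power_decreasing) auto
    thus "norm (norm ((-1) ^ Suc k * x ^ (Suc k)\<^sup>2)) \<le> x ^ k" using x by (simp add: abs_mult power_abs del: power_Suc)
  qed
  define S where "S n = 1 + 2 * (\<Sum>k<n. (-1) ^ Suc k * x ^ (Suc k)\<^sup>2)" for n
  have "S \<longlonglongrightarrow> 1 + 2 * (\<Sum>k. (-1) ^ Suc k * x ^ (Suc k)\<^sup>2)"
    unfolding S_def by (intro tendsto_intros summable_LIMSEQ summable_norm_cancel[OF sm])
  moreover have "(\<lambda>n. S n - Pphi x n) \<longlonglongrightarrow> 0"
  proof (rule Lim_null_comparison)
    show "(\<lambda>n. real n * (2 * x ^ (n + 1))) \<longlonglongrightarrow> 0" using x by real_asymp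
    show "\<forall>\<^sub>F n in sequentially. norm (S n - Pphi x n) \<le> real n * (2 * x ^ (n + 1))"
    proof (intro always_eventually allI)
      fix n
      let ?t = "\<lambda>s. (-1) ^ s * (Pphi x n / Pphi x s) * (2 * x ^ (s * (n + 1)) / (1 + x ^ s))"
      have "S n = (\<Sum>s\<le>n. ?t s)" unfolding S_def shanks_phi[OF x1] ..
      also have "\<dots> = ?t 0 + (\<Sum>s<n. ?t (Suc s))" by (rule sum.atMost_shift)
      also have "?t 0 = Pphi x n" by (simp add: Pphi_def)
      finally have "\<bar>S n - Pphi x n\<bar> = \<bar>\<Sum>s<n. ?t (Suc s)\<bar>" by simp
      also have "\<dots> \<le> (\<Sum>s<n. \<bar>?t (Suc s)\<bar>)" by (rule sum_abs)
      also have "\<dots> \<le> (\<Sum>s<n. 2 * x ^ (n + 1))"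
      proof (rule sum_mono)
        fix s assume s: "s \<in> {..<n}"
        have P: "0 \<le> Pphi x n / Pphi x (Suc s)" "Pphi x n / Pphi x (Suc s) \<le> 1"
          using Pphi_pos[OF x1] Pphi_ratio[OF x, of "Suc s" n] s by (auto intro: divide_nonneg_pos less_imp_le)
        have "n + 1 \<le> Suc s * (n + 1)" by simp
        hence "x ^ (Suc s * (n + 1)) \<le> x ^ (n + 1)" using x by (intro power_decreasing) auto
        moreover have "0 < x ^ Suc s" "0 < x ^ (Suc s * (n + 1))" using x by simp_all
        ultimately have q: "2 * x ^ (Suc s * (n + 1)) / (1 + x ^ Suc s) \<le> 2 * x ^ (n + 1)"
          "0 \<le> 2 * x ^ (Suc s * (n + 1)) / (1 + x ^ Suc s)"
          using frac_le[of "2 * x ^ (n + 1)" "2 * x ^ (Suc s * (n + 1))" 1 "1 + x ^ Suc s"] by (simp_all del: power_Suc mult_Suc)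
        have "\<bar>?t (Suc s)\<bar> = (Pphi x n / Pphi x (Suc s)) * (2 * x ^ (Suc s * (n + 1)) / (1 + x ^ Suc s))"
          unfolding abs_mult[of "_ * _"] abs_mult[of "(-1) ^ Suc s"] abs_of_nonneg[OF P(1)] abs_of_nonneg[OF q(2)]
          by (simp add: power_abs)
        also have "\<dots> \<le> 1 * (2 * x ^ (n + 1))" using P q by (intro mult_mono) auto
        finally show "\<bar>?t (Suc s)\<bar> \<le> 2 * x ^ (n + 1)" by simp
      qed
      finally show "norm (S n - Pphi x n) \<le> real n * (2 * x ^ (n + 1))" by simp
    qed
  qed
  ultimately have "(\<lambda>n. S n - (S n - Pphi x n)) \<longlonglongrightarrow> (1 + 2 * (\<Sum>k. (-1) ^ Suc k * x ^ (Suc k)\<^sup>2)) - 0"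
    by (rule tendsto_diff)
  thus "Pphi x \<longlonglongrightarrow> 1 + 2 * (\<Sum>k. (-1) ^ Suc k * x ^ (Suc k)\<^sup>2)" by simp
qed

lemma has_sum_int_even:
  fixes f :: "int \<Rightarrow> real"
  assumes s: "((\<lambda>n::nat. f (int (Suc n))) has_sum A) UNIV" and even: "\<And>n. f (- n) = f n"
  shows "(f has_sum (2 * A)) (UNIV - {0})"
proof -
  have "((\<lambda>n::nat. f (- int (Suc n))) has_sum A) UNIV" using s unfolding even .
  hence "((f \<circ> (\<lambda>k. int (Suc k))) has_sum A) UNIV" "((f \<circ> (\<lambda>k. - int (Suc k))) has_sum A) UNIV"
    using s unfolding o_def by simp_all
  hence "(f has_sum A) (range (\<lambda>k. int (Suc k)))" "(f has_sum A) (range (\<lambda>k. - int (Suc k)))"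
    by (subst has_sum_reindex; simp add: inj_def)+
  moreover have "range (\<lambda>k. int (Suc k)) \<inter> range (\<lambda>k. - int (Suc k)) = {}" by auto
  ultimately have "(f has_sum (A + A)) (range (\<lambda>k. int (Suc k)) \<union> range (\<lambda>k. - int (Suc k)))"
    by (rule has_sum_Un_disjoint)
  also have "range (\<lambda>k. int (Suc k)) \<union> range (\<lambda>k. - int (Suc k)) = UNIV - {0}"
  proof (intro equalityI subsetI)
    fix n :: int
    assume "n \<in> UNIV - {0}"
    thus "n \<in> range (\<lambda>k. int (Suc k)) \<union> range (\<lambda>k. - int (Suc k))"
    proof (cases n rule: int_cases3)
      case (pos m)
      hence "n = int (Suc (m - 1))" by simp
      thus ?thesis by blast
    next
      case (neg m)
      hence "n = - int (Suc (m - 1))" by simp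
      thus ?thesis by blast
    qed simp
  qed auto
  finally show ?thesis unfolding mult_2 .
qed

lemma ramanujan_phi_eq:
  assumes x: "0 < x" "x < (1::real)"
  shows "ramanujan_phi (-x) = 1 + 2 * (\<Sum>k. (-1) ^ Suc k * x ^ (Suc k)\<^sup>2)"
proof -
  let ?f = "\<lambda>k::int. (-x) powi (k\<^sup>2)" and ?g = "\<lambda>k::nat. (-1) ^ Suc k * x ^ (Suc k)\<^sup>2"
  define A where "A = (\<Sum>k. ?g k)"
  note sm = Pphi_tendsto_ramanujan(2)[OF x]
  have "(?g has_sum A) UNIV" unfolding A_def
    by (rule norm_summable_imp_has_sum[OF sm]) (intro summable_sums summable_norm_cancel[OF sm])
  moreover have eq: "?f (int (Suc k)) = ?g k" for k
  proof -
    have "(int (Suc k))\<^sup>2 = int ((Suc k)\<^sup>2)" by simp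
    hence 1: "?f (int (Suc k)) = (-x) ^ (Suc k)\<^sup>2" by (simp only: power_int_of_nat)
    have "(-x) ^ (Suc k)\<^sup>2 = (-1) ^ (Suc k)\<^sup>2 * x ^ (Suc k)\<^sup>2" by (rule power_minus)
    \<comment> \<open>A number and its square have the same parity.\<close>
    also have "(-1) ^ (Suc k)\<^sup>2 = ((-1) ^ Suc k :: real)" by (simp add: minus_one_power_iff)
    finally show "?f (int (Suc k)) = ?g k" using 1 by simp
  qed
  ultimately have "((\<lambda>k. ?f (int (Suc k))) has_sum A) UNIV" unfolding eq by simp
  hence "(?f has_sum (2 * A)) (UNIV - {0})" by (rule has_sum_int_even) simp
  hence "(?f has_sum (?f 0 + 2 * A)) (insert 0 (UNIV - {0}))" by (intro has_sum_insert) auto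
  also have "insert 0 (UNIV - {0}) = (UNIV :: int set)" by auto
  finally have "(?f has_sum (1 + 2 * A)) UNIV" by simp
  thus ?thesis unfolding ramanujan_phi_def A_def[symmetric] by (rule infsumI)
qed

lemma Ppsi_tendsto_ramanujan:
  assumes x: "-1 < x" "x < (0::real)"
  shows "Ppsi x \<longlonglongrightarrow> ramanujan_psi x"
proof -
  have x1: "\<bar>x\<bar> < 1" using x by simp
  have sm: "summable (\<lambda>k. norm (x ^ (k * (k + 1) div 2)))"
  proof (rule summable_comparison_test')
    show "summable (\<lambda>k. \<bar>x\<bar> ^ k)" using x1 by simp
    fix k :: nat assume "k \<ge> 0"
    have "k \<le> k * (k + 1) div 2"
    proof (cases k)
      case (Suc j)
      have "2 * Suc j \<le> Suc j * (Suc j + 1)" by simp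
      thus ?thesis unfolding Suc by (simp add: less_eq_div_iff_mult_less_eq mult.commute)
    qed simp
    hence "\<bar>x\<bar> ^ (k * (k + 1) div 2) \<le> \<bar>x\<bar> ^ k" using x1 by (intro power_decreasing) auto
    thus "norm (norm (x ^ (k * (k + 1) div 2))) \<le> \<bar>x\<bar> ^ k" by (simp add: power_abs)
  qed
  define S where "S n = (\<Sum>k<2 * n. x ^ (k * (k + 1) div 2))" for n
  have "(\<lambda>n. \<Sum>k<n. x ^ (k * (k + 1) div 2)) \<longlonglongrightarrow> ramanujan_psi x"
    unfolding ramanujan_psi_def by (intro summable_LIMSEQ summable_norm_cancel[OF sm])
  hence "S \<longlonglongrightarrow> ramanujan_psi x" unfolding S_def
    by (rule filterlim_compose[of _ _ _ "\<lambda>n. 2 * n"]) (rule filterlim_subseq, simp add: strict_mono_def)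
  moreover have "(\<lambda>n. S n - Ppsi x n) \<longlonglongrightarrow> 0"
  proof (rule Lim_null_comparison)
    define y where "y = \<bar>x\<bar>"
    have y: "0 < y" "y < 1" using x unfolding y_def by auto
    have "(\<lambda>n. real n * y ^ (2 * n + 1)) \<longlonglongrightarrow> 0" using y by real_asymp
    thus "(\<lambda>n. real n * \<bar>x\<bar> ^ (2 * n + 1)) \<longlonglongrightarrow> 0" unfolding y_def .
    show "\<forall>\<^sub>F n in sequentially. norm (S n - Ppsi x n) \<le> real n * \<bar>x\<bar> ^ (2 * n + 1)"
    proof (rule eventually_mono[OF eventually_gt_at_top[of 0]])
      fix n :: nat assume "n > 0"
      then obtain m where m: "n = Suc m" by (cases n) auto
      let ?t = "\<lambda>s. (Ppsi x n / Ppsi x s) * x ^ (s * (2 * n + 1))"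
      have "S n = (\<Sum>s<n. ?t s)" unfolding S_def shanks_psi[OF x1] ..
      also have "\<dots> = ?t 0 + (\<Sum>s<m. ?t (Suc s))" unfolding m by (rule sum.lessThan_Suc_shift)
      also have "?t 0 = Ppsi x n" by (simp add: Ppsi_def)
      finally have "\<bar>S n - Ppsi x n\<bar> = \<bar>\<Sum>s<m. ?t (Suc s)\<bar>" by simp
      also have "\<dots> \<le> (\<Sum>s<m. \<bar>?t (Suc s)\<bar>)" by (rule sum_abs)
      also have "\<dots> \<le> (\<Sum>s<m. \<bar>x\<bar> ^ (2 * n + 1))"
      proof (rule sum_mono)
        fix s assume s: "s \<in> {..<m}"
        have P: "0 \<le> Ppsi x n / Ppsi x (Suc s)" "Ppsi x n / Ppsi x (Suc s) \<le> 1"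
          using Ppsi_pos[OF x1] Ppsi_ratio[OF x, of "Suc s" n] s m by (auto intro: divide_nonneg_pos less_imp_le)
        have "2 * n + 1 \<le> Suc s * (2 * n + 1)" by simp
        hence q: "\<bar>x\<bar> ^ (Suc s * (2 * n + 1)) \<le> \<bar>x\<bar> ^ (2 * n + 1)" using x1 by (intro power_decreasing) auto
        have "\<bar>?t (Suc s)\<bar> = (Ppsi x n / Ppsi x (Suc s)) * \<bar>x\<bar> ^ (Suc s * (2 * n + 1))"
          unfolding abs_mult[of "Ppsi x n / Ppsi x (Suc s)"] abs_of_nonneg[OF P(1)] power_abs ..
        also have "\<dots> \<le> 1 * \<bar>x\<bar> ^ (2 * n + 1)" using P q by (intro mult_mono) auto
        finally show "\<bar>?t (Suc s)\<bar> \<le> \<bar>x\<bar> ^ (2 * n + 1)" by simp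
      qed
      also have "\<dots> \<le> real n * \<bar>x\<bar> ^ (2 * n + 1)" unfolding m by (simp add: mult_right_mono del: power_Suc)
      finally show "norm (S n - Ppsi x n) \<le> real n * \<bar>x\<bar> ^ (2 * n + 1)" by simp
    qed
  qed
  ultimately have "(\<lambda>n. S n - (S n - Ppsi x n)) \<longlonglongrightarrow> ramanujan_psi x - 0" by (rule tendsto_diff)
  thus ?thesis by simp
qed

text \<open>The denominators \<open>1 + q^(2k+1)\<close> from psi and \<open>1 + q^(2k)\<close> from
  phi together run through all \<open>1 + q^k\<close> up to index \<open>2 n\<close>, and this
  product is \<open>f(q^2) / f(q)\<close>. Hence one partial product has length \<open>n\<close> and
  the other \<open>2 n\<close>, which is harmless in the limit.\<close>

theorem psi_phi_eq:
  assumes q: "0 < q" "q < (1::real)"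
  shows "ramanujan_psi (-q) * ramanujan_phi (-(q\<^sup>2)) = exp (ln_euler q + ln_euler (q\<^sup>2))"
proof -
  have q2: "0 < q\<^sup>2" "q\<^sup>2 < 1" using q by (simp_all add: power_less_one_iff)
  define f where "f x n = (\<Prod>k<n. 1 - x ^ Suc k)" for x :: real and n
  have fpos: "f x n > 0" if "0 < x" "x < 1" for x n
    unfolding f_def using that power_Suc_less_one[of x] by (intro prod_pos) auto
  have "(\<lambda>n. Ppsi (-q) n * Pphi (q\<^sup>2) n) \<longlonglongrightarrow> ramanujan_psi (-q) * ramanujan_phi (-(q\<^sup>2))"
    unfolding ramanujan_phi_eq[OF q2] using q
    by (intro tendsto_mult Ppsi_tendsto_ramanujan Pphi_tendsto_ramanujan(1) q2) auto
  moreover have "Ppsi (-q) n * Pphi (q\<^sup>2) n = (f (q\<^sup>2) n)\<^sup>2 * (f q (2 * n) / f (q\<^sup>2) (2 * n))" for n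
  proof -
    define g where "g n = (\<Prod>k<n. 1 + q ^ Suc k)" for n
    have gpos: "g n > 0" for n unfolding g_def using q by (intro prod_pos) (simp add: add_pos_pos)
    have "f (q\<^sup>2) n = f q n * g n" for n
    proof -
      have "1 - (q\<^sup>2) ^ k = (1 - q ^ k) * (1 + q ^ k)" for k
        by (simp add: power2_eq_square power_mult_distrib algebra_simps)
      thus ?thesis unfolding f_def g_def by (simp only: prod.distrib)
    qed
    hence r: "f q (2 * n) / f (q\<^sup>2) (2 * n) = 1 / g (2 * n)" using fpos[OF q, of "2 * n"] by simp
    have "Ppsi (-q) n * Pphi (q\<^sup>2) n = (f (q\<^sup>2) n)\<^sup>2 / g (2 * n)"
    proof (induction n)
      case 0 show ?case by (simp add: Ppsi_def Pphi_def f_def g_def)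
    next
      case (Suc n)
      have e: "(-q) ^ (2 * n + 2) = (q\<^sup>2) ^ Suc n" "(-q) ^ (2 * n + 1) = - (q ^ (2 * n + 1))" 
        by (simp_all add: power_mult[symmetric] power_add[symmetric] power_minus_even power_minus_odd flip: power_mult)
      have g2: "g (2 * Suc n) = g (2 * n) * (1 + q ^ (2 * n + 1)) * (1 + (q\<^sup>2) ^ Suc n)"
        by (simp add: g_def power_mult[symmetric] power2_eq_square mult.assoc)
          (simp add: power_mult power2_eq_square)
      have fS: "f (q\<^sup>2) (Suc n) = f (q\<^sup>2) n * (1 - (q\<^sup>2) ^ Suc n)" by (simp add: f_def)
      have "Ppsi (-q) (Suc n) * Pphi (q\<^sup>2) (Suc n) = (Ppsi (-q) n * Pphi (q\<^sup>2) n) *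
         ((1 - (q\<^sup>2) ^ Suc n) / (1 + q ^ (2 * n + 1)) * ((1 - (q\<^sup>2) ^ Suc n) / (1 + (q\<^sup>2) ^ Suc n)))"
        unfolding Ppsi_def Pphi_def prod.lessThan_Suc e by simp
      thus ?case unfolding Suc.IH g2 fS by (simp add: power_mult_distrib power2_eq_square[of "1 - _"] del: power_Suc)
    qed
    thus ?thesis unfolding r by simp
  qed
  ultimately have "(\<lambda>n. (f (q\<^sup>2) n)\<^sup>2 * (f q (2 * n) / f (q\<^sup>2) (2 * n))) \<longlonglongrightarrow> ramanujan_psi (-q) * ramanujan_phi (-(q\<^sup>2))"
    by simp
  moreover have "(\<lambda>n. (f (q\<^sup>2) n)\<^sup>2 * (f q (2 * n) / f (q\<^sup>2) (2 * n))) \<longlonglongrightarrow>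
      (exp (ln_euler (q\<^sup>2)))\<^sup>2 * (exp (ln_euler q) / exp (ln_euler (q\<^sup>2)))"
  proof -
    have sub: "filterlim (\<lambda>n::nat. 2 * n) at_top at_top" by (rule filterlim_subseq) (simp add: strict_mono_def)
    have "(\<lambda>n. f x n) \<longlonglongrightarrow> exp (ln_euler x)" if "0 < x" "x < 1" for x
      unfolding f_def by (rule prod_tendsto_exp_ln_euler[OF that])
    thus ?thesis using q q2 by (intro tendsto_mult tendsto_power tendsto_divide filterlim_compose[OF _ sub]) auto
  qed
  ultimately have "ramanujan_psi (-q) * ramanujan_phi (-(q\<^sup>2)) = (exp (ln_euler (q\<^sup>2)))\<^sup>2 * (exp (ln_euler q) / exp (ln_euler (q\<^sup>2)))"
    by (rule LIMSEQ_unique)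
  thus ?thesis by (simp add: power2_eq_square exp_add)
qed

text \<open>Because \<open>sqrt (m n) = n * sqrt (m / n)\<close>, all four arguments are powers of
  the single number \<open>q\<close>, and \<open>psi_phi_eq\<close> applies to \<open>q\<close> and
  to \<open>q ^ n\<close>.\<close>

theorem b_eq:
  fixes r :: rat and n :: nat
  assumes r: "r > 0" and n: "n > 0"
  defines "q \<equiv> exp (- pi * sqrt (real_of_rat r / n))"
  shows "b r n = n * exp (- (pi / 4) * (real n - 1) * sqrt (real_of_rat r / n)) *
    exp (2 * (ln_euler (q ^ n) + ln_euler (q ^ (2 * n)) - ln_euler q - ln_euler (q\<^sup>2)))"
proof -
  define m where "m = real_of_rat r"
  have m: "m > 0" unfolding m_def using r by simp
  have q: "0 < q" "q < 1" unfolding q_def using m n by (simp_all add: m_def)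
  have "m * real n = (real n)\<^sup>2 * (m / real n)" using n by (simp add: power2_eq_square)
  hence "sqrt (m * real n) = sqrt ((real n)\<^sup>2) * sqrt (m / real n)" by (simp only: real_sqrt_mult)
  hence s: "sqrt (m * real n) = real n * sqrt (m / real n)" by simp
  have e1: "exp (- pi * sqrt (m * real n)) = q ^ n"
    unfolding s q_def m_def[symmetric] exp_of_nat_mult[symmetric] by (simp add: algebra_simps)
  have e2: "exp (- 2 * pi * sqrt (m * real n)) = (q ^ n)\<^sup>2"
    unfolding e1[symmetric] exp_double[symmetric] by (simp add: algebra_simps)
  have e3: "exp (- 2 * pi * sqrt (m / real n)) = q\<^sup>2"
    unfolding q_def m_def[symmetric] exp_double[symmetric] by (simp add: algebra_simps)
  have qn: "0 < q ^ n" "q ^ n < 1" using q n by (simp_all add: power_less_one_iff)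
  have "b r n = n * exp (- (pi / 4) * (real n - 1) * sqrt (m / n)) *
     ((ramanujan_psi (- (q ^ n)) * ramanujan_phi (- ((q ^ n)\<^sup>2)))\<^sup>2 / (ramanujan_psi (- q) * ramanujan_phi (- (q\<^sup>2)))\<^sup>2)"
    unfolding b_def m_def[symmetric] e1 e2 e3 q_def[folded m_def, symmetric] by (simp add: power_mult_distrib)
  also have "(ramanujan_psi (- (q ^ n)) * ramanujan_phi (- ((q ^ n)\<^sup>2)))\<^sup>2 / (ramanujan_psi (- q) * ramanujan_phi (- (q\<^sup>2)))\<^sup>2
     = exp (2 * (ln_euler (q ^ n) + ln_euler ((q ^ n)\<^sup>2) - ln_euler q - ln_euler (q\<^sup>2)))"
    unfolding psi_phi_eq[OF q] psi_phi_eq[OF qn] exp_double[symmetric] exp_diff[symmetric] by (simp add: algebra_simps)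
  finally show ?thesis unfolding m_def power_mult[symmetric] by (simp add: mult.commute)
qed


subsection \<open>Kronecker's limit formula\<close>

text \<open>Differentiating Euler's reflection formula for Gamma gives
  \<open>Digamma (1 - z) - Digamma z\<close> as \<open>pi\<close> times the cotangent; in the limit
  formula for Digamma the two logarithms cancel.\<close>

lemma cot_partial_fractions:
  fixes z :: complex
  assumes z: "z \<notin> \<int>"
  shows "(\<lambda>m. \<Sum>n<m. inverse (z + of_nat n) - inverse (1 - z + of_nat n)) \<longlonglongrightarrow>
    of_real pi * cos (of_real pi * z) / sin (of_real pi * z)"
proof -
  have z0: "z \<noteq> 0" and z1: "1 - z \<noteq> 0" using z by auto
  have nz: "z \<notin> \<int>\<^sub>\<le>\<^sub>0" using z nonpos_Ints_subset_Ints by blast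
  have nz1: "1 - z \<notin> \<int>\<^sub>\<le>\<^sub>0"
  proof
    assume "1 - z \<in> \<int>\<^sub>\<le>\<^sub>0"
    hence "1 - (1 - z) \<in> \<int>" using nonpos_Ints_subset_Ints Ints_diff Ints_1 by blast
    thus False using z by simp
  qed
  have s: "sin (of_real pi * z) \<noteq> 0"
    using z by (auto simp: sin_eq_0 mult.commute)
  have "((\<lambda>z. Gamma z * Gamma (1 - z)) has_field_derivative
     (Gamma z * Digamma z * Gamma (1 - z) - Gamma z * (Gamma (1 - z) * Digamma (1 - z)))) (at z)"
    using nz nz1 by (auto intro!: derivative_eq_intros)
  hence d1: "((\<lambda>z. of_real pi / sin (of_real pi * z)) has_field_derivative
     (Gamma z * Digamma z * Gamma (1 - z) - Gamma z * (Gamma (1 - z) * Digamma (1 - z)))) (at z)"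
    by (simp add: Gamma_reflection_complex)
  have d2: "((\<lambda>z. of_real pi / sin (of_real pi * z)) has_field_derivative
     (- (of_real pi * (cos (of_real pi * z) * of_real pi)) / (sin (of_real pi * z))\<^sup>2)) (at z)"
    using s by (auto intro!: derivative_eq_intros simp: power2_eq_square)
  have "Gamma z * Digamma z * Gamma (1 - z) - Gamma z * (Gamma (1 - z) * Digamma (1 - z)) =
      - (of_real pi * (cos (of_real pi * z) * of_real pi)) / (sin (of_real pi * z))\<^sup>2"
    using d1 d2 by (rule DERIV_unique)
  hence "(Gamma z * Gamma (1 - z)) * (Digamma z - Digamma (1 - z)) =
      - (of_real pi * (cos (of_real pi * z) * of_real pi)) / (sin (of_real pi * z))\<^sup>2"
    by (simp add: algebra_simps)
  hence "of_real pi / sin (of_real pi * z) * (Digamma z - Digamma (1 - z)) =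
      - (of_real pi * (cos (of_real pi * z) * of_real pi)) / (sin (of_real pi * z))\<^sup>2"
    unfolding Gamma_reflection_complex .
  hence D: "Digamma (1 - z) - Digamma z = of_real pi * cos (of_real pi * z) / sin (of_real pi * z)"
  proof -
    have "E - D = P * C / S"
      if "P / S * (D - E) = - (P * (C * P)) / S\<^sup>2" "S \<noteq> 0" "P \<noteq> 0" for P S D E C :: complex
    proof -
      have "P * ((D - E) * S) = P / S * (D - E) * S\<^sup>2" using that(2) by (simp add: power2_eq_square)
      also have "\<dots> = P * (- (C * P))" unfolding that(1) using that(2) by simp
      finally have "(D - E) * S = - (C * P)" by (rule mult_left_cancel[OF that(3), THEN iffD1])
      hence "(E - D) * S = P * C" by (simp add: algebra_simps)
      thus ?thesis using that(2) by (simp add: eq_divide_eq)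
    qed
    from this[OF \<open>of_real pi / _ * _ = _\<close> s] show ?thesis by simp
  qed
  have "(\<lambda>m. (of_real (ln (real m)) - (\<Sum>n<m. inverse (1 - z + of_nat n))) -
       (of_real (ln (real m)) - (\<Sum>n<m. inverse (z + of_nat n)))) \<longlonglongrightarrow> Digamma (1 - z) - Digamma z"
    by (intro tendsto_diff Digamma_LIMSEQ z0 z1)
  thus ?thesis unfolding D by (simp add: sum_subtractf)
qed

text \<open>The cotangent expansion on the imaginary axis, at \<open>z = i w\<close>.\<close>

lemma coth_sums:
  fixes w :: real
  assumes w: "w > 0"
  shows "(\<lambda>n. 2 * w / ((real (Suc n))\<^sup>2 + w\<^sup>2)) sums (pi * (cosh (pi * w) / sinh (pi * w)) - 1 / w)"
proof -
  define z where "z = \<i> * complex_of_real w"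
  have z: "z \<notin> \<int>"
  proof
    assume "z \<in> \<int>"
    hence "Im z = 0" by (auto elim: Ints_cases)
    thus False using w by (simp add: z_def)
  qed
  have z0: "z \<noteq> 0" using w by (simp add: z_def)
  define T where "T m = (\<Sum>n<m. inverse (z + of_nat n) - inverse (1 - z + of_nat n))" for m
  \<comment> \<open>The expansion pairs \<open>z + n\<close> with \<open>n + 1 - z\<close>. Pairing
    \<open>z + n\<close> with \<open>n - z\<close> instead leaves \<open>inverse z\<close> in front
    and one boundary term that tends to 0.\<close>
  have Tf: "T (Suc m) = inverse z - (\<Sum>n<m. \<i> * complex_of_real (2 * w / ((real (Suc n))\<^sup>2 + w\<^sup>2))) - inverse (of_nat (Suc m) - z)" for m
  proof (induction m)
    case 0 show ?case by (simp add: T_def)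
  next
    case (Suc m)
    have nz: "of_nat (Suc m) - z \<noteq> 0" "z + of_nat (Suc m) \<noteq> 0"
      using w by (auto simp: z_def complex_eq_iff)
    have zz: "(of_nat (Suc m) - z) * (z + of_nat (Suc m)) = complex_of_real ((real (Suc m))\<^sup>2 + w\<^sup>2)"
      by (simp add: z_def algebra_simps power2_eq_square complex_eq_iff)
    have "inverse (z + of_nat (Suc m)) - inverse (of_nat (Suc m) - z) =
       ((of_nat (Suc m) - z) - (z + of_nat (Suc m))) / ((of_nat (Suc m) - z) * (z + of_nat (Suc m)))"
      using nz by (simp add: divide_simps del: of_nat_Suc)
    also have "\<dots> = - (2 * z) / complex_of_real ((real (Suc m))\<^sup>2 + w\<^sup>2)" unfolding zz by (simp add: algebra_simps)
    also have "\<dots> = - (\<i> * complex_of_real (2 * w / ((real (Suc m))\<^sup>2 + w\<^sup>2)))"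
      by (simp add: z_def del: of_nat_Suc)
    finally have e: "inverse (z + of_nat (Suc m)) - inverse (of_nat (Suc m) - z) = - (\<i> * complex_of_real (2 * w / ((real (Suc m))\<^sup>2 + w\<^sup>2)))" .
    have "T (Suc (Suc m)) = T (Suc m) + (inverse (z + of_nat (Suc m)) - inverse (of_nat (Suc (Suc m)) - z))"
      unfolding T_def sum.lessThan_Suc[of _ "Suc m"] by (simp add: algebra_simps)
    also have "\<dots> = inverse z - (\<Sum>n<m. \<i> * complex_of_real (2 * w / ((real (Suc n))\<^sup>2 + w\<^sup>2)))
        + (inverse (z + of_nat (Suc m)) - inverse (of_nat (Suc m) - z)) - inverse (of_nat (Suc (Suc m)) - z)"
      unfolding Suc.IH by simp
    finally show ?case unfolding e by (simp add: algebra_simps)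
  qed
  have "T \<longlonglongrightarrow> of_real pi * cos (of_real pi * z) / sin (of_real pi * z)"
    unfolding T_def by (rule cot_partial_fractions[OF z])
  hence T1: "(\<lambda>m. T (Suc m)) \<longlonglongrightarrow> of_real pi * cos (of_real pi * z) / sin (of_real pi * z)" by (rule LIMSEQ_Suc)
  have inv0: "(\<lambda>m. inverse (of_nat (Suc m) - z)) \<longlonglongrightarrow> 0"
  proof (rule Lim_null_comparison)
    show "(\<lambda>m. inverse (real (Suc m))) \<longlonglongrightarrow> 0" by (rule LIMSEQ_inverse_real_of_nat)
    show "\<forall>\<^sub>F m in sequentially. norm (inverse (of_nat (Suc m) - z)) \<le> inverse (real (Suc m))"
    proof (intro always_eventually allI)
      fix m
      have "real (Suc m) = \<bar>Re (of_nat (Suc m) - z)\<bar>" by (simp add: z_def)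
      also have "\<dots> \<le> norm (of_nat (Suc m) - z)" by (rule abs_Re_le_cmod)
      finally show "norm (inverse (of_nat (Suc m) - z)) \<le> inverse (real (Suc m))"
        unfolding norm_inverse by (intro le_imp_inverse_le) auto
    qed
  qed
  have "(\<lambda>m. \<i> * (T (Suc m) - inverse z + inverse (of_nat (Suc m) - z))) \<longlonglongrightarrow>
      \<i> * (of_real pi * cos (of_real pi * z) / sin (of_real pi * z) - inverse z + 0)"
    by (intro tendsto_intros T1 inv0)
  also have "(\<lambda>m. \<i> * (T (Suc m) - inverse z + inverse (of_nat (Suc m) - z))) =
      (\<lambda>m. complex_of_real (\<Sum>n<m. 2 * w / ((real (Suc n))\<^sup>2 + w\<^sup>2)))"
  proof
    fix m
    have "(\<Sum>n<m. \<i> * complex_of_real (2 * w / ((real (Suc n))\<^sup>2 + w\<^sup>2))) =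
        \<i> * complex_of_real (\<Sum>n<m. 2 * w / ((real (Suc n))\<^sup>2 + w\<^sup>2))"
      by (simp only: of_real_sum sum_distrib_left)
    moreover have "\<i> * (u - \<i> * v - t - u + t) = v" for u v t :: complex by (simp add: algebra_simps)
    ultimately show "\<i> * (T (Suc m) - inverse z + inverse (of_nat (Suc m) - z)) =
        complex_of_real (\<Sum>n<m. 2 * w / ((real (Suc n))\<^sup>2 + w\<^sup>2))" unfolding Tf by simp
  qed
  also have "\<i> * (of_real pi * cos (of_real pi * z) / sin (of_real pi * z) - inverse z + 0) =
      complex_of_real (pi * (cosh (pi * w) / sinh (pi * w)) - 1 / w)"
  proof -
    have pz: "of_real pi * z = \<i> * complex_of_real (pi * w)" by (simp add: z_def)
    have "cosh (complex_of_real x) = complex_of_real (cosh x)" "sinh (complex_of_real x) = complex_of_real (sinh x)" for x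
      by (simp_all add: cosh_def sinh_def exp_of_real scaleR_conv_of_real flip: of_real_minus)
    hence "cos (\<i> * complex_of_real x) = complex_of_real (cosh x)"
      "sin (\<i> * complex_of_real x) = \<i> * complex_of_real (sinh x)" for x
      using cosh_conv_cos[of "complex_of_real x"] sinh_conv_sin[of "complex_of_real x"] by simp_all
    note this[of "pi * w"]
    moreover have "sinh (pi * w) \<noteq> 0" using w by simp
    ultimately show ?thesis unfolding pz using w by (simp add: z_def field_simps)
  qed
  finally have "(\<lambda>m. Re (complex_of_real (\<Sum>n<m. 2 * w / ((real (Suc n))\<^sup>2 + w\<^sup>2)))) \<longlonglongrightarrow>
     Re (complex_of_real (pi * (cosh (pi * w) / sinh (pi * w)) - 1 / w))" by (rule tendsto_Re)
  thus ?thesis unfolding sums_def by simp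
qed

section \<open>Integrals of \<open>(1 + u^2) powr (-s)\<close>\<close>

definition arctan_part_int :: "real \<Rightarrow> real \<Rightarrow> real" where
  "arctan_part_int s X = integral {0..X} (\<lambda>u. (1 + u\<^sup>2) powr (-s))"

lemma arctan_part_integrable:
  fixes a b :: real
  shows "(\<lambda>u::real. (1 + u\<^sup>2) powr (-s)) integrable_on {a..b}"
proof (rule integrable_continuous_real)
  have "1 + u\<^sup>2 \<noteq> 0" for u :: real using zero_le_power2[of u] by linarith
  thus "continuous_on {a..b} (\<lambda>u::real. (1 + u\<^sup>2) powr (-s))" by (intro continuous_intros) auto
qed

lemma arctan_part_int_diff:
  assumes "0 \<le> p" "p \<le> q" "s \<ge> 0"
  shows "(q - p) * (1 + q\<^sup>2) powr (-s) \<le> arctan_part_int s q - arctan_part_int s p"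
    "arctan_part_int s q - arctan_part_int s p \<le> (q - p) * (1 + p\<^sup>2) powr (-s)"
proof -
  let ?f = "\<lambda>u::real. (1 + u\<^sup>2) powr (-s)"
  have e: "arctan_part_int s q - arctan_part_int s p = integral {p..q} ?f"
    unfolding arctan_part_int_def using Henstock_Kurzweil_Integration.integral_combine[OF assms(1,2) arctan_part_integrable, of s] by simp
  have anti: "?f v \<le> ?f u" if "0 \<le> u" "u \<le> v" for u v
    using that assms(3) by (intro powr_mono2') (auto intro: power_mono add_pos_nonneg)
  have c: "integral {p..q} (\<lambda>_. k) = (q - p) * k" for k :: real using assms(2) by simp
  show "(q - p) * (1 + q\<^sup>2) powr (-s) \<le> arctan_part_int s q - arctan_part_int s p" unfolding e c[symmetric]
    by (rule integral_le) (use anti assms in \<open>auto intro!: arctan_part_integrable\<close>)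
  show "arctan_part_int s q - arctan_part_int s p \<le> (q - p) * (1 + p\<^sup>2) powr (-s)" unfolding e c[symmetric]
    by (rule integral_le) (use anti assms in \<open>auto intro!: arctan_part_integrable\<close>)
qed

lemma arctan_part_int_mono: "0 \<le> p \<Longrightarrow> p \<le> q \<Longrightarrow> s \<ge> 0 \<Longrightarrow> arctan_part_int s p \<le> arctan_part_int s q"
  using arctan_part_int_diff(1)[of p q s] by (smt (verit) mult_nonneg_nonneg powr_ge_zero)

lemma arctan_part_int_1: "X \<ge> 0 \<Longrightarrow> arctan_part_int 1 X = arctan X"
proof -
  assume X: "X \<ge> 0"
  have "((\<lambda>u. (1 + u\<^sup>2) powr (-1)) has_integral (arctan X - arctan 0)) {0..X}"
  proof (rule fundamental_theorem_of_calculus[OF X])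
    fix x assume "x \<in> {0..X}"
    have "1 + x\<^sup>2 > 0" using zero_le_power2[of x] by linarith
    hence "(1 + x\<^sup>2) powr (-1) = inverse (1 + x\<^sup>2)" by (simp add: powr_minus)
    thus "(arctan has_vector_derivative (1 + x\<^sup>2) powr - 1) (at x within {0..X})"
      unfolding has_real_derivative_iff_has_vector_derivative[symmetric]
      using DERIV_subset[OF DERIV_arctan[of x] subset_UNIV] by simp
  qed
  thus ?thesis unfolding arctan_part_int_def by (simp add: integral_unique)
qed

lemma arctan_part_int_le: "X \<ge> 0 \<Longrightarrow> s \<ge> 1 \<Longrightarrow> arctan_part_int s X \<le> arctan X"
proof -
  assume X: "X \<ge> 0" and s: "s \<ge> 1"
  have "1 \<le> 1 + u\<^sup>2" for u :: real by simp
  hence "arctan_part_int s X \<le> arctan_part_int 1 X" unfolding arctan_part_int_def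
    using s by (intro integral_le arctan_part_integrable powr_mono) auto
  thus ?thesis using arctan_part_int_1[OF X] by simp
qed

text \<open>On the interval the factor \<open>(1 + u^2) powr (1 - s)\<close> is smallest at
  \<open>u = X\<close>, and the rest of the integrand belongs to \<open>s = 1\<close>.\<close>

lemma arctan_part_int_ge: "X \<ge> 0 \<Longrightarrow> s \<ge> 1 \<Longrightarrow> (1 + X\<^sup>2) powr (1 - s) * arctan X \<le> arctan_part_int s X"
proof -
  assume X: "X \<ge> 0" and s: "s \<ge> 1"
  have "(1 + X\<^sup>2) powr (1 - s) * arctan_part_int 1 X = integral {0..X} (\<lambda>u. (1 + X\<^sup>2) powr (1 - s) * (1 + u\<^sup>2) powr (-1))"
    unfolding arctan_part_int_def by (rule integral_mult_right[symmetric])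
  also have "\<dots> \<le> arctan_part_int s X" unfolding arctan_part_int_def
  proof (rule integral_le)
    show "(\<lambda>u. (1 + X\<^sup>2) powr (1 - s) * (1 + u\<^sup>2) powr - 1) integrable_on {0..X}"
      by (intro integrable_on_cmult_left arctan_part_integrable[THEN integrable_on_mult_right] arctan_part_integrable)
    fix u assume u: "u \<in> {0..X}"
    have "(1 + X\<^sup>2) powr (1 - s) \<le> (1 + u\<^sup>2) powr (1 - s)"
      using u s by (intro powr_mono2') (auto intro: power_mono add_pos_nonneg)
    hence "(1 + X\<^sup>2) powr (1 - s) * (1 + u\<^sup>2) powr (-1) \<le> (1 + u\<^sup>2) powr (1 - s) * (1 + u\<^sup>2) powr (-1)"
      by (intro mult_right_mono) auto
    also have "\<dots> = (1 + u\<^sup>2) powr (-s)" by (simp only: powr_add[symmetric]) simp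
    finally show "(1 + X\<^sup>2) powr (1 - s) * (1 + u\<^sup>2) powr - 1 \<le> (1 + u\<^sup>2) powr - s" .
  qed (rule arctan_part_integrable)
  finally show ?thesis using arctan_part_int_1[OF X] by simp
qed

text \<open>The integral of \<open>(1 + u^2) powr (-s)\<close> over the positive half line.\<close>

definition arctan_int :: "real \<Rightarrow> real" where "arctan_int s = (SUP X\<in>{0..}. arctan_part_int s X)"

lemma arctan_part_int_le_pi_half: "X \<ge> 0 \<Longrightarrow> s \<ge> 1 \<Longrightarrow> arctan_part_int s X \<le> pi / 2"
  using arctan_part_int_le[of X s] arctan_ubound[of X] by linarith

lemma arctan_part_int_bdd: "s \<ge> 1 \<Longrightarrow> bdd_above (arctan_part_int s ` {0..})"
  by (intro bdd_aboveI2[of _ _ "pi / 2"]) (rule arctan_part_int_le_pi_half; simp)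

lemma arctan_part_int_le_arctan_int: "s \<ge> 1 \<Longrightarrow> X \<ge> 0 \<Longrightarrow> arctan_part_int s X \<le> arctan_int s"
  unfolding arctan_int_def by (rule cSUP_upper) (use arctan_part_int_bdd in auto)

lemma arctan_int_le: "s \<ge> 1 \<Longrightarrow> arctan_int s \<le> pi / 2"
  unfolding arctan_int_def by (rule cSUP_least) (simp, rule arctan_part_int_le_pi_half, simp_all)

lemma arctan_part_int_tendsto:
  assumes "s \<ge> 1"
  shows "(arctan_part_int s \<longlongrightarrow> arctan_int s) at_top"
proof (rule order_tendstoI)
  fix a assume "a < arctan_int s"
  then obtain X where X: "X \<ge> 0" "a < arctan_part_int s X"
    unfolding arctan_int_def using less_cSUP_iff[OF _ arctan_part_int_bdd[OF assms]] by auto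
  show "eventually (\<lambda>x. a < arctan_part_int s x) at_top"
    using eventually_ge_at_top[of X]
  proof eventually_elim
    case (elim x) thus ?case using arctan_part_int_mono[of X x s] X assms by simp
  qed
next
  fix a assume "arctan_int s < a"
  show "eventually (\<lambda>x. arctan_part_int s x < a) at_top"
    using eventually_ge_at_top[of 0]
  proof eventually_elim
    case (elim x) thus ?case using arctan_part_int_le_arctan_int[OF assms, of x] \<open>arctan_int s < a\<close> by simp
  qed
qed

text \<open>Bounded above by \<open>pi / 2\<close> throughout. From below, \<open>X\<close> is fixed
  with \<open>arctan X\<close> close to \<open>pi / 2\<close> before \<open>s\<close> tends to
  1.\<close>

lemma arctan_int_tendsto: "(arctan_int \<longlongrightarrow> pi / 2) (at_right 1)"
proof (rule order_tendstoI)
  fix a :: real assume a: "a < pi / 2"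
  have "eventually (\<lambda>X. a < arctan X) at_top"
    using tendsto_arctan_at_top a by (rule order_tendstoD(1))
  hence "eventually (\<lambda>X. a < arctan X \<and> X \<ge> 0) at_top" using eventually_ge_at_top by (rule eventually_conj)
  then obtain X where X: "a < arctan X" "X \<ge> 0" using eventually_happens'[OF trivial_limit_at_top_linorder] by blast
  have "((\<lambda>s. (1 + X\<^sup>2) powr (1 - s) * arctan X) \<longlongrightarrow> (1 + X\<^sup>2) powr (1 - 1) * arctan X) (at_right 1)"
    using X by (intro tendsto_intros) (auto simp: add_nonneg_eq_0_iff)
  hence "((\<lambda>s. (1 + X\<^sup>2) powr (1 - s) * arctan X) \<longlongrightarrow> arctan X) (at_right 1)"
    by (simp add: add_nonneg_eq_0_iff)
  hence "eventually (\<lambda>s. a < (1 + X\<^sup>2) powr (1 - s) * arctan X) (at_right 1)" using X(1) by (rule order_tendstoD(1))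
  moreover have "eventually (\<lambda>s. s > (1::real)) (at_right 1)" by (rule eventually_at_right_less)
  ultimately show "eventually (\<lambda>s. a < arctan_int s) (at_right 1)"
  proof eventually_elim
    case (elim s)
    show ?case using arctan_part_int_ge[of X s] arctan_part_int_le_arctan_int[of s X] X elim by simp
  qed
next
  fix a :: real assume a: "pi / 2 < a"
  have "eventually (\<lambda>s. s > (1::real)) (at_right 1)" by (rule eventually_at_right_less)
  thus "eventually (\<lambda>s. arctan_int s < a) (at_right 1)"
  proof eventually_elim
    case (elim s) thus ?case using arctan_int_le[of s] a by simp
  qed
qed


lemma powr_minus_half: "x > 0 \<Longrightarrow> x powr (-1/2) = inverse (sqrt x)"
proof -
  assume "x > 0"
  have "x powr (-1/2) = x powr (-(1/2))" by simp
  also have "\<dots> = inverse (x powr (1/2))" by (rule powr_minus)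
  also have "x powr (1/2) = sqrt x" using \<open>x > 0\<close> by (intro powr_half_sqrt) simp
  finally show ?thesis .
qed

text \<open>Integral test for a decreasing function: sum and integral differ by at most the first
  term.\<close>

lemma sum_arctan_int_bounds:
  fixes a t s :: real
  assumes a: "a > 0" and t: "t > 0" and s: "s \<ge> 1"
  defines "g \<equiv> \<lambda>n::nat. (a * (real n)\<^sup>2 + t) powr (-s)"
    and "K \<equiv> a powr (-1/2) * t powr (1/2 - s)"
  shows "summable g" "K * arctan_int s \<le> (\<Sum>n. g n)" "(\<Sum>n. g n) \<le> K * arctan_int s + t powr (-s)"
proof -
  \<comment> \<open>After the scaling \<open>u = k * n\<close> the summand becomes
    \<open>K * k * (1 + u^2) powr (-s)\<close>, so \<open>k\<close> is the mesh width and
    \<open>K * k\<close> the value at 0.\<close>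
  define k where "k = sqrt (a / t)"
  have k: "k > 0" unfolding k_def using a t by simp
  have K: "K > 0" unfolding K_def using a t by simp
  have Kk: "K * k = t powr (-s)"
  proof -
    have "a powr (1/2) = sqrt a" using a by (intro powr_half_sqrt) simp
    hence e: "a powr (1/2) * t powr (-1/2) = sqrt a * inverse (sqrt t)"
      by (simp only: powr_minus_half[OF t])
    have "k = sqrt a * inverse (sqrt t)" unfolding k_def real_sqrt_divide by (rule divide_inverse)
    hence "k = a powr (1/2) * t powr (-1/2)" by (simp only: e)
    hence "K * k = (a powr (-1/2) * a powr (1/2)) * (t powr (1/2 - s) * t powr (-1/2))"
      by (simp only: K_def mult_ac)
    also have "\<dots> = a powr (-1/2 + 1/2) * t powr (1/2 - s + -1/2)" by (simp only: powr_add)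
    also have "\<dots> = t powr (-s)" using a by simp
    finally show ?thesis .
  qed
  have gk: "g n = K * k * (1 + (k * real n)\<^sup>2) powr (-s)" for n
  proof -
    have "k\<^sup>2 = a / t" unfolding k_def using a t by simp
    hence "a * (real n)\<^sup>2 + t = t * (1 + (k * real n)\<^sup>2)" using t by (simp add: power_mult_distrib field_simps)
    thus ?thesis unfolding g_def Kk using t by (simp add: powr_mult add_nonneg_nonneg)
  qed
  have st: "K * (arctan_part_int s (k * real (Suc n)) - arctan_part_int s (k * real n)) \<le> g n"
    "g (Suc n) \<le> K * (arctan_part_int s (k * real (Suc n)) - arctan_part_int s (k * real n))" for n
  proof -
    have p: "0 \<le> k * real n" "k * real n \<le> k * real (Suc n)" using k by (auto intro: mult_left_mono)
    have d: "k * real (Suc n) - k * real n = k" by (simp add: algebra_simps)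
    show "K * (arctan_part_int s (k * real (Suc n)) - arctan_part_int s (k * real n)) \<le> g n"
      using mult_left_mono[OF arctan_part_int_diff(2)[OF p, of s], of K] K s unfolding d gk by (simp add: mult.assoc)
    show "g (Suc n) \<le> K * (arctan_part_int s (k * real (Suc n)) - arctan_part_int s (k * real n))"
      using mult_left_mono[OF arctan_part_int_diff(1)[OF p, of s], of K] K s unfolding d gk by (simp add: mult.assoc)
  qed
  have J0: "arctan_part_int s 0 = 0" unfolding arctan_part_int_def by simp
  have low: "K * arctan_part_int s (k * real N) \<le> (\<Sum>n<N. g n)" for N
  proof (induction N)
    case (Suc N) thus ?case using st(1)[of N] by (simp add: algebra_simps)
  qed (simp add: J0)
  have up: "(\<Sum>n<Suc N. g n) \<le> g 0 + K * arctan_part_int s (k * real N)" for N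
  proof (induction N)
    case (Suc N) thus ?case using st(2)[of N] by (simp add: algebra_simps)
  qed (simp add: J0)
  have gnn: "g n \<ge> 0" for n unfolding g_def by simp
  have JJ: "arctan_part_int s (k * real N) \<le> arctan_int s" for N using k s by (intro arctan_part_int_le_arctan_int) auto
  have up': "(\<Sum>n<N. g n) \<le> g 0 + K * arctan_int s" for N
  proof -
    have "(\<Sum>n<N. g n) \<le> (\<Sum>n<Suc N. g n)" using gnn by simp
    also have "\<dots> \<le> g 0 + K * arctan_part_int s (k * real N)" by (rule up)
    also have "\<dots> \<le> g 0 + K * arctan_int s" using JJ K by (simp add: mult_left_mono)
    finally show ?thesis .
  qed
  show sg: "summable g" using gnn up' by (rule summableI_nonneg_bounded)
  have "(\<Sum>n. g n) \<le> g 0 + K * arctan_int s" by (rule suminf_le_const[OF sg up'])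
  thus "(\<Sum>n. g n) \<le> K * arctan_int s + t powr (-s)" by (simp add: g_def)
  have "filterlim (\<lambda>N. k * real N) at_top sequentially"
    using k by (intro filterlim_tendsto_pos_mult_at_top[OF tendsto_const] filterlim_real_sequentially)
  hence "(\<lambda>N. K * arctan_part_int s (k * real N)) \<longlonglongrightarrow> K * arctan_int s"
    by (intro tendsto_mult tendsto_const filterlim_compose[OF arctan_part_int_tendsto[OF s]])
  thus "K * arctan_int s \<le> (\<Sum>n. g n)"
    using summable_LIMSEQ[OF sg] low by (intro LIMSEQ_le) auto
qed

text \<open>The sum of \<open>(a x^2 + t) powr (-s)\<close> over all integers \<open>x\<close> minus the integral over the real line.\<close>

definition epstein_rem :: "real \<Rightarrow> real \<Rightarrow> real \<Rightarrow> real" where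
  "epstein_rem a t s = 2 * (\<Sum>n. (a * (real n)\<^sup>2 + t) powr (-s)) - t powr (-s) - 2 * (a powr (-1/2) * t powr (1/2 - s) * arctan_int s)"

text \<open>The integral test confines the doubled series to an interval of length
  \<open>2 * t powr (-s)\<close>; subtracting \<open>t powr (-s)\<close> centres it at the
  integral.\<close>

lemma epstein_rem_bound: "a > 0 \<Longrightarrow> t > 0 \<Longrightarrow> s \<ge> 1 \<Longrightarrow> \<bar>epstein_rem a t s\<bar> \<le> t powr (-s)"
  using sum_arctan_int_bounds(2,3)[of a t s] unfolding epstein_rem_def by linarith

lemma summable_inverse_quadratic: "a > 0 \<Longrightarrow> t > 0 \<Longrightarrow> summable (\<lambda>n. 1 / (a * (real n)\<^sup>2 + t))"
proof -
  assume a: "a > 0" and t: "t > 0"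
  have "(a * (real n)\<^sup>2 + t) powr (-1) = 1 / (a * (real n)\<^sup>2 + t)" for n
    using a t by (simp add: powr_minus divide_inverse add_nonneg_pos)
  thus ?thesis using sum_arctan_int_bounds(1)[OF a t, of 1] by simp
qed

lemma epstein_rem_tendsto:
  assumes a: "a \<ge> 1" and t: "t \<ge> 1"
  shows "(epstein_rem a t \<longlongrightarrow> 2 * (\<Sum>n. 1 / (a * (real n)\<^sup>2 + t)) - 1 / t - pi / sqrt (a * t)) (at_right 1)"
proof -
  have pos: "a * (real n)\<^sup>2 + t \<ge> 1" for n using a t by (simp add: add_increasing)
  have "((\<lambda>s. \<Sum>n. (a * (real n)\<^sup>2 + t) powr (-s)) \<longlongrightarrow> (\<Sum>n. 1 / (a * (real n)\<^sup>2 + t))) (at_right 1)"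
  proof (rule suminf_tendsto_at_right_1(2))
    have p1: "(a * (real n)\<^sup>2 + t) powr (-1) = 1 / (a * (real n)\<^sup>2 + t)" for n
      using pos[of n] by (simp add: powr_minus divide_inverse)
    have "((\<lambda>s. (a * (real n)\<^sup>2 + t) powr (-s)) \<longlongrightarrow> (a * (real n)\<^sup>2 + t) powr (-1)) (at_right 1)" for n
      using pos[of n] by (intro tendsto_intros) auto
    thus "((\<lambda>s. (a * (real n)\<^sup>2 + t) powr (-s)) \<longlongrightarrow> 1 / (a * (real n)\<^sup>2 + t)) (at_right 1)" for n
      unfolding p1 .
    fix n and s :: real
    assume "1 < s"
    hence "(a * (real n)\<^sup>2 + t) powr (-s) \<le> (a * (real n)\<^sup>2 + t) powr (-1)"
      using pos[of n] by (intro powr_mono) auto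
    thus "\<bar>(a * (real n)\<^sup>2 + t) powr (-s)\<bar> \<le> 1 / (a * (real n)\<^sup>2 + t)" unfolding p1 by simp
  qed (use a t in \<open>auto intro!: summable_inverse_quadratic\<close>)
  hence "(epstein_rem a t \<longlongrightarrow> 2 * (\<Sum>n. 1 / (a * (real n)\<^sup>2 + t)) - t powr (-1)
      - 2 * (a powr (-1/2) * t powr (1/2 - 1) * (pi / 2))) (at_right 1)"
    unfolding epstein_rem_def using t by (intro tendsto_intros arctan_int_tendsto) auto
  also have "t powr (-1) = 1 / t" using t by (simp add: powr_minus divide_inverse)
  also have "a powr (-1/2) * t powr (1/2 - 1) * (pi / 2) = pi / 2 / sqrt (a * t)"
  proof -
    have "t powr (1/2 - 1) = t powr (-1/2)" by simp
    moreover have "a powr (-1/2) = inverse (sqrt a)" "t powr (-1/2) = inverse (sqrt t)"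
      using a t by (intro powr_minus_half; simp)+
    ultimately have e: "a powr (-1/2) * t powr (1/2 - 1) = inverse (sqrt a) * inverse (sqrt t)" by (simp only:)
    show ?thesis unfolding e real_sqrt_mult by (simp add: field_simps)
  qed
  finally show ?thesis by simp
qed

text \<open>At \<open>s = 1\<close> the row sum is a hyperbolic cotangent, equal to
  \<open>1 + 2 * Q^y / (1 - Q^y)\<close>. Its leading 1 is the integral over the row, which is
  subtracted, and only the exponentially small part remains.\<close>

lemma epstein_rem_limit_value:
  fixes a c :: real and y :: nat
  assumes a: "a > 0" and c: "c > 0" and y: "y > 0"
  defines "Q \<equiv> exp (- 2 * pi * sqrt (c / a))"
  shows "2 * (\<Sum>n. 1 / (a * (real n)\<^sup>2 + c * (real y)\<^sup>2)) - 1 / (c * (real y)\<^sup>2) - pi / sqrt (a * (c * (real y)\<^sup>2))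
    = 2 * pi / sqrt (a * c) * (1 / real y * (Q ^ y / (1 - Q ^ y)))"
proof -
  define w where "w = sqrt (c / a) * real y"
  have w: "w > 0" unfolding w_def using a c y by simp
  have w2: "w\<^sup>2 = c * (real y)\<^sup>2 / a" unfolding w_def using a c by (simp add: power_mult_distrib)
  have aw: "a * w = sqrt (a * c) * real y" 
  proof -
    have "a * sqrt (c / a) = sqrt (a\<^sup>2) * sqrt (c / a)" using a by simp
    also have "\<dots> = sqrt (a\<^sup>2 * (c / a))" by (rule real_sqrt_mult[symmetric])
    also have "a\<^sup>2 * (c / a) = a * c" using a by (simp add: power2_eq_square)
    finally show ?thesis unfolding w_def by (simp add: mult.assoc[symmetric])
  qed
  have "(\<lambda>n. 1 / (2 * a * w) * (2 * w / ((real (Suc n))\<^sup>2 + w\<^sup>2))) sums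
     (1 / (2 * a * w) * (pi * (cosh (pi * w) / sinh (pi * w)) - 1 / w))"
    by (intro sums_mult coth_sums w)
  also have "(\<lambda>n. 1 / (2 * a * w) * (2 * w / ((real (Suc n))\<^sup>2 + w\<^sup>2))) = (\<lambda>n. 1 / (a * (real (Suc n))\<^sup>2 + c * (real y)\<^sup>2))"
  proof
    fix n
    have "a * ((real (Suc n))\<^sup>2 + w\<^sup>2) = a * (real (Suc n))\<^sup>2 + c * (real y)\<^sup>2" unfolding w2 using a by (simp add: field_simps)
    moreover have "1 / (2 * a * w) * (2 * w / ((real (Suc n))\<^sup>2 + w\<^sup>2)) = 1 / (a * ((real (Suc n))\<^sup>2 + w\<^sup>2))"
      using w by simp
    ultimately show "1 / (2 * a * w) * (2 * w / ((real (Suc n))\<^sup>2 + w\<^sup>2)) = 1 / (a * (real (Suc n))\<^sup>2 + c * (real y)\<^sup>2)" by simp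
  qed
  finally have "(\<lambda>n. 1 / (a * (real n)\<^sup>2 + c * (real y)\<^sup>2)) sums
     (1 / (2 * a * w) * (pi * (cosh (pi * w) / sinh (pi * w)) - 1 / w) + 1 / (a * (real 0)\<^sup>2 + c * (real y)\<^sup>2))"
    by (subst (asm) sums_Suc_iff) simp
  hence S: "(\<Sum>n. 1 / (a * (real n)\<^sup>2 + c * (real y)\<^sup>2)) =
     1 / (2 * a * w) * (pi * (cosh (pi * w) / sinh (pi * w)) - 1 / w) + 1 / (c * (real y)\<^sup>2)"
    by (simp add: sums_iff)
  have r: "sqrt (a * (c * (real y)\<^sup>2)) = a * w" unfolding aw using y by (simp add: real_sqrt_mult)
  have cy: "c * (real y)\<^sup>2 = a * w\<^sup>2" unfolding w2 using a by simp
  have ch: "cosh (pi * w) / sinh (pi * w) = 1 + 2 * (Q ^ y / (1 - Q ^ y))"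
  proof -
    define e where "e = exp (pi * w)"
    have e: "e > 1" unfolding e_def using w by simp
    have "Q ^ y = exp (- (2 * (pi * w)))" unfolding Q_def w_def exp_of_nat_mult[symmetric] by (simp add: algebra_simps)
    also have "\<dots> = inverse (e * e)" by (simp only: e_def exp_minus mult_2 exp_add)
    finally have Qe: "Q ^ y = inverse (e * e)" .
    have "cosh (pi * w) / sinh (pi * w) = (e + inverse e) / (e - inverse e)"
    proof -
      have "(A / 2) / (B / 2) = A / B" for A B :: real by simp
      from this[of "e + inverse e" "e - inverse e"] show ?thesis
        unfolding cosh_field_def sinh_field_def e_def exp_minus .
    qed
    also have "\<dots> = ((e + inverse e) * e) / ((e - inverse e) * e)" using e by simp
    also have "\<dots> = (e * e + 1) / (e * e - 1)" using e by (simp only: distrib_right left_diff_distrib) simp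
    also have "\<dots> = 1 + 2 * (inverse (e * e) / (1 - inverse (e * e)))"
    proof -
      have "E > 1 \<Longrightarrow> (E + 1) / (E - 1) = 1 + 2 * (inverse E / (1 - inverse E))" for E :: real
        by (simp add: field_simps)
      moreover have "e * e > 1" using e by (simp add: less_1_mult)
      ultimately show ?thesis by blast
    qed
    finally show ?thesis unfolding Qe .
  qed
  have "2 * (\<Sum>n. 1 / (a * (real n)\<^sup>2 + c * (real y)\<^sup>2)) - 1 / (c * (real y)\<^sup>2) - pi / (a * w)
     = 2 * (1 / (2 * a * w) * (pi * (1 + 2 * (Q ^ y / (1 - Q ^ y))) - 1 / w)) + 1 / (a * w\<^sup>2) - pi / (a * w)"
  proof -
    have "2 * S - u - v = 2 * X + u - v" if "S = X + u" for S u v X :: real using that by simp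
    from this[OF S[unfolded ch cy]] show ?thesis unfolding cy .
  qed
  also have "\<dots> = 2 * pi / (a * w) * (Q ^ y / (1 - Q ^ y))"
  proof -
    have "2 * (1 / (2 * a * w) * (p * (1 + 2 * X) - 1 / w)) + 1 / (a * w\<^sup>2) - p / (a * w) = 2 * p / (a * w) * X" for X p :: real
      using a w by (simp add: field_simps power2_eq_square)
    thus ?thesis .
  qed
  finally show ?thesis unfolding r aw by simp
qed

text \<open>Expand each logarithm of the product into its power series and interchange the two sums;
  the inner sum is then geometric. All terms have the same sign, so the interchange is
  allowed.\<close>

lemma ln_euler_double_series:
  assumes q: "0 < q" "q < (1::real)"
  shows "(\<lambda>y. 1 / real (Suc y) * (q ^ Suc y / (1 - q ^ Suc y))) sums (- ln_euler q)"
proof -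
  define f where "f = (\<lambda>(k, y). (q ^ Suc k) ^ Suc y / real (Suc y))"
  have qk: "0 < q ^ Suc k" "q ^ Suc k < 1" for k using q power_Suc_less_one by auto
  have inner1: "((\<lambda>y. f (k, y)) has_sum (- ln (1 - q ^ Suc k))) UNIV" for k
  proof -
    have "(\<lambda>n. - ((-(-1)) ^ n / real n * (q ^ Suc k) ^ n)) sums ln (1 - q ^ Suc k)"
      using ln_series'[of "- (q ^ Suc k)"] qk[of k] by simp
    hence "(\<lambda>n. (q ^ Suc k) ^ n / real n) sums (- ln (1 - q ^ Suc k))"
      using sums_minus by fastforce
    hence "(\<lambda>y. (q ^ Suc k) ^ Suc y / real (Suc y)) sums (- ln (1 - q ^ Suc k))"
      by (subst sums_Suc_iff) simp
    thus ?thesis unfolding f_def using q by (intro norm_summable_imp_has_sum) (auto simp: sums_iff abs_mult)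
  qed
  have outer1: "((\<lambda>k. - ln (1 - q ^ Suc k)) has_sum (- ln_euler q)) UNIV"
  proof (rule norm_summable_imp_has_sum)
    show "(\<lambda>k. - ln (1 - q ^ Suc k)) sums (- ln_euler q)"
      unfolding ln_euler_def by (intro sums_minus summable_sums summable_ln_one_minus q)
    have "norm (- ln (1 - q ^ Suc k)) = - ln (1 - q ^ Suc k)" for k using qk[of k] by simp
    thus "summable (\<lambda>k. norm (- ln (1 - q ^ Suc k)))"
      using summable_minus[OF summable_ln_one_minus[OF q]] by simp
  qed
  have sm: "f summable_on (UNIV \<times> UNIV)"
    by (rule summable_on_SigmaI[OF inner1]) (use outer1 q in \<open>auto simp: summable_on_def f_def\<close>)
  have tot: "(f has_sum (- ln_euler q)) (UNIV \<times> UNIV)"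
    by (rule has_sum_SigmaI[OF inner1 outer1 sm])
  hence "((\<lambda>(y, k). f (k, y)) has_sum (- ln_euler q)) (UNIV \<times> UNIV)"
    by (rule has_sum_swap[THEN iffD1])
  moreover have "((\<lambda>k. (\<lambda>(y, k). f (k, y)) (y, k)) has_sum (1 / real (Suc y) * (q ^ Suc y / (1 - q ^ Suc y)))) UNIV" for y
  proof -
    have "(\<lambda>k. 1 / real (Suc y) * (q ^ Suc y * (q ^ Suc y) ^ k)) sums (1 / real (Suc y) * (q ^ Suc y * (1 / (1 - q ^ Suc y))))"
      using qk[of y] by (intro sums_mult geometric_sums) simp
    moreover have "1 / real (Suc y) * (q ^ Suc y * (q ^ Suc y) ^ k) = f (k, y)" for k
      unfolding f_def by (simp add: power_mult[symmetric] power_add[symmetric] algebra_simps)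
    ultimately have "(\<lambda>k. f (k, y)) sums (1 / real (Suc y) * (q ^ Suc y / (1 - q ^ Suc y)))" by simp
    moreover have "norm (f (k, y)) = f (k, y)" for k using q by (simp add: f_def)
    ultimately show ?thesis by (intro norm_summable_imp_has_sum) (auto simp: sums_iff)
  qed
  ultimately have "((\<lambda>y. 1 / real (Suc y) * (q ^ Suc y / (1 - q ^ Suc y))) has_sum (- ln_euler q)) UNIV"
    by (rule has_sum_SigmaD)
  thus ?thesis by (rule has_sum_imp_sums)
qed


section \<open>The zeta function near its pole\<close>

definition zeta_series :: "real \<Rightarrow> real" where "zeta_series s = (\<Sum>n. real (Suc n) powr (-s))"

lemma summable_zeta_series: "s > 1 \<Longrightarrow> summable (\<lambda>n. real (Suc n) powr (-s))"
  using summable_Suc_iff[of "\<lambda>n. real n powr (-s)"] summable_real_powr_iff[of "-s"] by simp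

lemma zeta_series_step:
  assumes "s > 1"
  shows "(s - 1) * real (Suc (Suc n)) powr (-s) \<le> real (Suc n) powr (1 - s) - real (Suc (Suc n)) powr (1 - s)"
    "real (Suc n) powr (1 - s) - real (Suc (Suc n)) powr (1 - s) \<le> (s - 1) * real (Suc n) powr (-s)"
proof -
  have "\<exists>z. z > real (Suc n) \<and> z < real (Suc (Suc n)) \<and>
      real (Suc (Suc n)) powr (1 - s) - real (Suc n) powr (1 - s) = (real (Suc (Suc n)) - real (Suc n)) * ((1 - s) * z powr (1 - s - 1))"
    by (rule MVT2) (auto intro!: derivative_eq_intros)
  then obtain z where z: "real (Suc n) < z" "z < real (Suc (Suc n))"
      "real (Suc n) powr (1 - s) - real (Suc (Suc n)) powr (1 - s) = (s - 1) * z powr (-s)"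
    by (auto simp: algebra_simps)
  have z0: "z > 0" using z(1) by (rule le_less_trans[rotated]) simp
  show "(s - 1) * real (Suc (Suc n)) powr (-s) \<le> real (Suc n) powr (1 - s) - real (Suc (Suc n)) powr (1 - s)"
    unfolding z(3) using z z0 assms by (intro mult_left_mono powr_mono2') auto
  show "real (Suc n) powr (1 - s) - real (Suc (Suc n)) powr (1 - s) \<le> (s - 1) * real (Suc n) powr (-s)"
    unfolding z(3) using z z0 assms by (intro mult_left_mono powr_mono2') auto
qed

text \<open>Comparison of \<open>(s - 1) * n powr (-s)\<close> with the telescoping differences of
  \<open>n powr (1 - s)\<close> on either side.\<close>

lemma zeta_series_bounds:
  assumes s: "s > 1"
  shows "1 \<le> (s - 1) * zeta_series s" "(s - 1) * zeta_series s \<le> s"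
proof -
  have "(\<lambda>n. real (Suc n) powr (1 - s)) \<longlonglongrightarrow> 0"
    using s by real_asymp
  hence t: "(\<lambda>n. real (Suc n) powr (1 - s) - real (Suc (Suc n)) powr (1 - s)) sums (real (Suc 0) powr (1 - s) - 0)"
    by (rule telescope_sums')
  have z: "(\<lambda>n. (s - 1) * real (Suc n) powr (-s)) sums ((s - 1) * zeta_series s)"
    unfolding zeta_series_def by (intro sums_mult summable_sums summable_zeta_series s)
  have "real (Suc 0) powr (1 - s) - 0 \<le> (s - 1) * zeta_series s"
    by (rule sums_le[OF zeta_series_step(2)[OF s] t z])
  thus "1 \<le> (s - 1) * zeta_series s" by simp
  have "(\<lambda>n. (s - 1) * real (Suc (Suc n)) powr (-s)) sums ((s - 1) * zeta_series s - (s - 1) * real (Suc 0) powr (-s))"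
    using z by (subst sums_Suc_iff) simp
  hence "(s - 1) * zeta_series s - (s - 1) * real (Suc 0) powr (-s) \<le> real (Suc 0) powr (1 - s) - 0"
    by (rule sums_le[OF zeta_series_step(1)[OF s] _ t])
  thus "(s - 1) * zeta_series s \<le> s" by simp
qed

lemma zeta_series_pole: "((\<lambda>s. (s - 1) * zeta_series (2 * s - 1)) \<longlongrightarrow> 1 / 2) (at_right 1)"
proof (rule tendsto_sandwich)
  have ev: "eventually (\<lambda>s. s > (1::real)) (at_right 1)" by (rule eventually_at_right_less)
  have b: "1 / 2 \<le> (s - 1) * zeta_series (2 * s - 1)" "(s - 1) * zeta_series (2 * s - 1) \<le> (2 * s - 1) / 2" if "1 < s" for s
  proof -
    have s1: "1 < 2 * s - 1" using that by simp
    have e: "(2 * s - 1 - 1) * zeta_series (2 * s - 1) = 2 * ((s - 1) * zeta_series (2 * s - 1))" by (simp add: algebra_simps)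
    define X where "X = (s - 1) * zeta_series (2 * s - 1)"
    have "1 \<le> 2 * X" "2 * X \<le> 2 * s - 1" using zeta_series_bounds[OF s1] unfolding e X_def .
    thus "1 / 2 \<le> (s - 1) * zeta_series (2 * s - 1)" "(s - 1) * zeta_series (2 * s - 1) \<le> (2 * s - 1) / 2"
      unfolding X_def[symmetric] by simp_all
  qed
  show "eventually (\<lambda>s. 1 / 2 \<le> (s - 1) * zeta_series (2 * s - 1)) (at_right 1)"
    using ev by (rule eventually_mono) (rule b)
  show "eventually (\<lambda>s. (s - 1) * zeta_series (2 * s - 1) \<le> (2 * s - 1) / 2) (at_right 1)"
    using ev by (rule eventually_mono) (rule b)
  have "((\<lambda>s::real. (2 * s - 1) / 2) \<longlongrightarrow> (2 * 1 - 1) / 2) (at_right 1)" by (intro tendsto_intros) auto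
  thus "((\<lambda>s::real. (2 * s - 1) / 2) \<longlongrightarrow> 1 / 2) (at_right 1)" by simp
qed auto

lemma summable_inverse_Suc_squares: "summable (\<lambda>n. 1 / (real (Suc n))\<^sup>2)"
  using inverse_squares_sums by (simp add: sums_iff add.commute)

lemma zeta_series_2_tendsto: "((\<lambda>s. zeta_series (2 * s)) \<longlongrightarrow> pi\<^sup>2 / 6) (at_right 1)"
proof -
  have p2: "real (Suc n) powr (- (2 * 1)) = 1 / (real (Suc n))\<^sup>2" for n
    using powr_realpow[of "real (Suc n)" 2] by (simp add: powr_minus divide_inverse del: of_nat_Suc)
  have "((\<lambda>s. \<Sum>n. real (Suc n) powr (- (2 * s))) \<longlongrightarrow> (\<Sum>n. 1 / (real (Suc n))\<^sup>2)) (at_right 1)"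
  proof (rule suminf_tendsto_at_right_1(2)[OF _ summable_inverse_Suc_squares])
    fix n
    have "((\<lambda>s. real (Suc n) powr (- (2 * s))) \<longlongrightarrow> real (Suc n) powr (- (2 * 1))) (at_right 1)"
      by (intro tendsto_intros) auto
    thus "((\<lambda>s. real (Suc n) powr (- (2 * s))) \<longlongrightarrow> 1 / (real (Suc n))\<^sup>2) (at_right 1)" unfolding p2 .
    fix s :: real
    assume "1 < s"
    hence "real (Suc n) powr (- (2 * s)) \<le> real (Suc n) powr (- (2 * 1))" by (intro powr_mono) auto
    thus "\<bar>real (Suc n) powr (- (2 * s))\<bar> \<le> 1 / (real (Suc n))\<^sup>2" unfolding p2 by simp
  qed
  moreover have "(\<Sum>n. 1 / (real (Suc n))\<^sup>2) = pi\<^sup>2 / 6"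
    using inverse_squares_sums by (simp add: sums_iff add.commute)
  ultimately show ?thesis unfolding zeta_series_def by (simp only:)
qed

section \<open>Epstein zeta functions and their limit at 1\<close>

text \<open>The lattice sum arranged by rows: the row \<open>y = 0\<close>, the integrals over the
  remaining rows, and the deviations of those rows from their integrals. Only the middle term is
  singular at \<open>s = 1\<close>.\<close>

definition epstein_value :: "real \<Rightarrow> real \<Rightarrow> real \<Rightarrow> real" where
  "epstein_value a c s = 2 * a powr (-s) * zeta_series (2 * s) + 4 * (a powr (-1/2) * c powr (1/2 - s)) * arctan_int s * zeta_series (2 * s - 1)
     + 2 * (\<Sum>n. epstein_rem a (c * (real (Suc n))\<^sup>2) s)"

lemma square_powr: "(x::real) > 0 \<Longrightarrow> (x\<^sup>2) powr r = x powr (2 * r)"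
proof -
  assume "x > 0"
  hence "x\<^sup>2 = x powr 2" by (simp add: powr_numeral)
  thus ?thesis by (simp only: powr_powr)
qed

lemma epstein_rem_bound_square:
  assumes "a \<ge> 1" "c \<ge> 1" "s \<ge> 1"
  shows "\<bar>epstein_rem a (c * (real (Suc n))\<^sup>2) s\<bar> \<le> 1 / (real (Suc n))\<^sup>2"
proof -
  have t: "c * (real (Suc n))\<^sup>2 \<ge> (real (Suc n))\<^sup>2" using assms mult_right_mono[of 1 c "(real (Suc n))\<^sup>2"] by simp
  have sq: "(real (Suc n))\<^sup>2 \<ge> 1" by simp
  have "\<bar>epstein_rem a (c * (real (Suc n))\<^sup>2) s\<bar> \<le> (c * (real (Suc n))\<^sup>2) powr (-s)"
    using assms by (intro epstein_rem_bound) auto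
  also have "\<dots> \<le> (c * (real (Suc n))\<^sup>2) powr (-1)"
    using assms t sq by (intro powr_mono) linarith+
  also have "\<dots> = 1 / (c * (real (Suc n))\<^sup>2)" using assms by (simp add: powr_minus divide_inverse del: of_nat_Suc)
  also have "\<dots> \<le> 1 / (real (Suc n))\<^sup>2" 
  proof -
    have p: "0 < c" "0 < (real (Suc n))\<^sup>2" using assms by auto
    show ?thesis by (rule divide_left_mono[OF t _ mult_pos_pos[OF mult_pos_pos[OF p] p(2)]]) simp
  qed
  finally show ?thesis .
qed

text \<open>The terms are nonnegative, so convergence of the row sums, and of their sum, justifies
  summing row by row.\<close>

theorem epstein_has_sum:
  assumes a: "a \<ge> 1" and c: "c \<ge> 1" and s: "s > 1"
  shows "((\<lambda>(x, y). (a * (of_int x)\<^sup>2 + c * (of_int y)\<^sup>2) powr (-s)) has_sum epstein_value a c s) (UNIV - {(0::int, 0::int)})"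
proof -
  define f where "f = (\<lambda>(x::int, y::int). (a * (of_int x)\<^sup>2 + c * (of_int y)\<^sup>2) powr (-s))"
  define T where "T t = epstein_rem a t s + 2 * (a powr (-1/2) * t powr (1/2 - s) * arctan_int s)" for t
  have a0: "a > 0" and c0: "c > 0" using a c by auto
  have inner: "((\<lambda>x. f (x, y)) has_sum T (c * (of_int y)\<^sup>2)) UNIV" if y: "y \<noteq> 0" for y
  proof -
    define t where "t = c * (of_int y)\<^sup>2"
    have t: "t > 0" unfolding t_def using c0 y by simp
    have sm: "summable (\<lambda>n. (a * (real n)\<^sup>2 + t) powr (-s))" using sum_arctan_int_bounds(1)[OF a0 t, of s] s by simp
    have "(\<lambda>n. (a * (real n)\<^sup>2 + t) powr (-s)) sums (\<Sum>n. (a * (real n)\<^sup>2 + t) powr (-s))"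
      using sm by (rule summable_sums)
    hence "(\<lambda>n. (a * (real (Suc n))\<^sup>2 + t) powr (-s)) sums ((\<Sum>n. (a * (real n)\<^sup>2 + t) powr (-s)) - t powr (-s))"
      by (subst sums_Suc_iff) simp
    hence "((\<lambda>n. (a * (real (Suc n))\<^sup>2 + t) powr (-s)) has_sum ((\<Sum>n. (a * (real n)\<^sup>2 + t) powr (-s)) - t powr (-s))) UNIV"
      by (rule sums_nonneg_imp_has_sum) simp
    hence "((\<lambda>n. f (int (Suc n), y)) has_sum ((\<Sum>n. (a * (real n)\<^sup>2 + t) powr (-s)) - t powr (-s))) UNIV"
      by (simp add: f_def t_def)
    hence "((\<lambda>x. f (x, y)) has_sum (2 * ((\<Sum>n. (a * (real n)\<^sup>2 + t) powr (-s)) - t powr (-s)))) (UNIV - {0})"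
      by (rule has_sum_int_even) (simp add: f_def)
    hence "((\<lambda>x. f (x, y)) has_sum (f (0, y) + 2 * ((\<Sum>n. (a * (real n)\<^sup>2 + t) powr (-s)) - t powr (-s)))) (insert 0 (UNIV - {0}))"
      by (intro has_sum_insert) auto
    also have "f (0, y) = t powr (-s)" by (simp add: f_def t_def)
    also have "t powr (-s) + 2 * ((\<Sum>n. (a * (real n)\<^sup>2 + t) powr (-s)) - t powr (-s)) = T t"
      unfolding T_def epstein_rem_def by simp
    also have "insert 0 (UNIV - {0}) = (UNIV :: int set)" by auto
    finally show ?thesis unfolding t_def .
  qed
  define S where "S = a powr (-1/2) * c powr (1/2 - s) * arctan_int s * 2 * zeta_series (2 * s - 1) + (\<Sum>n. epstein_rem a (c * (real (Suc n))\<^sup>2) s)"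
  have Tnn: "T (c * (of_int y)\<^sup>2) \<ge> 0" if "y \<noteq> 0" for y :: int
    by (rule has_sum_nonneg[OF inner[OF that]]) (simp add: f_def)
  have "(\<lambda>n. T (c * (real (Suc n))\<^sup>2)) sums S"
  proof -
    have "summable (\<lambda>n. epstein_rem a (c * (real (Suc n))\<^sup>2) s)"
      by (rule summable_comparison_test'[OF summable_inverse_Suc_squares])
        (use epstein_rem_bound_square[OF a c] s in auto)
    hence 1: "(\<lambda>n. epstein_rem a (c * (real (Suc n))\<^sup>2) s) sums (\<Sum>n. epstein_rem a (c * (real (Suc n))\<^sup>2) s)" by (rule summable_sums)
    have 2: "(\<lambda>n. a powr (-1/2) * c powr (1/2 - s) * arctan_int s * 2 * real (Suc n) powr (-(2 * s - 1))) sums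
        (a powr (-1/2) * c powr (1/2 - s) * arctan_int s * 2 * zeta_series (2 * s - 1))"
      unfolding zeta_series_def using s by (intro sums_mult summable_sums summable_zeta_series) simp
    have "(c * (real (Suc n))\<^sup>2) powr (1/2 - s) = c powr (1/2 - s) * real (Suc n) powr (-(2 * s - 1))" for n
    proof -
      have "(c * (real (Suc n))\<^sup>2) powr (1/2 - s) = c powr (1/2 - s) * ((real (Suc n))\<^sup>2) powr (1/2 - s)"
        by (rule powr_mult)
      also have "((real (Suc n))\<^sup>2) powr (1/2 - s) = real (Suc n) powr (2 * (1/2 - s))" by (rule square_powr) simp
      also have "2 * (1/2 - s) = -(2 * s - 1)" by simp
      finally show ?thesis .
    qed
    hence "T (c * (real (Suc n))\<^sup>2) = a powr (-1/2) * c powr (1/2 - s) * arctan_int s * 2 * real (Suc n) powr (-(2 * s - 1))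
       + epstein_rem a (c * (real (Suc n))\<^sup>2) s" for n
      unfolding T_def by (simp only: mult_ac add.commute)
    thus ?thesis unfolding S_def using sums_add[OF 2 1] by (simp only:)
  qed
  hence "((\<lambda>n. T (c * (real (Suc n))\<^sup>2)) has_sum S) UNIV"
    by (rule sums_nonneg_imp_has_sum) (use Tnn[of "int (Suc _)"] in simp)
  hence "((\<lambda>n. T (c * (of_int (int (Suc n)))\<^sup>2)) has_sum S) UNIV" by simp
  hence outer: "((\<lambda>y. T (c * (of_int y)\<^sup>2)) has_sum (2 * S)) (UNIV - {0})"
    by (rule has_sum_int_even) simp
  have inner': "((\<lambda>x. (case (y, x) of (y, x) \<Rightarrow> f (x, y))) has_sum T (c * (of_int y)\<^sup>2)) UNIV" if "y \<in> UNIV - {0}" for y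
    using inner[of y] that by simp
  have sm: "(\<lambda>(y, x). f (x, y)) summable_on ((UNIV - {0}) \<times> UNIV)"
    by (rule summable_on_SigmaI[OF inner']) (use outer in \<open>auto simp: summable_on_def f_def\<close>)
  have "((\<lambda>(y, x). f (x, y)) has_sum (2 * S)) ((UNIV - {0}) \<times> UNIV)"
    by (rule has_sum_SigmaI[OF inner' outer sm])
  hence two: "(f has_sum (2 * S)) (UNIV \<times> (UNIV - {0}))"
    by (rule has_sum_swap[THEN iffD2])
  have "(\<lambda>n. a powr (-s) * real (Suc n) powr (-(2 * s))) sums (a powr (-s) * zeta_series (2 * s))"
    unfolding zeta_series_def using s by (intro sums_mult summable_sums summable_zeta_series) simp
  moreover have "a powr (-s) * real (Suc n) powr (-(2 * s)) = f (int (Suc n), 0)" for n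
  proof -
    have "f (int (Suc n), 0) = (a * (real (Suc n))\<^sup>2) powr (-s)" by (simp add: f_def)
    also have "\<dots> = a powr (-s) * ((real (Suc n))\<^sup>2) powr (-s)" by (rule powr_mult)
    also have "((real (Suc n))\<^sup>2) powr (-s) = real (Suc n) powr (2 * (-s))" by (rule square_powr) simp
    finally show ?thesis by simp
  qed
  ultimately have "(\<lambda>n. f (int (Suc n), 0)) sums (a powr (-s) * zeta_series (2 * s))" by simp
  hence "((\<lambda>n. f (int (Suc n), 0)) has_sum (a powr (-s) * zeta_series (2 * s))) UNIV"
    by (rule sums_nonneg_imp_has_sum) (simp add: f_def)
  hence "((\<lambda>x. f (x, 0)) has_sum (2 * (a powr (-s) * zeta_series (2 * s)))) (UNIV - {0})"
    by (rule has_sum_int_even) (simp add: f_def)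
  hence "((f \<circ> (\<lambda>x. (x, 0))) has_sum (2 * (a powr (-s) * zeta_series (2 * s)))) (UNIV - {0})" by (simp add: o_def)
  hence one: "(f has_sum (2 * (a powr (-s) * zeta_series (2 * s)))) ((\<lambda>x. (x, 0)) ` (UNIV - {0}))"
    by (subst has_sum_reindex) (auto simp: inj_on_def)
  have "(f has_sum (2 * (a powr (-s) * zeta_series (2 * s)) + 2 * S)) ((\<lambda>x. (x, 0)) ` (UNIV - {0}) \<union> (UNIV \<times> (UNIV - {0})))"
    by (rule has_sum_Un_disjoint[OF one two]) auto
  also have "(\<lambda>x. (x, 0)) ` (UNIV - {0}) \<union> (UNIV \<times> (UNIV - {0})) = UNIV - {(0::int, 0::int)}" by auto
  also have "2 * (a powr (-s) * zeta_series (2 * s)) + 2 * S = epstein_value a c s" unfolding epstein_value_def S_def by (simp add: algebra_simps)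
  finally show ?thesis unfolding f_def .
qed

lemma epstein_rem_sum_tendsto:
  assumes a: "a \<ge> 1" and c: "c \<ge> 1"
  shows "((\<lambda>s. \<Sum>n. epstein_rem a (c * (real (Suc n))\<^sup>2) s) \<longlongrightarrow> - (2 * pi / sqrt (a * c) * ln_euler (exp (- 2 * pi * sqrt (c / a))))) (at_right 1)"
proof -
  define Q where "Q = exp (- 2 * pi * sqrt (c / a))"
  have Q: "0 < Q" "Q < 1" unfolding Q_def using a c by auto
  have "((\<lambda>s. \<Sum>n. epstein_rem a (c * (real (Suc n))\<^sup>2) s) \<longlongrightarrow>
     (\<Sum>n. 2 * pi / sqrt (a * c) * (1 / real (Suc n) * (Q ^ Suc n / (1 - Q ^ Suc n))))) (at_right 1)"
  proof (rule suminf_tendsto_at_right_1(2)[OF _ summable_inverse_Suc_squares])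
    fix n
    have t: "c * (real (Suc n))\<^sup>2 \<ge> 1"
    proof -
      have "1 * 1 \<le> c * (real (Suc n))\<^sup>2" using c by (intro mult_mono) auto
      thus ?thesis by simp
    qed
    show "(epstein_rem a (c * (real (Suc n))\<^sup>2) \<longlongrightarrow> 2 * pi / sqrt (a * c) * (1 / real (Suc n) * (Q ^ Suc n / (1 - Q ^ Suc n)))) (at_right 1)"
      using epstein_rem_tendsto[OF a t] epstein_rem_limit_value[of a c "Suc n"] a c unfolding Q_def by simp
  qed (use epstein_rem_bound_square[OF a c] in auto)
  also have "(\<Sum>n. 2 * pi / sqrt (a * c) * (1 / real (Suc n) * (Q ^ Suc n / (1 - Q ^ Suc n)))) = 2 * pi / sqrt (a * c) * (- ln_euler Q)"
    by (rule sums_unique[symmetric], rule sums_mult, rule ln_euler_double_series[OF Q])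
  finally show ?thesis unfolding Q_def by simp
qed

text \<open>The signs add up to zero, so the simple poles cancel and the limit is a derivative at 1.
  The quotients 658 / 94 and 329 / 47 both equal 7.\<close>

lemma main_term_tendsto:
  "((\<lambda>s::real. (658 powr (1 - s) + 329 powr (1 - s) - 94 powr (1 - s) - 47 powr (1 - s)) / (s - 1)) \<longlongrightarrow> - 2 * ln 7) (at_right 1)"
proof -
  have "((\<lambda>s::real. 658 powr (1 - s) + 329 powr (1 - s) - 94 powr (1 - s) - 47 powr (1 - s)) has_real_derivative
     (- ln 658 - ln 329 + ln 94 + ln 47)) (at 1)"
    by (auto intro!: derivative_eq_intros)
  hence "((\<lambda>s::real. (658 powr (1 - s) + 329 powr (1 - s) - 94 powr (1 - s) - 47 powr (1 - s)) / (s - 1)) \<longlongrightarrow>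
     (- ln 658 - ln 329 + ln 94 + ln 47)) (at 1)"
    by (simp add: has_field_derivative_iff)
  moreover have "ln 658 = ln 7 + (ln 94 :: real)" "ln 329 = ln 7 + (ln 47 :: real)"
    using ln_mult[of 7 "94::real"] ln_mult[of 7 "47::real"] by simp_all
  ultimately have "((\<lambda>s::real. (658 powr (1 - s) + 329 powr (1 - s) - 94 powr (1 - s) - 47 powr (1 - s)) / (s - 1)) \<longlongrightarrow> - 2 * ln 7) (at 1)"
    by simp
  thus ?thesis by (rule filterlim_mono) (auto simp: at_le)
qed

theorem epstein_combination_tendsto:
  defines "r \<equiv> sqrt 658"
  shows "((\<lambda>s. epstein_value 1 658 s + epstein_value 2 329 s - epstein_value 7 94 s - epstein_value 14 47 s) \<longlongrightarrow>
    3 * pi\<^sup>2 / 7 - 2 * pi / r * ln 7 - 4 * pi / r *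
      (ln_euler (exp (- 2 * pi * sqrt 658)) + ln_euler (exp (- 2 * pi * sqrt (329 / 2)))
       - ln_euler (exp (- 2 * pi * sqrt (94 / 7))) - ln_euler (exp (- 2 * pi * sqrt (47 / 14))))) (at_right 1)"
proof -
  define E where "E a c s = (\<Sum>n. epstein_rem a (c * (real (Suc n))\<^sup>2) s)" for a c s
  define m where "m s = (658 powr (1 - s) + 329 powr (1 - s) - 94 powr (1 - s) - 47 powr (1 - s)) / (s - 1)" for s :: real
  \<comment> \<open>All four forms have \<open>a * c = 658\<close>, so their singular terms share
    the factor \<open>1 / r\<close>.\<close>
  have pw: "a powr (-1/2) * c powr (1/2 - s) = 1 / r * c powr (1 - s)" if "a > 0" "c > 0" "a * c = 658" for a c s :: real
  proof -
    have "1/2 - s = (1 - s) + (-1/2)" by simp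
    hence "c powr (1/2 - s) = c powr (1 - s) * c powr (-1/2)" by (simp only: powr_add)
    hence "a powr (-1/2) * c powr (1/2 - s) = c powr (1 - s) * (a powr (-1/2) * c powr (-1/2))" by simp
    also have "a powr (-1/2) * c powr (-1/2) = (a * c) powr (-1/2)" by (rule powr_mult[symmetric])
    also have "\<dots> = inverse r" unfolding that r_def by (rule powr_minus_half) simp
    finally show ?thesis by (simp only: inverse_eq_divide mult.commute)
  qed
  have eq: "epstein_value 1 658 s + epstein_value 2 329 s - epstein_value 7 94 s - epstein_value 14 47 s =
      2 * (1 powr (-s) + 2 powr (-s) - 7 powr (-s) - 14 powr (-s)) * zeta_series (2 * s)
      + 4 * (1 / r) * m s * arctan_int s * ((s - 1) * zeta_series (2 * s - 1))
      + 2 * (E 1 658 s + E 2 329 s - E 7 94 s - E 14 47 s)" if "s > 1" for s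
  proof -
    have ms: "m s * (s - 1) = 658 powr (1 - s) + 329 powr (1 - s) - 94 powr (1 - s) - 47 powr (1 - s)"
      unfolding m_def using that by simp
    have M: "4 * (1 / r) * m s * arctan_int s * ((s - 1) * zeta_series (2 * s - 1)) =
       4 * (1 / r) * (658 powr (1 - s) + 329 powr (1 - s) - 94 powr (1 - s) - 47 powr (1 - s)) * arctan_int s * zeta_series (2 * s - 1)"
      unfolding ms[symmetric] by (simp only: mult_ac)
    have Z: "epstein_value a c s = 2 * a powr (-s) * zeta_series (2 * s) + 4 * (1 / r * c powr (1 - s)) * arctan_int s * zeta_series (2 * s - 1) + 2 * E a c s"
      if "a > 0" "c > 0" "a * c = 658" for a c
      unfolding epstein_value_def E_def pw[OF that] ..
    have "(2 * A1 * z + 4 * (k * p1) * j * w + 2 * E1) + (2 * A2 * z + 4 * (k * p2) * j * w + 2 * E2)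
       - (2 * A3 * z + 4 * (k * p3) * j * w + 2 * E3) - (2 * A4 * z + 4 * (k * p4) * j * w + 2 * E4)
       = 2 * (A1 + A2 - A3 - A4) * z + 4 * k * (p1 + p2 - p3 - p4) * j * w + 2 * (E1 + E2 - E3 - E4)"
      for A1 A2 A3 A4 p1 p2 p3 p4 E1 E2 E3 E4 z k j w :: real
      by (simp add: algebra_simps)
    moreover have "epstein_value 1 658 s = 2 * 1 powr (-s) * zeta_series (2 * s) + 4 * (1 / r * 658 powr (1 - s)) * arctan_int s * zeta_series (2 * s - 1) + 2 * E 1 658 s"
      "epstein_value 2 329 s = 2 * 2 powr (-s) * zeta_series (2 * s) + 4 * (1 / r * 329 powr (1 - s)) * arctan_int s * zeta_series (2 * s - 1) + 2 * E 2 329 s"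
      "epstein_value 7 94 s = 2 * 7 powr (-s) * zeta_series (2 * s) + 4 * (1 / r * 94 powr (1 - s)) * arctan_int s * zeta_series (2 * s - 1) + 2 * E 7 94 s"
      "epstein_value 14 47 s = 2 * 14 powr (-s) * zeta_series (2 * s) + 4 * (1 / r * 47 powr (1 - s)) * arctan_int s * zeta_series (2 * s - 1) + 2 * E 14 47 s"
      by (rule Z; simp)+
    ultimately show ?thesis unfolding M by (simp only:)
  qed
  have lim: "((\<lambda>s. 2 * (1 powr (-s) + 2 powr (-s) - 7 powr (-s) - 14 powr (-s)) * zeta_series (2 * s)
      + 4 * (1 / r) * m s * arctan_int s * ((s - 1) * zeta_series (2 * s - 1))
      + 2 * (E 1 658 s + E 2 329 s - E 7 94 s - E 14 47 s)) \<longlongrightarrow>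
    2 * (1 powr (-1) + 2 powr (-1) - 7 powr (-1) - 14 powr (-1)) * (pi\<^sup>2 / 6)
      + 4 * (1 / r) * (- 2 * ln 7) * (pi / 2) * (1 / 2)
      + 2 * (- (2 * pi / sqrt (1 * 658) * ln_euler (exp (- 2 * pi * sqrt (658 / 1)))) +
             - (2 * pi / sqrt (2 * 329) * ln_euler (exp (- 2 * pi * sqrt (329 / 2))))
             - - (2 * pi / sqrt (7 * 94) * ln_euler (exp (- 2 * pi * sqrt (94 / 7))))
             - - (2 * pi / sqrt (14 * 47) * ln_euler (exp (- 2 * pi * sqrt (47 / 14)))))) (at_right 1)"
    unfolding E_def m_def
    by (intro tendsto_intros zeta_series_2_tendsto zeta_series_pole arctan_int_tendsto epstein_rem_sum_tendsto main_term_tendsto) auto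
  have "((\<lambda>s. epstein_value 1 658 s + epstein_value 2 329 s - epstein_value 7 94 s - epstein_value 14 47 s) \<longlongrightarrow>
    2 * (1 powr (-1) + 2 powr (-1) - 7 powr (-1) - 14 powr (-1)) * (pi\<^sup>2 / 6)
      + 4 * (1 / r) * (- 2 * ln 7) * (pi / 2) * (1 / 2)
      + 2 * (- (2 * pi / sqrt (1 * 658) * ln_euler (exp (- 2 * pi * sqrt (658 / 1)))) +
             - (2 * pi / sqrt (2 * 329) * ln_euler (exp (- 2 * pi * sqrt (329 / 2))))
             - - (2 * pi / sqrt (7 * 94) * ln_euler (exp (- 2 * pi * sqrt (94 / 7))))
             - - (2 * pi / sqrt (14 * 47) * ln_euler (exp (- 2 * pi * sqrt (47 / 14)))))) (at_right 1)"
    by (rule Lim_transform_eventually[OF lim])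
      (rule eventually_mono[OF eventually_at_right_less], rule eq[symmetric])
  \<comment> \<open>From 1 + 1/2 - 1/7 - 1/14 = 9/7.\<close>
  moreover have "2 * (1 powr (-1) + 2 powr (-1) - 7 powr (-1) - 14 powr (-1)) * (pi\<^sup>2 / 6) = 3 * pi\<^sup>2 / 7"
    by (simp add: powr_minus)
  ultimately show ?thesis by (simp add: r_def algebra_simps)
qed


subsection \<open>The value of b\<close>

text \<open>Collects the terms with equal \<open>m z\<close>. It turns lattice sums and products of
  L-series alike into Dirichlet series.\<close>

lemma has_sum_regroup:
  fixes w :: "'a \<Rightarrow> real" and h :: "nat \<Rightarrow> real" and m :: "'a \<Rightarrow> nat"
  assumes S: "((\<lambda>z. w z * h (m z)) has_sum S) A" and fin: "\<And>n. finite {z \<in> A. m z = n}"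
  shows "((\<lambda>n. (\<Sum>z | z \<in> A \<and> m z = n. w z) * h n) has_sum S) UNIV"
proof -
  have bij: "bij_betw (\<lambda>z. (m z, z)) A (Sigma UNIV (\<lambda>n. {z \<in> A. m z = n}))"
    by (rule bij_betwI[of _ _ _ snd]) auto
  have "((\<lambda>(n, z). w z * h (m z)) has_sum S) (Sigma UNIV (\<lambda>n. {z \<in> A. m z = n}))"
    using S has_sum_reindex_bij_betw[OF bij, of "\<lambda>(n, z). w z * h (m z)" S] by simp
  moreover have "((\<lambda>z. (case (n, z) of (n, z) \<Rightarrow> w z * h (m z))) has_sum
      ((\<Sum>z | z \<in> A \<and> m z = n. w z) * h n)) {z \<in> A. m z = n}" for n
    using fin[of n] by (intro has_sum_finiteI) (auto simp: sum_distrib_right)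
  ultimately show ?thesis by (rule has_sum_SigmaD)
qed

lemma epstein_has_sum_rep:
  fixes a c :: int
  assumes a: "a \<ge> 1" and c: "c \<ge> 1" and s: "s > 1"
  shows "((\<lambda>n. real (card (rep a c (Suc n))) * real (Suc n) powr (-s)) has_sum epstein_value a c s) UNIV"
proof -
  let ?m = "\<lambda>(x, y). nat (a * x\<^sup>2 + c * y\<^sup>2)"
  have nn: "a * x\<^sup>2 + c * y\<^sup>2 \<ge> 0" for x y using a c by simp
  have pos: "a * x\<^sup>2 + c * y\<^sup>2 > 0" if "x \<noteq> 0 \<or> y \<noteq> 0" for x y
    using that a c by (auto intro: add_pos_nonneg add_nonneg_pos)
  \<comment> \<open>The index is the value of the form minus 1. On \<open>nat\<close> this
    subtraction would merge the values 0 and 1; leaving out the origin prevents that.\<close>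
  have fib: "{z \<in> UNIV - {(0, 0)}. ?m z - 1 = n} = rep a c (Suc n)" for n
  proof -
    have "(x, y) \<noteq> (0, 0) \<and> nat (a * x\<^sup>2 + c * y\<^sup>2) - 1 = n \<longleftrightarrow> a * x\<^sup>2 + c * y\<^sup>2 = int (Suc n)" for x y
      using pos[of x y] by (cases "x = 0 \<and> y = 0") auto
    thus ?thesis unfolding rep_def by auto
  qed
  have fin: "finite {z \<in> UNIV - {(0, 0)}. ?m z - 1 = n}" for n
    unfolding fib using a c by (intro finite_rep) auto
  have "((\<lambda>z. 1 * real (Suc (?m z - 1)) powr (-s)) has_sum epstein_value a c s) (UNIV - {(0, 0)})"
  proof -
    have "1 * real (Suc (?m z - 1)) powr (-s) =
        (case z of (x, y) \<Rightarrow> (real_of_int a * (of_int x)\<^sup>2 + real_of_int c * (of_int y)\<^sup>2) powr (-s))"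
      if "z \<in> UNIV - {(0, 0)}" for z
    proof -
      obtain x y where z: "z = (x, y)" by (cases z)
      have "0 < a * x\<^sup>2 + c * y\<^sup>2" using pos[of x y] that z by auto
      hence "int (Suc (nat (a * x\<^sup>2 + c * y\<^sup>2) - 1)) = a * x\<^sup>2 + c * y\<^sup>2" by linarith
      hence "real (Suc (nat (a * x\<^sup>2 + c * y\<^sup>2) - 1)) = real_of_int (a * x\<^sup>2 + c * y\<^sup>2)"
        by (metis of_int_of_nat_eq)
      thus ?thesis unfolding z prod.case by simp
    qed
    hence "((\<lambda>z. 1 * real (Suc (?m z - 1)) powr (-s)) has_sum epstein_value a c s) (UNIV - {(0, 0)}) \<longleftrightarrow>
      ((\<lambda>(x, y). (real_of_int a * (of_int x)\<^sup>2 + real_of_int c * (of_int y)\<^sup>2) powr (-s)) has_sum epstein_value a c s) (UNIV - {(0, 0)})"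
      by (rule has_sum_cong)
    thus ?thesis using epstein_has_sum[of "of_int a" "of_int c" s] a c s by simp
  qed
  from has_sum_regroup[where w = "\<lambda>_. 1" and h = "\<lambda>n. real (Suc n) powr (-s)" and m = "\<lambda>z. ?m z - 1", OF this fin]
  have "((\<lambda>n. (\<Sum>z\<in>{z \<in> UNIV - {(0, 0)}. ?m z - 1 = n}. 1) * real (Suc n) powr (-s)) has_sum epstein_value a c s) UNIV" .
  thus ?thesis unfolding fib by simp
qed

lemma L_series_mult_has_sum:
  assumes f: "\<And>n. \<bar>f n\<bar> \<le> 1" and g: "\<And>n. \<bar>g n\<bar> \<le> 1" and s: "s > 1"
  shows "((\<lambda>n. of_int (dconv f g (Suc n)) * real (Suc n) powr (-s)) has_sum (L_series f s * L_series g s)) UNIV"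
proof -
  define F where "F f n = real_of_int (f (int n + 1)) * real (n + 1) powr (-s)" for f and n :: nat
  have abs: "(\<lambda>n. norm (F f n)) summable_on UNIV" "(F f has_sum L_series f s) UNIV" if f: "\<And>n. \<bar>f n\<bar> \<le> 1" for f
  proof -
    have b: "\<bar>real_of_int (f n)\<bar> \<le> 1" for n using f[of n] by linarith
    have 1: "summable (\<lambda>n. \<bar>real_of_int (f (int n + 1))\<bar> * real (n + 1) powr (-s))"
      by (rule summable_powr_bounded) (use b s in auto)
    have n: "norm (F f n) = \<bar>real_of_int (f (int n + 1))\<bar> * real (n + 1) powr (-s)" for n
      unfolding F_def by (simp add: abs_mult)
    hence 2: "summable (\<lambda>n. norm (F f n))" using 1 by simp
    thus "(\<lambda>n. norm (F f n)) summable_on UNIV" by (intro summable_nonneg_imp_summable_on) auto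
    show "(F f has_sum L_series f s) UNIV"
      by (rule norm_summable_imp_has_sum[OF 2]) (use summable_norm_cancel[OF 2] in \<open>simp add: L_series_def F_def[abs_def] summable_sums\<close>)
  qed
  have prod: "((\<lambda>(d, e). F f d * F g e) has_sum (L_series f s * L_series g s)) (UNIV \<times> UNIV)"
  proof (rule has_sum_SigmaI)
    show "((\<lambda>e. case (d, e) of (d, e) \<Rightarrow> F f d * F g e) has_sum (F f d * L_series g s)) UNIV" for d
      using has_sum_cmult_right[OF abs(2)[OF g]] by simp
    show "((\<lambda>d. F f d * L_series g s) has_sum (L_series f s * L_series g s)) UNIV"
      by (rule has_sum_cmult_left[OF abs(2)[OF f]])
    have "(\<lambda>(d, e). norm (F f d) * norm (F g e)) summable_on (UNIV \<times> UNIV)"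
    proof (rule summable_on_SigmaI)
      show "((\<lambda>e. case (d, e) of (d, e) \<Rightarrow> norm (F f d) * norm (F g e)) has_sum
          (norm (F f d) * (\<Sum>\<^sub>\<infinity>e. norm (F g e)))) UNIV" for d
        using has_sum_cmult_right[OF has_sum_infsum[OF abs(1)[OF g]], of "norm (F f d)"] by simp
      show "(\<lambda>d. norm (F f d) * (\<Sum>\<^sub>\<infinity>e. norm (F g e))) summable_on UNIV"
        by (rule summable_on_cmult_left[OF abs(1)[OF f]])
    qed auto
    moreover have "(\<lambda>(d, e). norm (F f d) * norm (F g e)) = (\<lambda>z. norm (case z of (d, e) \<Rightarrow> F f d * F g e))"
      by (auto simp: abs_mult)
    ultimately have "(\<lambda>z. norm (case z of (d, e) \<Rightarrow> F f d * F g e)) summable_on (UNIV \<times> UNIV)" by (simp only:)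
    thus "(\<lambda>(d, e). F f d * F g e) summable_on (UNIV \<times> UNIV)" by (rule abs_summable_summable)
  qed
  define w where "w = (\<lambda>(d, e). real_of_int (f (int d + 1)) * real_of_int (g (int e + 1)))"
  \<comment> \<open>All indices are shifted by one:
    \<open>(d + 1) * (e + 1) = (d + e + d * e) + 1\<close>.\<close>
  let ?m = "\<lambda>(d::nat, e::nat). d + e + d * e"
  have ww: "(\<lambda>z. w z * real (Suc (?m z)) powr (-s)) = (\<lambda>(d, e). F f d * F g e)"
  proof
    fix z :: "nat \<times> nat"
    obtain d e where z: "z = (d, e)" by (cases z)
    have "real (Suc (d + e + d * e)) = real (d + 1) * real (e + 1)" by (simp add: algebra_simps)
    hence "real (Suc (d + e + d * e)) powr (-s) = real (d + 1) powr (-s) * real (e + 1) powr (-s)"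
      by (simp only: powr_mult)
    thus "w z * real (Suc (?m z)) powr (-s) = (case z of (d, e) \<Rightarrow> F f d * F g e)"
      unfolding z w_def F_def prod.case by (simp only: mult_ac)
  qed
  have fin: "finite {z \<in> UNIV \<times> UNIV. ?m z = n}" for n
    by (rule finite_subset[of _ "{..n} \<times> {..n}"]) auto
  have "((\<lambda>n. (\<Sum>z | z \<in> UNIV \<times> UNIV \<and> ?m z = n. w z) * real (Suc n) powr (-s)) has_sum (L_series f s * L_series g s)) UNIV"
    by (rule has_sum_regroup[OF _ fin]) (use prod ww in simp)
  moreover have "(\<Sum>z | z \<in> UNIV \<times> UNIV \<and> ?m z = n. w z) = of_int (dconv f g (Suc n))" for n
  proof -
    have "(\<Sum>z | z \<in> UNIV \<times> UNIV \<and> ?m z = n. w z) = (\<Sum>d | d dvd Suc n. real_of_int (f (int d) * g (int (Suc n div d))))"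
    proof (rule sum.reindex_bij_witness[of _ "\<lambda>d. (d - 1, Suc n div d - 1)" "\<lambda>(d, e). Suc d"])
      fix z assume "z \<in> {z. z \<in> UNIV \<times> UNIV \<and> ?m z = n}"
      then obtain d e where z: "z = (d, e)" "d + e + d * e = n" by (cases z) auto
      have n: "Suc n = Suc d * Suc e" using z(2) by simp
      hence dv: "Suc n div Suc d = Suc e" by (metis nonzero_mult_div_cancel_left nat.distinct(1))
      show "(case z of (d, e) \<Rightarrow> Suc d) \<in> {d. d dvd Suc n}"
        unfolding z(1) mem_Collect_eq prod.case n by (rule dvd_triv_left)
      show "(case (case z of (d, e) \<Rightarrow> Suc d) of d \<Rightarrow> (d - 1, Suc n div d - 1)) = z" using dv by (simp add: z(1))
      show "real_of_int (f (int (case z of (d, e) \<Rightarrow> Suc d)) * g (int (Suc n div (case z of (d, e) \<Rightarrow> Suc d)))) = w z"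
        using dv unfolding w_def z(1) by (simp add: add.commute)
    next
      fix d assume "d \<in> {d. d dvd Suc n}"
      then obtain e where e: "Suc n = d * e" by blast
      have d0: "d > 0" "e > 0" using e by (auto intro!: Nat.gr0I)
      hence dv: "Suc n div d = e" unfolding e by simp
      obtain d' e' where de: "d = Suc d'" "e = Suc e'" using d0 gr0_implies_Suc by metis
      show "(case (d - 1, Suc n div d - 1) of (d, e) \<Rightarrow> Suc d) = d" using d0 by simp
      have "d' + e' + d' * e' = n" using e unfolding de by simp
      thus "(d - 1, Suc n div d - 1) \<in> {z. z \<in> UNIV \<times> UNIV \<and> ?m z = n}" unfolding dv unfolding de by simp
    qed
    thus ?thesis unfolding dconv_def by simp
  qed
  ultimately show ?thesis by simp
qed

theorem epstein_eq_L_series: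
  assumes s: "s > 1"
  shows "epstein_value 1 658 s + epstein_value 2 329 s - epstein_value 7 94 s - epstein_value 14 47 s =
    L_series chi8 s * L_series chi329 s + L_series chi7 s * L_series chi376 s"
proof -
  let ?p = "\<lambda>n. real (Suc n) powr (-s)"
  let ?N = "\<lambda>a c n. real (card (rep a c (Suc n)))"
  have "((\<lambda>n. ?N 1 658 n * ?p n + ?N 2 329 n * ?p n + (- 1) * (?N 7 94 n * ?p n) + (- 1) * (?N 14 47 n * ?p n)) has_sum
     (epstein_value 1 658 s + epstein_value 2 329 s + (- 1) * epstein_value 7 94 s + (- 1) * epstein_value 14 47 s)) UNIV"
    using epstein_has_sum_rep[of 1 658 s] epstein_has_sum_rep[of 2 329 s] epstein_has_sum_rep[of 7 94 s] epstein_has_sum_rep[of 14 47 s] s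
    by (intro has_sum_add has_sum_cmult_right) simp_all
  moreover have "?N 1 658 n * ?p n + ?N 2 329 n * ?p n + (- 1) * (?N 7 94 n * ?p n) + (- 1) * (?N 14 47 n * ?p n) =
      of_int (dconv chi8 chi329 (Suc n)) * ?p n + of_int (dconv chi7 chi376 (Suc n)) * ?p n" for n
  proof -
    have "real_of_int (rep_diff (Suc n)) = real_of_int (char_conv (Suc n))" using rep_diff_eq_char_conv[of "Suc n"] by simp
    hence e: "?N 1 658 n + ?N 2 329 n - ?N 7 94 n - ?N 14 47 n = of_int (dconv chi8 chi329 (Suc n)) + of_int (dconv chi7 chi376 (Suc n))"
      unfolding rep_diff_def char_conv_def by simp
    have "u1 * p + u2 * p + (- 1) * (u3 * p) + (- 1) * (u4 * p) = (u1 + u2 - u3 - u4) * p" for u1 u2 u3 u4 p :: real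
      by (simp add: algebra_simps)
    thus ?thesis unfolding e[symmetric] distrib_right[symmetric] .
  qed
  ultimately have 1: "((\<lambda>n. of_int (dconv chi8 chi329 (Suc n)) * ?p n + of_int (dconv chi7 chi376 (Suc n)) * ?p n) has_sum
     (epstein_value 1 658 s + epstein_value 2 329 s + (- 1) * epstein_value 7 94 s + (- 1) * epstein_value 14 47 s)) UNIV" by (simp only:)
  have 2: "((\<lambda>n. of_int (dconv chi8 chi329 (Suc n)) * ?p n + of_int (dconv chi7 chi376 (Suc n)) * ?p n) has_sum
     (L_series chi8 s * L_series chi329 s + L_series chi7 s * L_series chi376 s)) UNIV"
    by (intro has_sum_add L_series_mult_has_sum chi_bounds s)
  show ?thesis using has_sum_unique[OF 1 2] by simp
qed

theorem corollary2p10: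
  shows "b 94 7 = (412 * sqrt 7 - 159 * sqrt 47) * (732 * sqrt 2 - 151 * sqrt 47)"
proof -
  define u where "u = 412 * sqrt 7 + 159 * sqrt (47::real)"
  define v where "v = 732 * sqrt 2 + 151 * sqrt (47::real)"
  define r where "r = sqrt (658::real)"
  define q where "q = exp (- pi * sqrt (94 / 7))"
  have uv: "u > 0" "v > 0" unfolding u_def v_def by (auto intro: add_pos_pos)
  have r0: "r > 0" unfolding r_def by simp
  have "b 94 7 = 7 * exp (- (pi / 4) * (real 7 - 1) * sqrt (94 / 7)) *
      exp (2 * (ln_euler (q ^ 7) + ln_euler (q ^ (2 * 7)) - ln_euler q - ln_euler (q\<^sup>2)))"
    using b_eq[of 94 7] unfolding q_def by simp
  also have "\<dots> = exp (ln 7 - 3 * pi / 2 * sqrt (94 / 7) + 2 * (ln_euler (q ^ 7) + ln_euler (q ^ 14) - ln_euler q - ln_euler (q\<^sup>2)))"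
  proof -
    have 7: "7 * exp x * exp y = exp z" if "ln 7 + x + y = z" for x y z :: real
      unfolding that[symmetric] by (simp add: exp_add)
    show ?thesis by (rule 7) simp
  qed
  finally have b1: "b 94 7 = exp (ln 7 - 3 * pi / 2 * sqrt (94 / 7) + 2 * (ln_euler (q ^ 7) + ln_euler (q ^ 14) - ln_euler q - ln_euler (q\<^sup>2)))" .
  \<comment> \<open>The four ratios \<open>c / a\<close> differ only by rational squares, so all
    four nomes are powers of \<open>q\<close>.\<close>
  have sq: "sqrt 658 = 7 * sqrt (94 / 7)" "sqrt (329 / 2) = 7 / 2 * sqrt (94 / 7)" "sqrt (47 / 14) = 1 / 2 * sqrt (94 / 7)"
    by (rule real_sqrt_unique; simp add: power_mult_distrib power_divide)+
  have q1: "exp (- 2 * pi * sqrt 658) = q ^ 14" "exp (- 2 * pi * sqrt (329 / 2)) = q ^ 7"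
    "exp (- 2 * pi * sqrt (94 / 7)) = q\<^sup>2" "exp (- 2 * pi * sqrt (47 / 14)) = q"
    unfolding sq q_def exp_of_nat_mult[symmetric] by simp_all
  let ?D = "ln_euler (q ^ 14) + ln_euler (q ^ 7) - ln_euler (q\<^sup>2) - ln_euler q"
  have "((\<lambda>s. L_series chi8 s * L_series chi329 s + L_series chi7 s * L_series chi376 s) \<longlongrightarrow>
      3 * pi\<^sup>2 / 7 - 2 * pi / r * ln 7 - 4 * pi / r * ?D) (at_right 1)"
  proof (rule Lim_transform_eventually)
    show "((\<lambda>s. epstein_value 1 658 s + epstein_value 2 329 s - epstein_value 7 94 s - epstein_value 14 47 s) \<longlongrightarrow>
      3 * pi\<^sup>2 / 7 - 2 * pi / r * ln 7 - 4 * pi / r * ?D) (at_right 1)"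
      using epstein_combination_tendsto unfolding q1 r_def .
  qed (rule eventually_mono[OF eventually_at_right_less], rule epstein_eq_L_series)
  moreover have "((\<lambda>s. L_series chi8 s * L_series chi329 s + L_series chi7 s * L_series chi376 s) \<longlongrightarrow>
      pi / (2 * sqrt 2) * (2 * ln (2376415 + 131016 * sqrt 329) / sqrt 329)
      + pi / sqrt 7 * (ln (2143295 + 221064 * sqrt 94) / sqrt 94)) (at_right 1)"
    by (intro tendsto_intros L_series_8_limit L_series_329_limit L_series_7_limit L_series_376_limit)
  ultimately have "3 * pi\<^sup>2 / 7 - 2 * pi / r * ln 7 - 4 * pi / r * ?D =
      pi / (2 * sqrt 2) * (2 * ln (2376415 + 131016 * sqrt 329) / sqrt 329)
      + pi / sqrt 7 * (ln (2143295 + 221064 * sqrt 94) / sqrt 94)"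
    by (intro tendsto_unique[of "at_right (1::real)"]) auto
  \<comment> \<open>The integers \<open>7 * 412^2\<close> and \<open>47 * 159^2\<close> are
    consecutive with sum 2376415, and \<open>2 * 732^2\<close> and \<open>47 * 151^2\<close> are
    consecutive with sum 2143295. Hence both units are squares in biquadratic fields.\<close>
  also have "2376415 + 131016 * sqrt 329 = u\<^sup>2"
  proof -
    have "sqrt 329 = sqrt 7 * sqrt (47::real)" by (simp flip: real_sqrt_mult)
    thus ?thesis unfolding u_def by (simp add: power2_sum power_mult_distrib)
  qed
  also have "2143295 + 221064 * sqrt 94 = v\<^sup>2"
  proof -
    have "sqrt 94 = sqrt 2 * sqrt (47::real)" by (simp flip: real_sqrt_mult)
    thus ?thesis unfolding v_def by (simp add: power2_sum power_mult_distrib)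
  qed
  also have "ln (u\<^sup>2) = 2 * ln u" by (simp add: ln_realpow)
  also have "ln (v\<^sup>2) = 2 * ln v" by (simp add: ln_realpow)
  also have "pi / (2 * sqrt 2) * (2 * (2 * ln u) / sqrt 329) + pi / sqrt 7 * (2 * ln v / sqrt 94) = 2 * pi / r * (ln u + ln v)"
  proof -
    have "r = sqrt 2 * sqrt 329" "r = sqrt 7 * sqrt 94" unfolding r_def by (simp_all flip: real_sqrt_mult)
    hence "pi / (2 * sqrt 2) * (2 * (2 * ln u) / sqrt 329) = 2 * pi / r * ln u" "pi / sqrt 7 * (2 * ln v / sqrt 94) = 2 * pi / r * ln v"
      by simp_all
    thus ?thesis by (simp add: distrib_left)
  qed
  finally have E: "3 * pi\<^sup>2 / 7 - 2 * pi / r * ln 7 - 4 * pi / r * ?D = 2 * pi / r * (ln u + ln v)" .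
  have "2 * pi / r * (3 * pi * r / 14 - ln 7 - 2 * ?D) = 2 * pi / r * (ln u + ln v)"
    unfolding E[symmetric] using r0 by (simp add: field_simps power2_eq_square)
  hence "3 * pi * r / 14 - ln 7 - 2 * ?D = ln u + ln v" using r0 by simp
  \<comment> \<open>This turns \<open>3 * pi * r / 14\<close> into the exponent of the prefactor of
    \<open>b 94 7\<close>.\<close>
  moreover have "r = 7 * sqrt (94 / 7)" unfolding r_def by (rule sq)
  ultimately have "ln 7 - 3 * pi / 2 * sqrt (94 / 7) + 2 * (ln_euler (q ^ 7) + ln_euler (q ^ 14) - ln_euler q - ln_euler (q\<^sup>2)) = - ln u - ln v"
    by simp
  hence "b 94 7 = exp (- ln u - ln v)" unfolding b1 by simp
  also have "\<dots> = inverse u * inverse v" using uv by (simp add: exp_diff exp_minus divide_inverse)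
  also have "inverse u = 412 * sqrt 7 - 159 * sqrt 47"
  proof (rule inverse_unique)
    have "u * (412 * sqrt 7 - 159 * sqrt 47) = (412 * sqrt 7)\<^sup>2 - (159 * sqrt 47)\<^sup>2"
      unfolding u_def by (simp only: power2_eq_square square_diff_square_factored)
    thus "u * (412 * sqrt 7 - 159 * sqrt 47) = 1" by (simp add: power_mult_distrib)
  qed
  also have "inverse v = 732 * sqrt 2 - 151 * sqrt 47"
  proof (rule inverse_unique)
    have "v * (732 * sqrt 2 - 151 * sqrt 47) = (732 * sqrt 2)\<^sup>2 - (151 * sqrt 47)\<^sup>2"
      unfolding v_def by (simp only: power2_eq_square square_diff_square_factored)
    thus "v * (732 * sqrt 2 - 151 * sqrt 47) = 1" by (simp add: power_mult_distrib)
  qed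
  finally show ?thesis .
qed

end
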